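(* Let $d,d_1\ge 1$, let $\Sigma=(\sigma^{ij})_{1\le i\le d,\,1\le j\le d_1}$ have Borel measurable entries on $\mathbb{R}^d$, let $b=(b^i)_{1\le i\le d}$ be a Borel vector field on $\mathbb{R}^d$, and set $A=\Sigma\Sigma^t$. Suppose that either $q(x,y)>0$ for all $x\neq y$, or $q(x,y)<0$ for all $x\neq y$. Then there exists at most one probability solution $\mu$ to the equation $L^*\mu=0$ satisfying $$\int_{\mathbb{R}^d}\bigl(\|\Sigma(x)\|^2+|b(x)|\,|x|\bigr)\,\mu(dx)<\infty.$$
   Context: For a symmetric nonnegative definite matrix $A(x)=(a^{ij}(x))$ and a vector field $b(x)=(b^i(x))$ with Borel measurable entries, $Lf(x)=\mathrm{trace}(A(x)D^2f(x))+\langle b(x),\nabla f(x)\rangle$. A probability solution to $L^*\mu=0$ is a Borel probability measure $\mu$ on $\mathbb{R}^d$ such that all $a^{ij}$ and $b^i$ are $\mu$-integrable on every compact set and $\int_{\mathbb{R}^d}Lf\,d\mu=0$ for every $f\in C_0^\infty(\mathbb{R}^d)$. Here $A(x)=\Sigma(x)\Sigma(x)^t$ with $\Sigma(x)$ a $d\times d_1$ matrix, and $$q(x,y)=\langle x-y,b(x)-b(y)\rangle+\mathrm{trace}\bigl((\Sigma(x)-\Sigma(y))(\Sigma(x)-\Sigma(y))^t\bigr).$$ $\|\cdot\|$ denotes a matrix norm, $|\cdot|$ the Euclidean norm. *)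

theory Defs
  imports "HOL-Probability.Probability"
begin

definition pdiff :: "'n::finite \<Rightarrow> (real^'n \<Rightarrow> real) \<Rightarrow> real^'n \<Rightarrow> real" where
  "pdiff i f x = frechet_derivative f (at x) (axis i 1)"

fun iter_pdiff :: "'n::finite list \<Rightarrow> (real^'n \<Rightarrow> real) \<Rightarrow> real^'n \<Rightarrow> real" where
  "iter_pdiff [] f = f"
| "iter_pdiff (i # is) f = pdiff i (iter_pdiff is f)"

definition C0_inf :: "(real^'n::finite \<Rightarrow> real) set" where
  "C0_inf = {f. (\<forall>is x. iter_pdiff is f differentiable (at x))
               \<and> compact (closure {x. f x \<noteq> 0})}"

definition diff_op ::
  "(real^'n \<Rightarrow> real^'m::finite^'n::finite) \<Rightarrow> (real^'n \<Rightarrow> real^'n)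
     \<Rightarrow> (real^'n \<Rightarrow> real) \<Rightarrow> real^'n \<Rightarrow> real" where
  "diff_op Sig b f x =
     (\<Sum>i\<in>UNIV. \<Sum>j\<in>UNIV. ((Sig x ** transpose (Sig x)) $ i $ j) * pdiff i (pdiff j f) x)
     + (\<Sum>i\<in>UNIV. (b x $ i) * pdiff i f x)"

definition prob_solution ::
  "(real^'n \<Rightarrow> real^'m::finite^'n::finite) \<Rightarrow> (real^'n \<Rightarrow> real^'n) \<Rightarrow> (real^'n) measure \<Rightarrow> bool" where
  "prob_solution Sig b \<mu> \<longleftrightarrow>
     sets \<mu> = sets borel \<and> prob_space \<mu> \<and>
     (\<forall>K i j. compact K \<longrightarrow> set_integrable \<mu> K (\<lambda>x. (Sig x ** transpose (Sig x)) $ i $ j)) \<and>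
     (\<forall>K i. compact K \<longrightarrow> set_integrable \<mu> K (\<lambda>x. b x $ i)) \<and>
     (\<forall>f \<in> C0_inf. (\<integral>x. diff_op Sig b f x \<partial>\<mu>) = 0)"

definition qfun ::
  "(real^'n \<Rightarrow> real^'m::finite^'n::finite) \<Rightarrow> (real^'n \<Rightarrow> real^'n) \<Rightarrow> real^'n \<Rightarrow> real^'n \<Rightarrow> real" where
  "qfun Sig b x y = inner (x - y) (b x - b y)
     + trace ((Sig x - Sig y) ** transpose (Sig x - Sig y))"

end

theory Submission
  imports Defs
begin

text \<open>
  Expansive case \<open>q > 0\<close>. Testing the equation against cut-offs of \<open>x\<^sub>i\<close> and of \<open>|x|\<^sup>2\<close> gives
  \<open>\<integral> b d\<mu> = 0\<close> and \<open>\<integral> (\<langle>x, b\<rangle> + |\<Sigma>|\<^sup>2) d\<mu> = 0\<close>, hence \<open>\<integral>\<integral> q d\<mu> d\<mu> = - 2 |\<integral> \<Sigma> d\<mu>|\<^sup>2 \<le> 0\<close>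
  (with a truncation, since \<open>x\<close> need not be integrable). So \<open>\<mu>\<close> is a Dirac mass at a common zero of \<open>b\<close> and
  \<open>\<Sigma>\<close>, and \<open>q\<close> vanishes at a pair of such points.

  Dissipative case \<open>q < 0\<close>. Mollify \<open>\<mu>\<close> and \<open>\<nu>\<close> at scale \<open>\<epsilon>\<close> and take an almost optimal coupling \<open>(x, y)\<close> of the
  mollified measures for the bounded payoff \<open>k (x - y) = exp (- |x - y|\<^sup>2 / 2)\<close>; resample the unmollified
  points \<open>X\<close>, \<open>Y\<close>. Move \<open>x\<close> and \<open>y\<close> by one Euler step of length \<open>h\<close> with (truncated) coefficients frozen at \<open>X\<close>
  and \<open>Y\<close>, driven by the same noise. Because \<open>L\<^sup>*\<mu> = 0\<close>, the marginal densities change only by \<open>o(h)\<close> in \<open>L\<^sup>1\<close>, while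
  the payoff grows by at least \<open>h \<integral> k |q|\<close> up to small errors. Almost optimality forces \<open>\<integral> k |q|\<close> to be small,
  so the law of \<open>(X, Y)\<close>, a coupling of \<open>\<mu>\<close> and \<open>\<nu>\<close>, concentrates near the diagonal.
\<close>

section \<open>Smooth test functions\<close>

text \<open>The coefficients are only Borel and \<open>A\<close> may degenerate, so no flow or
  semigroup is at hand; \<mu> is known only through integrals against test functions. Mollification
  makes these usable: as a function of the averaged point, \<rho> (x - X) is a test function. The
  coefficients, however, belong to the unmollified point. Hence this point is resampled, and the
  step depends on it alone: the density after the step is then an integral of translates of \<rho>,
  with no Jacobian. The cost \<open>|x - y|^2\<close> could have infinite integral, as second
  moments are not assumed. The Gaussian \<open>k\<close> is bounded; its gradient at
  \<open>z\<close> is \<open>- k z\<close>, and its second derivative along \<open>u\<close> is at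
  least \<open>- k |u|^2\<close>. With noise of covariance \<open>2 h S S^t\<close> the mean gain is
  therefore at least \<open>- h k q\<close> to first order, with exactly the constants of
  \<open>q\<close>. Almost optimality is required only up to \<open>h^2\<close>, which is negligible
  against gains of order \<open>h\<close>; no optimal plan has to exist and no limit of couplings is
  taken.\<close>

definition flat_exp :: "real poly \<Rightarrow> real \<Rightarrow> real" where
  "flat_exp p t = (if t > 0 then poly p (1 / t) * exp (- (1 / t)) else 0)"

lemma poly_times_exp_minus_tendsto_0:
  fixes p :: "real poly"
  shows "((\<lambda>s. poly p s * exp (- s)) \<longlongrightarrow> 0) at_top"
proof -
  have 1: "((\<lambda>s::real. s ^ k * exp (- s)) \<longlongrightarrow> 0) at_top" for k :: nat
    using tendsto_power_div_exp_0[of k] unfolding exp_minus divide_inverse .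
  have "((\<lambda>s. \<Sum>i\<le>degree p. coeff p i * (s ^ i * exp (- s))) \<longlongrightarrow> (\<Sum>i\<le>degree p. coeff p i * 0)) at_top"
    by (intro tendsto_sum tendsto_mult tendsto_const 1)
  then show ?thesis by (simp add: poly_altdef sum_distrib_right mult.assoc)
qed

text \<open>With \<open>s = 1 / t\<close> one has \<open>d/dt = - s^2 d/ds\<close>, so
  \<open>p(s) exp(-s)\<close> turns into \<open>s^2 (p - p')(s) exp(-s)\<close>: the family is
  closed under differentiation. At the origin the exponential beats every power of
  \<open>1 / t\<close>.\<close>

lemma flat_exp_has_derivative:
  "(flat_exp p has_real_derivative flat_exp ([:0, 0, 1:] * (p - pderiv p)) t) (at t)"
proof -
  consider "t > 0" | "t < 0" | "t = 0" by linarith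
  then show ?thesis
  proof cases
    case 1
    have "((\<lambda>t. poly p (1 / t) * exp (- (1 / t))) has_real_derivative
        flat_exp ([:0, 0, 1:] * (p - pderiv p)) t) (at t)"
      using 1 by (auto intro!: derivative_eq_intros poly_DERIV[THEN DERIV_chain2]
          simp: flat_exp_def field_simps power2_eq_square)
    then show ?thesis
      by (rule DERIV_cong_ev[THEN iffD1, rotated -1])
        (use 1 in \<open>auto simp: flat_exp_def intro!: eventually_mono[OF eventually_gt_at_top]
            eventually_nhds_in_open[of "{0<..}", THEN eventually_mono]\<close>)
  next
    case 2
    have "((\<lambda>t. 0) has_real_derivative flat_exp ([:0, 0, 1:] * (p - pderiv p)) t) (at t)"
      using 2 by (auto simp: flat_exp_def)
    then show ?thesis
      by (rule DERIV_cong_ev[THEN iffD1, rotated -1])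
        (use 2 in \<open>auto simp: flat_exp_def intro!: 
            eventually_nhds_in_open[of "{..<0}", THEN eventually_mono]\<close>)
  next
    case 3
    \<comment> \<open>\<open>pCons 0 p\<close> absorbs the factor \<open>1 / h\<close> of the
      difference quotient.\<close>
    have "((\<lambda>h. poly (pCons 0 p) (inverse h) * exp (- inverse h)) \<longlongrightarrow> 0) (at_right 0)"
      by (rule filterlim_compose[OF poly_times_exp_minus_tendsto_0 filterlim_inverse_at_top_right])
    then have r: "((\<lambda>h. flat_exp p h / h) \<longlongrightarrow> 0) (at_right 0)"
      by (rule Lim_transform_eventually)
        (auto simp: eventually_at_right_field flat_exp_def field_simps intro!: exI[of _ 1])
    have l: "((\<lambda>h. flat_exp p h / h) \<longlongrightarrow> 0) (at_left 0)"
      by (rule Lim_transform_eventually[OF tendsto_const])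
        (auto simp: eventually_at_left_field flat_exp_def intro!: exI[of _ "-1"])
    from l r have "((\<lambda>h. flat_exp p h / h) \<longlongrightarrow> 0) (at 0)"
      by (simp add: filterlim_split_at)
    then show ?thesis using 3 by (simp add: DERIV_def flat_exp_def)
  qed
qed

text \<open>A generator vanishes off \<open>(-1, 1)\<close> because one of its factors does, and the
  product rule turns it into a sum of two generators. Closing under sums thus gives a family stable
  under differentiation.\<close>

inductive_set bump_algebra :: "(real \<Rightarrow> real) set" where
  base: "(\<lambda>t. flat_exp p (1 + t) * flat_exp q (1 - t)) \<in> bump_algebra"
| add: "f \<in> bump_algebra \<Longrightarrow> g \<in> bump_algebra \<Longrightarrow> (\<lambda>t. f t + g t) \<in> bump_algebra"

lemma bump_algebra_derivative:
  "f \<in> bump_algebra \<Longrightarrow> \<exists>g\<in>bump_algebra. \<forall>t. (f has_real_derivative g t) (at t)"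
proof (induction rule: bump_algebra.induct)
  case (base p q)
  let ?D = "\<lambda>p. [:0, 0, 1:] * (p - pderiv p)"
  let ?g = "\<lambda>t. flat_exp (?D p) (1 + t) * flat_exp q (1 - t) + flat_exp p (1 + t) * flat_exp (- ?D q) (1 - t)"
  have neg: "flat_exp (- p) t = - flat_exp p t" for p t by (simp add: flat_exp_def)
  have "((\<lambda>t. flat_exp p (1 + t) * flat_exp q (1 - t)) has_real_derivative ?g t) (at t)" for t
  proof -
    have a: "((\<lambda>t. flat_exp p (1 + t)) has_real_derivative flat_exp (?D p) (1 + t) * 1) (at t)"
      by (rule DERIV_chain2[OF flat_exp_has_derivative]) (auto intro!: derivative_eq_intros)
    have b: "((\<lambda>t. flat_exp q (1 - t)) has_real_derivative flat_exp (?D q) (1 - t) * (- 1)) (at t)"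
      by (rule DERIV_chain2[OF flat_exp_has_derivative]) (auto intro!: derivative_eq_intros)
    show ?thesis
      by (rule DERIV_cong[OF DERIV_mult[OF a b]]) (simp only: neg, simp)
  qed
  moreover have "?g \<in> bump_algebra"
    by (intro bump_algebra.intros)
  ultimately show ?case by (intro bexI[of _ ?g] allI)
next
  case (add f g)
  then obtain f' g' where "f' \<in> bump_algebra" "g' \<in> bump_algebra"
    "\<And>t. (f has_real_derivative f' t) (at t)" "\<And>t. (g has_real_derivative g' t) (at t)"
    by blast
  then show ?case
    by (intro bexI[of _ "\<lambda>t. f' t + g' t"]) (auto intro!: DERIV_add bump_algebra.add)
qed

lemma bump_algebra_support: "f \<in> bump_algebra \<Longrightarrow> \<bar>t\<bar> \<ge> 1 \<Longrightarrow> f t = 0"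
  by (induction rule: bump_algebra.induct) (auto simp: flat_exp_def)

text \<open>As \<open>1/(1+t) + 1/(1-t) = 2/(1-t^2)\<close>, the base function is the standard bump
  \<open>exp (-2/(1-t^2))\<close> on \<open>(-1, 1)\<close>. Having all its derivatives under one
  name gives closed forms for iterated partial derivatives of tensor products.\<close>

definition bump :: "nat \<Rightarrow> real \<Rightarrow> real" where
  "bump n = (deriv ^^ n) (\<lambda>t. flat_exp 1 (1 + t) * flat_exp 1 (1 - t))"

lemma bump_in_algebra: "bump n \<in> bump_algebra"
proof (induction n)
  case 0
  show ?case by (auto simp: bump_def intro: bump_algebra.base)
next
  case (Suc n)
  then obtain g where g: "g \<in> bump_algebra" "\<And>t. (bump n has_real_derivative g t) (at t)"
    using bump_algebra_derivative by blast
  then have "deriv (bump n) = g" by (auto intro!: ext DERIV_imp_deriv)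
  then show ?case using g by (simp add: bump_def)
qed

lemma bump_has_derivative: "(bump n has_real_derivative bump (Suc n) t) (at t)"
proof -
  obtain g where g: "g \<in> bump_algebra" "\<And>t. (bump n has_real_derivative g t) (at t)"
    using bump_algebra_derivative bump_in_algebra by blast
  then have "deriv (bump n) = g" by (auto intro!: ext DERIV_imp_deriv)
  then show ?thesis using g by (simp add: bump_def)
qed

lemma bump_support: "\<bar>t\<bar> \<ge> 1 \<Longrightarrow> bump n t = 0"
  using bump_algebra_support bump_in_algebra by blast

lemma isCont_bump: "isCont (bump n) t"
  using bump_has_derivative DERIV_isCont by blast

lemma continuous_on_bump [continuous_intros]:
  "continuous_on S f \<Longrightarrow> continuous_on S (\<lambda>x. bump n (f x))"
  by (rule continuous_on_compose2[of UNIV "bump n"]) (auto simp: continuous_on_eq_continuous_at isCont_bump)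

lemma bump_bounded: "\<exists>C\<ge>1. \<forall>n\<le>N. \<forall>t. \<bar>bump n t\<bar> \<le> C"
proof -
  have "\<exists>C. \<forall>t. \<bar>bump n t\<bar> \<le> C" for n
  proof -
    have "compact (bump n ` {-1..1})"
      by (intro compact_continuous_image continuous_intros) auto
    then obtain C where C: "\<forall>x\<in>bump n ` {-1..1}. norm x \<le> C"
      using compact_imp_bounded bounded_iff by metis
    have "\<bar>bump n t\<bar> \<le> max C 0" for t
    proof (cases "\<bar>t\<bar> \<ge> 1")
      case True
      then show ?thesis using bump_support[of t n] by simp
    next
      case False
      then have "bump n t \<in> bump n ` {-1..1}" by (intro imageI) auto
      then have "norm (bump n t) \<le> C" using C by blast
      then show ?thesis by simp
    qed
    then show ?thesis by blast
  qed
  then obtain C where C: "\<And>n t. \<bar>bump n t\<bar> \<le> C n" by metis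
  have C0: "C n \<ge> 0" for n using C[of n 0] by linarith
  have "\<bar>bump n t\<bar> \<le> 1 + (\<Sum>i\<le>N. C i)" if "n \<le> N" for n t
    using C[of n t] member_le_sum[of n "{..N}" C] that C0 by fastforce
  moreover have "1 + (\<Sum>i\<le>N. C i) \<ge> 1" using C0 by (simp add: sum_nonneg)
  ultimately show ?thesis by blast
qed

lemma bump_0_eq: "\<bar>t\<bar> < 1 \<Longrightarrow> bump 0 t = exp (- 2 / (1 - t\<^sup>2))"
proof -
  assume "\<bar>t\<bar> < 1"
  then have "1 + t > 0" "1 - t > 0" "1 - t\<^sup>2 > 0"
    by (auto simp: abs_square_less_1)
  moreover have "1 - t\<^sup>2 = (1 + t) * (1 - t)" by (simp add: power2_eq_square algebra_simps)
  ultimately show ?thesis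
    by (simp add: bump_def flat_exp_def exp_add[symmetric] field_simps)
qed

lemma bump_0_nonneg: "bump 0 t \<ge> 0"
  by (simp add: bump_def flat_exp_def)

text \<open>The explicit formula shows that \<open>bump 1\<close> vanishes at 0 but not at 1/2, and
  leads to \<open>bump 2 0\<close>. These values enter the nonzero constants by which the expansive
  case divides.\<close>

lemma bump_1_eq: "\<bar>t\<bar> < 1 \<Longrightarrow> bump 1 t = - 4 * t / (1 - t\<^sup>2)\<^sup>2 * exp (- 2 / (1 - t\<^sup>2))"
proof -
  assume t: "\<bar>t\<bar> < 1"
  then have n: "1 - t\<^sup>2 > 0" by (auto simp: abs_square_less_1)
  have "((\<lambda>t. exp (- 2 / (1 - t\<^sup>2))) has_real_derivative
      - 4 * t / (1 - t\<^sup>2)\<^sup>2 * exp (- 2 / (1 - t\<^sup>2))) (at t)"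
    using n by (auto intro!: derivative_eq_intros simp: field_simps power2_eq_square)
  then have "(bump 0 has_real_derivative - 4 * t / (1 - t\<^sup>2)\<^sup>2 * exp (- 2 / (1 - t\<^sup>2))) (at t)"
    by (rule DERIV_cong_ev[THEN iffD1, rotated -1])
      (use t in \<open>auto simp: bump_0_eq intro!:
        eventually_nhds_in_open[of "{-1<..<1}", THEN eventually_mono]\<close>)
  then show ?thesis using bump_has_derivative[of 0 t] DERIV_unique by auto
qed

lemma bump_2_at_0: "bump 2 0 = - 4 * exp (- 2)"
proof -
  have "((\<lambda>t::real. - 4 * t / (1 - t\<^sup>2)\<^sup>2 * exp (- 2 / (1 - t\<^sup>2))) has_real_derivative
      - 4 * exp (- 2)) (at 0)"
    by (auto intro!: derivative_eq_intros)
  then have "(bump 1 has_real_derivative - 4 * exp (- 2)) (at 0)"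
    by (rule DERIV_cong_ev[THEN iffD1, rotated -1])
      (auto simp: bump_1_eq[unfolded One_nat_def] intro!:
        eventually_nhds_in_open[of "{-1<..<1}", THEN eventually_mono])
  then show ?thesis using bump_has_derivative[of 1 0] DERIV_unique
    by (auto simp: numeral_2_eq_2)
qed

text \<open>One family plays every role: the mollifier (\<open>a = 0\<close>), the mollifier as a
  function of the averaged point (\<open>s\<close> negative, \<open>a\<close> a multiple of
  \<open>x\<close>), and cut-offs of a coordinate and of \<open>|x|^2\<close> (small
  \<open>s\<close>, large \<open>c\<close>). A product of one-variable bumps keeps all partial
  derivatives explicit.\<close>

definition tbump :: "real \<Rightarrow> real \<Rightarrow> real^'n \<Rightarrow> real^'n::finite \<Rightarrow> real" where
  "tbump c s a x = c * (\<Prod>i\<in>UNIV. bump 0 (a $ i + s * x $ i))"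

lemma tensor_has_derivative:
  fixes g g' :: "'n::finite \<Rightarrow> real \<Rightarrow> real"
  assumes "\<And>i t. (g i has_real_derivative g' i t) (at t)"
  shows "((\<lambda>x::real^'n. \<Prod>i\<in>UNIV. g i (x $ i)) has_derivative
    (\<lambda>y. \<Sum>i\<in>UNIV. (g' i (x $ i) * y $ i) * (\<Prod>j\<in>UNIV - {i}. g j (x $ j)))) (at x)"
proof -
  have *: "((\<lambda>x::real^'n. g i (x $ i)) has_derivative (\<lambda>y. g' i (x $ i) * y $ i)) (at x)" for i
  proof -
    have "(g i has_derivative (\<lambda>y. g' i (x $ i) * y)) (at (x $ i))"
      using assms[of i "x $ i"] by (simp add: has_field_derivative_def)
    then show ?thesis
      by (rule has_derivative_compose[rotated])
        (rule bounded_linear_imp_has_derivative, rule bounded_linear_vec_nth)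
  qed
  show ?thesis
    using has_derivative_prod[of UNIV "\<lambda>i x. g i (x $ i)" "\<lambda>i y. g' i (x $ i) * y $ i" x UNIV] *
    by simp
qed

text \<open>Each partial derivative raises the order of one factor and releases one factor
  \<open>s\<close>, so factor \<open>i\<close> is differentiated as often as \<open>i\<close> occurs
  in the list. Smoothness and bounds then reduce to one variable.\<close>

lemma
  fixes a :: "real^'n::finite"
  shows iter_pdiff_tbump: "iter_pdiff is (tbump c s a) =
      (\<lambda>x. c * s ^ length is * (\<Prod>i\<in>UNIV. bump (count_list is i) (a $ i + s * x $ i)))"
    and iter_pdiff_tbump_differentiable: "iter_pdiff is (tbump c s a) differentiable (at x)"
proof -
  have der: "((\<lambda>x. c * s ^ length is * (\<Prod>i\<in>UNIV. bump (count_list is i) (a $ i + s * x $ i)))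
     has_derivative (\<lambda>y. c * s ^ length is * (\<Sum>i\<in>UNIV.
        ((s * bump (Suc (count_list is i)) (a $ i + s * x $ i)) * y $ i) *
        (\<Prod>j\<in>UNIV - {i}. bump (count_list is j) (a $ j + s * x $ j))))) (at x)" for "is" x
  proof -
    have "((\<lambda>t. bump (count_list is i) (a $ i + s * t)) has_real_derivative
        s * bump (Suc (count_list is i)) (a $ i + s * t)) (at t)" for i t
    proof -
      have "((\<lambda>t. a $ i + s * t) has_real_derivative s) (at t)"
        by (auto intro!: derivative_eq_intros)
      from DERIV_chain2[OF bump_has_derivative this] show ?thesis by (simp add: mult.commute)
    qed
    from tensor_has_derivative[OF this, where x=x]
    show ?thesis by (rule has_derivative_mult_right)
  qed
  have eq: "iter_pdiff is (tbump c s a) =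
      (\<lambda>x. c * s ^ length is * (\<Prod>i\<in>UNIV. bump (count_list is i) (a $ i + s * x $ i)))" for "is"
  proof (induction "is")
    case Nil
    show ?case by (auto simp: tbump_def)
  next
    case (Cons k ks)
    have "pdiff k (iter_pdiff ks (tbump c s a)) x =
      c * s ^ Suc (length ks) * (\<Prod>i\<in>UNIV. bump (count_list (k # ks) i) (a $ i + s * x $ i))" for x
    proof -
      have "pdiff k (iter_pdiff ks (tbump c s a)) x = c * s ^ length ks * (\<Sum>i\<in>UNIV.
        ((s * bump (Suc (count_list ks i)) (a $ i + s * x $ i)) * axis k 1 $ i) *
        (\<Prod>j\<in>UNIV - {i}. bump (count_list ks j) (a $ j + s * x $ j)))"
        unfolding pdiff_def Cons.IH frechet_derivative_at[OF der, symmetric] ..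
      also have "(\<Sum>i\<in>UNIV.
        ((s * bump (Suc (count_list ks i)) (a $ i + s * x $ i)) * axis k 1 $ i) *
        (\<Prod>j\<in>UNIV - {i}. bump (count_list ks j) (a $ j + s * x $ j))) =
        (\<Sum>i\<in>{k}. (s * bump (Suc (count_list ks i)) (a $ i + s * x $ i)) *
        (\<Prod>j\<in>UNIV - {i}. bump (count_list ks j) (a $ j + s * x $ j)))"
        by (rule sum.mono_neutral_cong_right) (auto simp: axis_def)
      also have "\<dots> = s * (\<Prod>i\<in>UNIV. bump (count_list (k # ks) i) (a $ i + s * x $ i))"
        by (subst prod.remove[of UNIV k]) (auto intro!: prod.cong)
      finally show ?thesis by simp
    qed
    then show ?case by auto
  qed
  show "iter_pdiff is (tbump c s a) =
      (\<lambda>x. c * s ^ length is * (\<Prod>i\<in>UNIV. bump (count_list is i) (a $ i + s * x $ i)))"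
    by (rule eq)
  show "iter_pdiff is (tbump c s a) differentiable (at x)"
    unfolding eq using der differentiableI by blast
qed

lemma tbump_nonzeroD:
  assumes "tbump c s a x \<noteq> 0"
  shows "\<bar>a $ i + s * x $ i\<bar> < 1"
  using assms bump_support[of "a $ i + s * x $ i" 0] by (force simp: tbump_def)

lemma tbump_C0_inf:
  assumes "s \<noteq> 0"
  shows "tbump c s a \<in> C0_inf"
proof -
  have "{x. tbump c s a x \<noteq> 0} \<subseteq> cbox (\<chi> i. - (1 + \<bar>a $ i\<bar>) / \<bar>s\<bar>) (\<chi> i. (1 + \<bar>a $ i\<bar>) / \<bar>s\<bar>)"
  proof (clarsimp simp: mem_box_cart)
    fix x i assume "tbump c s a x \<noteq> 0"
    then have "\<bar>s * x $ i\<bar> \<le> 1 + \<bar>a $ i\<bar>" using tbump_nonzeroD[of c s a x i] by linarith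
    then have "\<bar>x $ i\<bar> \<le> (1 + \<bar>a $ i\<bar>) / \<bar>s\<bar>"
      using assms by (simp add: abs_mult field_simps)
    moreover have "(- 1 - \<bar>a $ i\<bar>) / \<bar>s\<bar> = - ((1 + \<bar>a $ i\<bar>) / \<bar>s\<bar>)"
      by (simp add: minus_divide_left)
    ultimately show "(- 1 - \<bar>a $ i\<bar>) / \<bar>s\<bar> \<le> x $ i \<and> x $ i \<le> (1 + \<bar>a $ i\<bar>) / \<bar>s\<bar>"
      by linarith
  qed
  then have "bounded {x. tbump c s a x \<noteq> 0}" using bounded_cbox bounded_subset by blast
  then show ?thesis
    using iter_pdiff_tbump_differentiable by (auto simp: C0_inf_def)
qed

lemma iter_pdiff_tbump_bound:
  fixes a :: "real^'n::finite"
  assumes "\<And>n t. n \<le> N \<Longrightarrow> \<bar>bump n t\<bar> \<le> C" "length is \<le> N"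
  shows "\<bar>iter_pdiff is (tbump c s a) x\<bar> \<le> \<bar>c\<bar> * \<bar>s\<bar> ^ length is * C ^ CARD('n)"
proof -
  have "count_list is i \<le> N" for i using count_le_length[of "is" i] assms(2) by linarith
  then have "(\<Prod>i\<in>UNIV. \<bar>bump (count_list is i) (a $ i + s * x $ i)\<bar>) \<le> (\<Prod>i\<in>(UNIV::'n set). C)"
    by (intro prod_mono) (auto intro: assms)
  then show ?thesis
    by (simp add: iter_pdiff_tbump abs_mult abs_prod power_abs mult_left_mono)
qed

section \<open>Taylor expansion of the generator\<close>

text \<open>The norm of \<open>real^'m^'n\<close> is the Euclidean norm of all entries, that is, the
  Frobenius norm. The trace term of \<open>qfun\<close> becomes a squared norm.\<close>

lemma trace_mult_transpose:
  fixes S :: "real^'m::finite^'n::finite"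
  shows "trace (S ** transpose S) = (norm S)\<^sup>2"
proof -
  have "(norm S)\<^sup>2 = S \<bullet> S" by (simp add: power2_norm_eq_inner)
  then show ?thesis
    by (simp add: trace_def matrix_matrix_mult_def transpose_def inner_vec_def)
qed

lemma sum_norm_column_power2:
  fixes S :: "real^'m::finite^'n::finite"
  shows "(\<Sum>j\<in>UNIV. (norm (column j S))\<^sup>2) = (norm S)\<^sup>2"
proof -
  have "(\<Sum>j\<in>UNIV. (norm (column j S))\<^sup>2) = (\<Sum>j\<in>UNIV. \<Sum>i\<in>UNIV. S $ i $ j * S $ i $ j)"
    by (simp add: power2_norm_eq_inner inner_vec_def column_def)
  also have "\<dots> = (\<Sum>i\<in>UNIV. \<Sum>j\<in>UNIV. S $ i $ j * S $ i $ j)" by (rule sum.swap)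
  also have "\<dots> = (norm S)\<^sup>2" by (simp add: power2_norm_eq_inner inner_vec_def)
  finally show ?thesis .
qed

lemma norm_column_le_norm:
  fixes S :: "real^'m::finite^'n::finite"
  shows "norm (column j S) \<le> norm S"
proof (rule power2_le_imp_le)
  show "(norm (column j S))\<^sup>2 \<le> (norm S)\<^sup>2"
    unfolding sum_norm_column_power2[symmetric] by (rule member_le_sum) auto
qed simp

lemma sum_abs_le_card_norm:
  fixes u :: "real^'n::finite"
  shows "(\<Sum>i\<in>UNIV. \<bar>u $ i\<bar>) \<le> CARD('n) * norm u"
  using sum_bounded_above[of UNIV "\<lambda>i. \<bar>u $ i\<bar>" "norm u"] component_le_norm_cart by auto

lemma line_has_derivative:
  fixes f :: "real^'n::finite \<Rightarrow> real"
  assumes "\<And>x. f differentiable (at x)"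
  shows "((\<lambda>t. f (x + t *\<^sub>R u)) has_real_derivative (\<Sum>i\<in>UNIV. u $ i * pdiff i f (x + t *\<^sub>R u))) (at t)"
proof -
  let ?D = "frechet_derivative f (at (x + t *\<^sub>R u))"
  have D: "(f has_derivative ?D) (at (x + t *\<^sub>R u))"
    using assms frechet_derivative_works by blast
  then have lin: "linear ?D" by (rule has_derivative_linear)
  have "u = (\<Sum>i\<in>UNIV. u $ i *\<^sub>R axis i 1)"
    by (simp add: vec_eq_iff axis_def if_distrib[of "\<lambda>x. _ * x"] cong: if_cong)
  then have "?D u = ?D (\<Sum>i\<in>UNIV. u $ i *\<^sub>R axis i 1)" by simp
  also have "\<dots> = (\<Sum>i\<in>UNIV. u $ i * pdiff i f (x + t *\<^sub>R u))"
    by (simp add: linear_sum[OF lin] linear_scale[OF lin] pdiff_def)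
  finally have u: "?D u = (\<Sum>i\<in>UNIV. u $ i * pdiff i f (x + t *\<^sub>R u))" .
  have "((\<lambda>t. x + t *\<^sub>R u) has_derivative (\<lambda>s. s *\<^sub>R u)) (at t)"
    by (auto intro!: derivative_eq_intros)
  from has_derivative_compose[OF this D]
  have "((\<lambda>t. f (x + t *\<^sub>R u)) has_derivative (\<lambda>s. s * ?D u)) (at t)"
    by (simp add: linear_scale[OF lin])
  then show ?thesis unfolding has_field_derivative_def u
    by (rule has_derivative_eq_rhs) (auto simp: mult.commute)
qed

text \<open>Restriction to the segment from \<open>x\<close> to \<open>x + u\<close> leaves a
  function of one variable. \<open>CARD('n)\<close> comes from comparing the l1 norm of
  \<open>u\<close> with the Euclidean one; the factor 1/6 of the remainder is given away.\<close>

lemma second_order_Taylor: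
  fixes f :: "real^'n::finite \<Rightarrow> real"
  assumes diff: "\<And>is x. iter_pdiff is f differentiable (at x)"
    and bound: "\<And>i j l x. \<bar>pdiff i (pdiff j (pdiff l f)) x\<bar> \<le> C"
  shows "\<bar>f (x + u) - (f x + (\<Sum>i\<in>UNIV. u $ i * pdiff i f x)
      + (\<Sum>i\<in>UNIV. \<Sum>j\<in>UNIV. u $ i * u $ j * pdiff i (pdiff j f) x) / 2)\<bar>
    \<le> C * (real CARD('n) * norm u) ^ 3"
proof -
  define p0 where "p0 t = f (x + t *\<^sub>R u)" for t
  define p1 where "p1 t = (\<Sum>j\<in>UNIV. u $ j * pdiff j f (x + t *\<^sub>R u))" for t
  define p2 where "p2 t = (\<Sum>j\<in>UNIV. u $ j * (\<Sum>i\<in>UNIV. u $ i * pdiff i (pdiff j f) (x + t *\<^sub>R u)))" for t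
  define p3 where "p3 t = (\<Sum>j\<in>UNIV. u $ j * (\<Sum>i\<in>UNIV. u $ i *
      (\<Sum>l\<in>UNIV. u $ l * pdiff l (pdiff i (pdiff j f)) (x + t *\<^sub>R u))))" for t
  have d: "f differentiable (at x)" "pdiff i f differentiable (at x)"
    "pdiff i (pdiff j f) differentiable (at x)" for i j x
    using diff[of "[]"] diff[of "[i]"] diff[of "[i, j]"] by auto
  have "(p0 has_real_derivative p1 t) (at t)" for t
    unfolding p0_def p1_def by (rule line_has_derivative[OF d(1)])
  moreover have "(p1 has_real_derivative p2 t) (at t)" for t
    unfolding p1_def p2_def by (intro DERIV_sum DERIV_cmult line_has_derivative d)
  moreover have "(p2 has_real_derivative p3 t) (at t)" for t
    unfolding p2_def p3_def by (intro DERIV_sum DERIV_cmult line_has_derivative d)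
  \<comment> \<open>\<open>Maclaurin\<close> takes a sequence of derivatives; the list supplies
    those of orders 0 to 3.\<close>
  ultimately have "\<forall>m t. m < 3 \<and> 0 \<le> t \<and> t \<le> 1 \<longrightarrow>
      DERIV (([p0, p1, p2, p3] ! m)) t :> ([p0, p1, p2, p3] ! (Suc m)) t"
    by (auto simp: less_Suc_eq numeral_3_eq_3)
  from Maclaurin[OF _ _ _ this, of p0]
  obtain t where t: "p0 1 = p0 0 + p1 0 + p2 0 / 2 + p3 t / 6"
    by (auto simp: eval_nat_numeral)
  have C: "C \<ge> 0" using bound[of undefined undefined undefined undefined] by linarith
  let ?s = "\<Sum>i\<in>UNIV. \<bar>u $ i\<bar>"
  have "\<bar>p3 t\<bar> \<le> (\<Sum>j\<in>UNIV. \<bar>u $ j\<bar> * (\<Sum>i\<in>UNIV. \<bar>u $ i\<bar> * (\<Sum>l\<in>UNIV. \<bar>u $ l\<bar> * C)))"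
    unfolding p3_def
    by (intro sum_abs[THEN order_trans] sum_mono)
      (auto simp: abs_mult intro!: mult_left_mono sum_abs[THEN order_trans] sum_mono bound)
  also have "\<dots> = C * ?s ^ 3"
    by (simp add: sum_distrib_right[symmetric] power3_eq_cube)
  also have "\<dots> \<le> C * (real CARD('n) * norm u) ^ 3"
    by (intro mult_left_mono power_mono sum_abs_le_card_norm sum_nonneg C) auto
  finally have "\<bar>p3 t / 6\<bar> \<le> C * (real CARD('n) * norm u) ^ 3"
    by linarith
  moreover have "p2 0 = (\<Sum>i\<in>UNIV. \<Sum>j\<in>UNIV. u $ i * u $ j * pdiff i (pdiff j f) x)"
    unfolding p2_def by (subst sum.swap) (simp add: sum_distrib_left mult_ac)
  ultimately show ?thesis using t by (simp add: p0_def p1_def)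
qed

text \<open>One Euler--Maruyama step of length \<open>h\<close>, the Gaussian increment being replaced by a uniformly chosen
  signed column; the scaling makes its covariance \<open>2 h S S\<^sup>t\<close>.\<close>

definition em_step :: "real \<Rightarrow> real^'n \<Rightarrow> real^'m^'n \<Rightarrow> 'm::finite \<times> bool \<Rightarrow> real^'n::finite" where
  "em_step h v S l = h *\<^sub>R v + ((if snd l then 1 else -1) * sqrt (2 * h * CARD('m))) *\<^sub>R column (fst l) S"

lemma sum_em_step:
  "(\<Sum>l\<in>UNIV. g (em_step h v S l)) = (\<Sum>j\<in>(UNIV :: 'm::finite set).
      g (h *\<^sub>R v + sqrt (2 * h * CARD('m)) *\<^sub>R column j S) +
      g (h *\<^sub>R v - sqrt (2 * h * CARD('m)) *\<^sub>R column j S))"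
  for g :: "real^'n::finite \<Rightarrow> real"
proof -
  have "(\<Sum>l\<in>UNIV. g (em_step h v S l)) = (\<Sum>j\<in>(UNIV :: 'm set). \<Sum>s\<in>UNIV. g (em_step h v S (j, s)))"
    unfolding sum.cartesian_product by simp
  then show ?thesis by (simp add: UNIV_bool em_step_def add.commute)
qed

text \<open>For \<open>h <= 1\<close> the drift \<open>h v\<close> is also of size
  \<open>sqrt h\<close>, so a cubic remainder along a step has order \<open>h^(3/2)\<close>.\<close>

lemma norm_em_step_le:
  fixes S :: "real^'m::finite^'n::finite"
  assumes "0 \<le> h" "h \<le> 1" "norm v \<le> R" "norm S \<le> R"
  shows "norm (em_step h v S l) \<le> R * (1 + sqrt (2 * CARD('m))) * sqrt h"
proof -
  have R: "R \<ge> 0" using assms(3) norm_ge_zero order_trans by blast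
  have "norm (em_step h v S l) \<le> h * norm v + sqrt (2 * h * CARD('m)) * norm (column (fst l) S)"
    unfolding em_step_def using assms(1)
    by (intro norm_triangle_ineq[THEN order_trans] add_mono) (auto simp: abs_mult)
  also have "\<dots> \<le> sqrt h * R + sqrt (2 * h * CARD('m)) * R"
  proof (intro add_mono mult_mono assms mult_left_mono)
    show "h \<le> sqrt h" using assms by (simp add: real_le_rsqrt power2_eq_square mult_left_le_one_le)
    show "norm (column (fst l) S) \<le> R" using norm_column_le_norm assms(4) order_trans by blast
  qed (use assms in auto)
  also have "\<dots> = R * (1 + sqrt (2 * CARD('m))) * sqrt h"
    by (simp add: real_sqrt_mult algebra_simps)
  finally show ?thesis .
qed

text \<open>This is \<open>diff_op\<close> with the coefficients frozen: the Taylor estimates then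
  concern one matrix and one vector, although the coefficients are merely measurable in the
  point.\<close>

definition gen :: "real^'m^'n \<Rightarrow> real^'n \<Rightarrow> (real^'n \<Rightarrow> real) \<Rightarrow> real^'n::finite \<Rightarrow> real" where
  "gen S v f x =
     (\<Sum>i\<in>UNIV. \<Sum>j\<in>UNIV. ((S ** transpose S) $ i $ j) * pdiff i (pdiff j f) x)
     + (\<Sum>i\<in>UNIV. v $ i * pdiff i f x)"

lemma diff_op_eq_gen: "diff_op Sig b f x = gen (Sig x) (b x) f x"
  by (simp add: diff_op_def gen_def)

lemma sum_column_hessian:
  fixes S :: "real^'m::finite^'n::finite" and H :: "'n \<Rightarrow> 'n \<Rightarrow> real"
  shows "(\<Sum>i\<in>UNIV. \<Sum>j\<in>UNIV. ((S ** transpose S) $ i $ j) * H i j) =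
    (\<Sum>l\<in>UNIV. \<Sum>i\<in>UNIV. \<Sum>j\<in>UNIV. column l S $ i * column l S $ j * H i j)"
proof -
  have "(\<Sum>i\<in>UNIV. \<Sum>j\<in>UNIV. ((S ** transpose S) $ i $ j) * H i j) =
      (\<Sum>i\<in>UNIV. \<Sum>j\<in>UNIV. \<Sum>l\<in>UNIV. column l S $ i * column l S $ j * H i j)"
    by (simp add: matrix_matrix_mult_def transpose_def column_def sum_distrib_right)
  also have "\<dots> = (\<Sum>i\<in>UNIV. \<Sum>l\<in>UNIV. \<Sum>j\<in>UNIV. column l S $ i * column l S $ j * H i j)"
    by (intro sum.cong refl sum.swap)
  also have "\<dots> = (\<Sum>l\<in>UNIV. \<Sum>i\<in>UNIV. \<Sum>j\<in>UNIV. column l S $ i * column l S $ j * H i j)"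
    by (rule sum.swap)
  finally show ?thesis .
qed

lemma abs_quadratic_form_le:
  fixes u :: "real^'n::finite" and H :: "'n \<Rightarrow> 'n \<Rightarrow> real"
  assumes "\<And>i j. \<bar>H i j\<bar> \<le> C"
  shows "\<bar>\<Sum>i\<in>UNIV. \<Sum>j\<in>UNIV. u $ i * u $ j * H i j\<bar> \<le> C * (real CARD('n) * norm u)\<^sup>2"
proof -
  have C: "C \<ge> 0" using assms[of undefined undefined] by linarith
  let ?s = "\<Sum>i\<in>UNIV. \<bar>u $ i\<bar>"
  have "\<bar>\<Sum>i\<in>UNIV. \<Sum>j\<in>UNIV. u $ i * u $ j * H i j\<bar> \<le> (\<Sum>i\<in>UNIV. \<Sum>j\<in>UNIV. \<bar>u $ i\<bar> * \<bar>u $ j\<bar> * C)"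
    by (intro sum_abs[THEN order_trans] sum_mono)
      (auto simp: abs_mult intro!: mult_left_mono assms)
  also have "\<dots> = C * ?s\<^sup>2"
    by (simp add: sum_distrib_right[symmetric] sum_distrib_left[symmetric] power2_eq_square algebra_simps)
  also have "\<dots> \<le> C * (real CARD('n) * norm u)\<^sup>2"
    by (intro mult_left_mono power_mono sum_abs_le_card_norm sum_nonneg C) auto
  finally show ?thesis .
qed

lemma abs_gen_le:
  fixes S :: "real^'m::finite^'n::finite"
  assumes 1: "\<And>i. \<bar>pdiff i f x\<bar> \<le> C1" and 2: "\<And>i j. \<bar>pdiff i (pdiff j f) x\<bar> \<le> C2"
  shows "\<bar>gen S v f x\<bar> \<le> (real CARD('n))\<^sup>2 * (C1 * norm v + C2 * (norm S)\<^sup>2)"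
proof -
  have C: "C1 \<ge> 0" using 1[of undefined] by linarith
  have "\<bar>\<Sum>i\<in>UNIV. \<Sum>j\<in>UNIV. ((S ** transpose S) $ i $ j) * pdiff i (pdiff j f) x\<bar> \<le>
    (\<Sum>l\<in>UNIV. C2 * (real CARD('n) * norm (column l S))\<^sup>2)"
    unfolding sum_column_hessian
    by (intro sum_abs[THEN order_trans] sum_mono abs_quadratic_form_le 2)
  also have "\<dots> = C2 * (real CARD('n))\<^sup>2 * (norm S)\<^sup>2"
    by (simp add: sum_norm_column_power2[symmetric] sum_distrib_left power_mult_distrib mult_ac)
  finally have a: "\<bar>\<Sum>i\<in>UNIV. \<Sum>j\<in>UNIV. ((S ** transpose S) $ i $ j) * pdiff i (pdiff j f) x\<bar> \<le>
      C2 * (real CARD('n))\<^sup>2 * (norm S)\<^sup>2" .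
  have "\<bar>\<Sum>i\<in>UNIV. v $ i * pdiff i f x\<bar> \<le> (\<Sum>i\<in>UNIV. \<bar>v $ i\<bar> * C1)"
    by (intro sum_abs[THEN order_trans] sum_mono) (auto simp: abs_mult intro!: mult_left_mono 1)
  also have "\<dots> \<le> C1 * (real CARD('n) * norm v)"
    using mult_left_mono[OF sum_abs_le_card_norm[of v] C]
    by (simp add: sum_distrib_right[symmetric] mult.commute[of "sum _ _" C1])
  also have "\<dots> \<le> C1 * ((real CARD('n))\<^sup>2 * norm v)"
    by (intro mult_left_mono mult_right_mono C) (auto simp: power2_eq_square)
  finally show ?thesis using a unfolding gen_def by (simp add: algebra_simps)
qed

text \<open>Weak consistency of the scheme. Opposite signs cancel the linear noise terms and the
  mixed terms; the quadratic noise terms add up to exactly \<open>h\<close> times the second-order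
  part of the generator. What is left is the quadratic term of the drift, of order
  \<open>h^2\<close>, and the cubic remainder; both are at most of order
  \<open>h^(3/2)\<close>.\<close>

lemma em_step_average:
  fixes S :: "real^'m::finite^'n::finite"
  assumes diff: "\<And>is x. iter_pdiff is f differentiable (at x)"
    and bound2: "\<And>i j x. \<bar>pdiff i (pdiff j f) x\<bar> \<le> C"
    and bound3: "\<And>i j l x. \<bar>pdiff i (pdiff j (pdiff l f)) x\<bar> \<le> C"
    and h: "0 \<le> h" "h \<le> 1" and R: "norm v \<le> R" "norm S \<le> R"
  shows "\<bar>(\<Sum>l\<in>UNIV. f (x + em_step h v S l)) / (2 * real CARD('m)) - (f x + h * gen S v f x)\<bar>
    \<le> C * ((real CARD('n) * R * (1 + sqrt (2 * CARD('m)))) ^ 3 + (real CARD('n) * R)\<^sup>2) * (h * sqrt h)"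
proof -
  let ?m = "real CARD('m)" and ?n = "real CARD('n)"
  let ?\<kappa> = "sqrt (2 * h * ?m)"
  define T1 where "T1 u = (\<Sum>i\<in>UNIV. u $ i * pdiff i f x)" for u
  define T2 where "T2 u w = (\<Sum>i\<in>UNIV. \<Sum>j\<in>UNIV. u $ i * w $ j * pdiff i (pdiff j f) x)" for u w
  define T where "T u = f x + T1 u + T2 u u / 2" for u
  have C: "C \<ge> 0" using bound2[of undefined undefined undefined] by linarith
  have R0: "R \<ge> 0" using R(1) norm_ge_zero order_trans by blast
  have T1a: "T1 (a + c) + T1 (a - c) = 2 * T1 a" for a c
    unfolding T1_def sum.distrib[symmetric] sum_distrib_left by (intro sum.cong) (auto simp: algebra_simps)
  have T2a: "T2 (a + c) (a + c) + T2 (a - c) (a - c) = 2 * T2 a a + 2 * T2 c c" for a c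
    unfolding T2_def sum.distrib[symmetric] sum_distrib_left by (intro sum.cong) (auto simp: algebra_simps)
  have T2s: "T2 (r *\<^sub>R a) (r *\<^sub>R a) = r\<^sup>2 * T2 a a" for r a
    unfolding T2_def sum_distrib_left by (intro sum.cong) (auto simp: algebra_simps power2_eq_square)
  have T1s: "T1 (r *\<^sub>R a) = r * T1 a" for r a
    unfolding T1_def sum_distrib_left by (intro sum.cong) (auto simp: algebra_simps)
  have "T (a + c) + T (a - c) = 2 * f x + 2 * T1 a + T2 a a + T2 c c" for a c
    using T1a[of a c] T2a[of a c] unfolding T_def by (simp add: field_simps)
  then have "(\<Sum>l\<in>UNIV. T (em_step h v S l)) = (\<Sum>j\<in>(UNIV :: 'm set).
      2 * f x + 2 * (h * T1 v) + h\<^sup>2 * T2 v v + ?\<kappa>\<^sup>2 * T2 (column j S) (column j S))"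
    unfolding sum_em_step by (simp only: T2s T1s)
  also have "\<dots> = 2 * ?m * f x + 2 * ?m * h * T1 v + ?m * h\<^sup>2 * T2 v v + 2 * ?m * h * (\<Sum>j\<in>UNIV. T2 (column j S) (column j S))"
    using h by (simp add: sum.distrib sum_distrib_left algebra_simps)
  also have "\<dots> = (2 * ?m) * (f x + h * gen S v f x + h\<^sup>2 * T2 v v / 2)"
    unfolding gen_def sum_column_hessian T1_def[symmetric] T2_def[symmetric]
    by (simp add: algebra_simps)
  finally have avgT: "(\<Sum>l\<in>UNIV. T (em_step h v S l)) / (2 * ?m) = f x + h * gen S v f x + h\<^sup>2 * T2 v v / 2"
    by (simp del: times_divide_eq_right)
  define E where "E = C * (?n * (R * (1 + sqrt (2 * ?m)) * sqrt h)) ^ 3"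
  have "\<bar>f (x + em_step h v S l) - T (em_step h v S l)\<bar> \<le> E" for l
  proof -
    have "\<bar>f (x + em_step h v S l) - T (em_step h v S l)\<bar> \<le> C * (?n * norm (em_step h v S l)) ^ 3"
      unfolding T_def T1_def T2_def by (rule second_order_Taylor[OF diff bound3])
    also have "\<dots> \<le> E"
      using norm_em_step_le[OF h R, of l]
      unfolding E_def by (intro mult_left_mono power_mono C) auto
    finally show ?thesis .
  qed
  then have "(\<Sum>l\<in>(UNIV::('m\<times>bool) set). \<bar>f (x + em_step h v S l) - T (em_step h v S l)\<bar>) \<le> (\<Sum>l\<in>(UNIV::('m\<times>bool) set). E)"
    by (intro sum_mono)
  then have "\<bar>(\<Sum>l\<in>UNIV. f (x + em_step h v S l)) - (\<Sum>l\<in>UNIV. T (em_step h v S l))\<bar> \<le> 2 * ?m * E"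
    unfolding sum_subtractf[symmetric] by (intro sum_abs[THEN order_trans]) simp
  then have 1: "\<bar>(\<Sum>l\<in>UNIV. f (x + em_step h v S l)) / (2 * ?m) - (\<Sum>l\<in>UNIV. T (em_step h v S l)) / (2 * ?m)\<bar> \<le> E"
    unfolding diff_divide_distrib[symmetric] by (simp add: abs_divide divide_simps mult.commute)
  have hh: "h\<^sup>2 \<le> h * sqrt h"
  proof -
    have "h \<le> sqrt h" using h by (simp add: real_le_rsqrt power2_eq_square mult_left_le_one_le)
    then show ?thesis using h by (simp add: power2_eq_square mult_left_mono)
  qed
  have T2b: "\<bar>T2 v v\<bar> \<le> C * (?n * norm v)\<^sup>2"
    unfolding T2_def by (rule abs_quadratic_form_le[OF bound2])
  also have "\<dots> \<le> C * (?n * R)\<^sup>2"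
    by (intro mult_left_mono power_mono R C) auto
  finally have "\<bar>T2 v v\<bar> \<le> C * (?n * R)\<^sup>2" .
  then have "\<bar>h\<^sup>2 * T2 v v / 2\<bar> \<le> h\<^sup>2 * (C * (?n * R)\<^sup>2)"
  proof -
    assume "\<bar>T2 v v\<bar> \<le> C * (?n * R)\<^sup>2"
    then have "h\<^sup>2 * \<bar>T2 v v\<bar> \<le> h\<^sup>2 * (C * (?n * R)\<^sup>2)" by (intro mult_left_mono) auto
    moreover have "0 \<le> h\<^sup>2 * \<bar>T2 v v\<bar>" by simp
    moreover have "\<bar>h\<^sup>2 * T2 v v / 2\<bar> = h\<^sup>2 * \<bar>T2 v v\<bar> / 2" by (simp add: abs_mult)
    ultimately show ?thesis by linarith
  qed
  also have "\<dots> \<le> h * sqrt h * (C * (?n * R)\<^sup>2)"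
    by (intro mult_right_mono hh) (use C in auto)
  finally have 2: "\<bar>h\<^sup>2 * T2 v v / 2\<bar> \<le> C * (?n * R)\<^sup>2 * (h * sqrt h)"
    by (simp add: mult_ac)
  have "(sqrt h) ^ 3 = h * sqrt h" using h by (simp add: power3_eq_cube)
  then have 3: "E = C * (?n * R * (1 + sqrt (2 * ?m))) ^ 3 * (h * sqrt h)"
    unfolding E_def power_mult_distrib by (simp add: mult_ac)
  show ?thesis using 1 2 3 unfolding avgT by (simp add: algebra_simps)
qed

section \<open>Couplings of mollified measures\<close>

lemma nn_integral_lborel_shift:
  fixes f :: "'a::euclidean_space \<Rightarrow> ennreal"
  assumes [measurable]: "f \<in> borel_measurable borel"
  shows "(\<integral>\<^sup>+x. f (x - c) \<partial>lborel) = (\<integral>\<^sup>+x. f x \<partial>lborel)"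
proof -
  have "(\<integral>\<^sup>+x. f x \<partial>lborel) = (\<integral>\<^sup>+x. f x \<partial>distr lborel borel ((+) (- c)))"
    by (simp add: lborel_distr_plus)
  also have "\<dots> = (\<integral>\<^sup>+x. f (- c + x) \<partial>lborel)"
    by (subst nn_integral_distr) auto
  finally show ?thesis by simp
qed

text \<open>\<open>\<theta>\<close> is the density, relative to \<open>p \<otimes> r\<close>, of a measure whose marginals are dominated by those with
  densities \<open>p\<close> and \<open>r\<close>.\<close>

definition feasible :: "('a::euclidean_space \<Rightarrow> ennreal) \<Rightarrow> ('a \<Rightarrow> ennreal) \<Rightarrow> ('a \<times> 'a \<Rightarrow> ennreal) \<Rightarrow> bool" where
  "feasible p r \<theta> \<longleftrightarrow> \<theta> \<in> borel_measurable (borel \<Otimes>\<^sub>M borel)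
     \<and> (\<forall>x. (\<integral>\<^sup>+y. \<theta> (x, y) * r y \<partial>lborel) \<le> 1) \<and> (\<forall>y. (\<integral>\<^sup>+x. \<theta> (x, y) * p x \<partial>lborel) \<le> 1)"

definition payoff :: "('a::euclidean_space \<Rightarrow> ennreal) \<Rightarrow> ('a \<Rightarrow> ennreal) \<Rightarrow> ('a \<Rightarrow> ennreal) \<Rightarrow> ('a \<times> 'a \<Rightarrow> ennreal) \<Rightarrow> ennreal" where
  "payoff k p r \<theta> = (\<integral>\<^sup>+x. \<integral>\<^sup>+y. k (x - y) * (\<theta> (x, y) * p x * r y) \<partial>lborel \<partial>lborel)"

lemma feasible_swap: "feasible p r \<theta> \<Longrightarrow> feasible r p (\<lambda>z. \<theta> (snd z, fst z))"
  unfolding feasible_def by (auto intro: measurable_compose[of "\<lambda>z. (snd z, fst z)"])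

text \<open>Thinning produces only sub-couplings; this lemma restores full mass. Both marginals of
  \<theta> carry the same mass \<open>w\<close>, so their deficits \<open>a\<close> and
  \<open>b\<close> have the same mass \<open>m\<close>, and adding the product of the deficits
  divided by \<open>m\<close> fills both marginals. As \<theta> only grows, no nonnegative payoff
  decreases.\<close>

lemma feasible_completion:
  assumes pr[measurable]: "p \<in> borel_measurable borel" "r \<in> borel_measurable borel"
    and one: "(\<integral>\<^sup>+x. p x \<partial>lborel) = 1" "(\<integral>\<^sup>+x. r x \<partial>lborel) = 1"
    and \<theta>: "feasible p r \<theta>"
  shows "\<exists>\<theta>'. feasible p r \<theta>' \<and> (\<forall>z. \<theta> z \<le> \<theta>' z) \<and> payoff (\<lambda>_. 1) p r \<theta>' = 1"
proof -
  have \<theta>m[measurable]: "\<theta> \<in> borel_measurable (borel \<Otimes>\<^sub>M borel)"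
    and \<theta>1: "\<And>x. (\<integral>\<^sup>+y. \<theta> (x, y) * r y \<partial>lborel) \<le> 1" and \<theta>2: "\<And>y. (\<integral>\<^sup>+x. \<theta> (x, y) * p x \<partial>lborel) \<le> 1"
    using \<theta> by (auto simp: feasible_def)
  define \<alpha> where "\<alpha> x = (\<integral>\<^sup>+y. \<theta> (x, y) * r y \<partial>lborel)" for x
  define \<beta> where "\<beta> y = (\<integral>\<^sup>+x. \<theta> (x, y) * p x \<partial>lborel)" for y
  define a where "a x = 1 - \<alpha> x" for x
  define b where "b y = 1 - \<beta> y" for y
  have [measurable]: "\<alpha> \<in> borel_measurable borel" "\<beta> \<in> borel_measurable borel"
    unfolding \<alpha>_def \<beta>_def by measurable
  have [measurable]: "a \<in> borel_measurable borel" "b \<in> borel_measurable borel"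
    unfolding a_def b_def by measurable
  have a1: "\<alpha> x + a x = 1" for x using \<theta>1[of x] by (simp add: a_def \<alpha>_def add_diff_inverse_ennreal)
  have b1: "\<beta> x + b x = 1" for x using \<theta>2[of x] by (simp add: b_def \<beta>_def add_diff_inverse_ennreal)
  define w where "w = (\<integral>\<^sup>+x. \<alpha> x * p x \<partial>lborel)"
  have w2: "w = (\<integral>\<^sup>+y. \<beta> y * r y \<partial>lborel)"
  proof -
    have "w = (\<integral>\<^sup>+x. \<integral>\<^sup>+y. \<theta> (x, y) * r y * p x \<partial>lborel \<partial>lborel)"
      unfolding w_def \<alpha>_def by (intro nn_integral_cong nn_integral_multc[symmetric]) measurable
    also have "\<dots> = (\<integral>\<^sup>+y. \<integral>\<^sup>+x. \<theta> (x, y) * r y * p x \<partial>lborel \<partial>lborel)"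
      by (rule lborel_pair.Fubini'[symmetric]) measurable
    also have "\<dots> = (\<integral>\<^sup>+y. \<integral>\<^sup>+x. \<theta> (x, y) * p x * r y \<partial>lborel \<partial>lborel)"
      by (simp add: mult_ac)
    also have "\<dots> = (\<integral>\<^sup>+y. \<beta> y * r y \<partial>lborel)"
      unfolding \<beta>_def by (intro nn_integral_cong nn_integral_multc) measurable
    finally show ?thesis .
  qed
  define m where "m = (\<integral>\<^sup>+x. a x * p x \<partial>lborel)"
  have wm: "w + m = 1"
    unfolding w_def m_def by (subst nn_integral_add[symmetric]) (auto simp: distrib_right[symmetric] a1 one)
  have wm2: "w + (\<integral>\<^sup>+y. b y * r y \<partial>lborel) = 1"
    unfolding w2 by (subst nn_integral_add[symmetric]) (auto simp: distrib_right[symmetric] b1 one)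
  have wle: "w \<le> 1" and mle: "m \<le> 1" using wm by (metis le_iff_add, metis add.commute le_iff_add)
  have m2: "(\<integral>\<^sup>+y. b y * r y \<partial>lborel) = m"
    using wm wm2 wle by (metis ennreal_add_left_cancel infinity_ennreal_def neq_top_trans ennreal_one_neq_top)
  have payoff1: "payoff (\<lambda>_. 1) p r \<theta>' = (\<integral>\<^sup>+x. (\<integral>\<^sup>+y. \<theta>' (x, y) * r y \<partial>lborel) * p x \<partial>lborel)"
    if [measurable]: "\<theta>' \<in> borel_measurable (borel \<Otimes>\<^sub>M borel)" for \<theta>'
    unfolding payoff_def
  proof (intro nn_integral_cong)
    fix x
    have "(\<integral>\<^sup>+y. 1 * (\<theta>' (x, y) * p x * r y) \<partial>lborel) = (\<integral>\<^sup>+y. \<theta>' (x, y) * r y * p x \<partial>lborel)"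
      by (simp add: mult_ac)
    also have "\<dots> = (\<integral>\<^sup>+y. \<theta>' (x, y) * r y \<partial>lborel) * p x"
      by (rule nn_integral_multc) measurable
    finally show "(\<integral>\<^sup>+y. 1 * (\<theta>' (x, y) * p x * r y) \<partial>lborel) = (\<integral>\<^sup>+y. \<theta>' (x, y) * r y \<partial>lborel) * p x" .
  qed
  show ?thesis
  proof (cases "m = 0")
    case True
    then have "w = 1" using wm by simp
    then show ?thesis using \<theta> payoff1[OF \<theta>m] by (auto simp: w_def \<alpha>_def)
  next
    case False
    have mtop: "m \<noteq> \<top>" using mle by (auto simp: top_unique)
    have minv: "inverse m * m = 1" using ennreal_divide_self[of m] False mtop by (simp add: divide_ennreal_def mult.commute less_top)
    define \<theta>' where "\<theta>' z = \<theta> z + a (fst z) * b (snd z) * inverse m" for z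
    have \<theta>'m[measurable]: "\<theta>' \<in> borel_measurable (borel \<Otimes>\<^sub>M borel)" unfolding \<theta>'_def by measurable
    have x1: "(\<integral>\<^sup>+y. \<theta>' (x, y) * r y \<partial>lborel) = 1" for x
    proof -
      have "(\<integral>\<^sup>+y. \<theta>' (x, y) * r y \<partial>lborel) = (\<integral>\<^sup>+y. \<theta> (x, y) * r y + (a x * inverse m) * (b y * r y) \<partial>lborel)"
        by (intro nn_integral_cong) (simp add: \<theta>'_def distrib_left mult_ac)
      also have "\<dots> = \<alpha> x + (a x * inverse m) * (\<integral>\<^sup>+y. b y * r y \<partial>lborel)"
        by (subst nn_integral_add) (auto simp: \<alpha>_def nn_integral_cmult)
      also have "\<dots> = 1" by (simp add: m2 mult.assoc minv a1)
      finally show ?thesis .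
    qed
    have y1: "(\<integral>\<^sup>+x. \<theta>' (x, y) * p x \<partial>lborel) = 1" for y
    proof -
      have "(\<integral>\<^sup>+x. \<theta>' (x, y) * p x \<partial>lborel) = (\<integral>\<^sup>+x. \<theta> (x, y) * p x + (b y * inverse m) * (a x * p x) \<partial>lborel)"
        by (intro nn_integral_cong) (simp add: \<theta>'_def distrib_left mult_ac)
      also have "\<dots> = \<beta> y + (b y * inverse m) * (\<integral>\<^sup>+x. a x * p x \<partial>lborel)"
        by (subst nn_integral_add) (auto simp: \<beta>_def nn_integral_cmult)
      also have "\<dots> = 1" by (simp add: m_def[symmetric] mult.assoc minv b1)
      finally show ?thesis .
    qed
    have "feasible p r \<theta>'" using x1 y1 by (auto simp: feasible_def)
    moreover have "payoff (\<lambda>_. 1) p r \<theta>' = 1" using payoff1[OF \<theta>'m] x1 one by simp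
    ultimately show ?thesis by (intro exI[of _ \<theta>']) (auto simp: \<theta>'_def)
  qed
qed

section \<open>Mollified measures and resampled couplings\<close>

definition mollify :: "('a::euclidean_space \<Rightarrow> ennreal) \<Rightarrow> 'a measure \<Rightarrow> 'a \<Rightarrow> ennreal" where
  "mollify \<rho> M x = (\<integral>\<^sup>+X. \<rho> (x - X) \<partial>M)"

text \<open>The law of \<open>((X, Y), (x, y))\<close> where \<open>(x, y)\<close> has density \<open>\<theta> (x, y) p x r y\<close> and, given \<open>(x, y)\<close>, the points
  \<open>X\<close> and \<open>Y\<close> are drawn independently from the posteriors of the mollification. Writing \<open>\<theta>\<close> relative to
  \<open>p \<otimes> r\<close> avoids dividing by \<open>p\<close> and \<open>r\<close>.\<close>

definition lift :: "('a::euclidean_space \<Rightarrow> ennreal) \<Rightarrow> 'a measure \<Rightarrow> 'a measure \<Rightarrow> ('a \<times> 'a \<Rightarrow> ennreal) \<Rightarrow> (('a \<times> 'a) \<times> ('a \<times> 'a)) measure" where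
  "lift \<rho> M N \<theta> = density ((M \<Otimes>\<^sub>M N) \<Otimes>\<^sub>M (lborel \<Otimes>\<^sub>M lborel))
     (\<lambda>z. \<theta> (snd z) * \<rho> (fst (snd z) - fst (fst z)) * \<rho> (snd (snd z) - snd (fst z)))"

text \<open>The density after one step: \<open>X\<close> is drawn from \<open>M\<close>,
  \<open>l\<close> uniformly, and noise with density \<rho> is added to \<open>X + v l X\<close>.
  The displacement depends on \<open>X\<close> only, so for fixed \<open>X\<close> it merely
  translates \<rho>, and measurability of \<open>v\<close> is all that this needs.\<close>

definition shifted_average ::
    "('a::euclidean_space \<Rightarrow> ennreal) \<Rightarrow> ('l::finite \<Rightarrow> 'a \<Rightarrow> 'a) \<Rightarrow> 'a measure \<Rightarrow> 'a \<Rightarrow> ennreal" where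
  "shifted_average \<rho> v M x = (\<Sum>l\<in>UNIV. \<integral>\<^sup>+X. \<rho> (x - v l X - X) \<partial>M) / of_nat CARD('l)"

text \<open>Equivalent to \<open>(1 - A) (1 - B) >= 0\<close>: the loss from thinning by both
  factors is at most the sum of the two separate losses.\<close>

lemma one_le_thinning:
  fixes A B :: ennreal
  assumes "A \<le> 1" "B \<le> 1"
  shows "1 \<le> A * B + (1 - A) + (1 - B)"
proof -
  obtain a where a: "A = ennreal a" "0 \<le> a" "a \<le> 1"
    using assms(1) by (cases A) (auto simp: top_unique)
  obtain b where b: "B = ennreal b" "0 \<le> b" "b \<le> 1"
    using assms(2) by (cases B) (auto simp: top_unique)
  have "A * B + (1 - A) + (1 - B) = ennreal (a * b + (1 - a) + (1 - b))"
    using a b by (simp only: ennreal_mult[symmetric] ennreal_minus[symmetric] ennreal_1 ennreal_plus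
        mult_nonneg_nonneg add_nonneg_nonneg diff_ge_0_iff_ge)
  moreover have "0 \<le> (1 - a) * (1 - b)" using a b by simp
  then have "1 \<le> a * b + (1 - a) + (1 - b)" by (simp add: algebra_simps)
  ultimately show ?thesis by (metis ennreal_1 ennreal_leI)
qed

text \<open>Subtraction on \<open>ennreal\<close> is truncated, so the right side is the positive
  part of \<open>q - p\<close>, the excess that thinning removes.\<close>

lemma max_mult_thinning_le:
  fixes p q :: ennreal
  assumes "q < \<top>" "p < \<top>"
  shows "q * (1 - p * inverse (max p q)) \<le> q - p"
proof (cases "q \<le> p")
  case True
  show ?thesis
  proof (cases "p = 0")
    case False
    then have "p * inverse (max p q) = 1" using True assms ennreal_divide_self[of p]
      by (simp add: divide_ennreal_def max_absorb1)
    then show ?thesis by simp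
  qed (use True in auto)
next
  case False
  then obtain a b where ab: "p = ennreal a" "q = ennreal b" "0 \<le> a" "0 \<le> b" "a < b"
    using assms by (cases p; cases q) (auto simp: ennreal_less_iff not_le)
  then have "max p q = ennreal b" by (simp add: max_def ennreal_leI)
  moreover have "0 \<le> 1 - a * inverse b" using ab by (simp add: field_simps)
  ultimately have "q * (1 - p * inverse (max p q)) = ennreal (b * (1 - a / b))"
    using ab by (simp add: inverse_ennreal ennreal_mult[symmetric] ennreal_minus ennreal_1[symmetric] divide_inverse del: ennreal_1)
  also have "b * (1 - a / b) = b - a" using ab by (simp add: field_simps)
  finally show ?thesis using ab by (simp add: ennreal_minus)
qed

lemma ennreal_mult_inverse_le_1: "a \<le> c \<Longrightarrow> a * inverse c \<le> 1" for a c :: ennreal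
  unfolding divide_ennreal_def[symmetric]
  by (cases "c = 0") (auto intro!: divide_le_posI_ennreal simp: zero_less_iff_neq_zero)

lemma thinned_marginal_le:
  assumes [measurable]: "g \<in> borel_measurable M" and g: "(\<integral>\<^sup>+y. g y \<partial>M) \<le> q" and B: "\<And>y. B y \<le> 1"
  shows "(\<integral>\<^sup>+y. g y * B y * inverse (max p q) \<partial>M) \<le> (1 :: ennreal)"
proof -
  have "(\<integral>\<^sup>+y. g y * B y * inverse (max p q) \<partial>M) \<le> (\<integral>\<^sup>+y. g y * 1 * inverse (max p q) \<partial>M)"
    by (intro nn_integral_mono mult_right_mono mult_left_mono B) auto
  also have "\<dots> = (\<integral>\<^sup>+y. g y \<partial>M) * inverse (max p q)" by (simp add: nn_integral_multc)
  also have "\<dots> \<le> q * inverse (max p q)" by (intro mult_right_mono g) auto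
  also have "\<dots> \<le> 1" by (intro ennreal_mult_inverse_le_1) auto
  finally show ?thesis .
qed

lemma thinning_loss_le:
  assumes [measurable]: "g \<in> borel_measurable M" and g: "(\<integral>\<^sup>+y. g y \<partial>M) \<le> q" and fin: "q < \<top>" "p < \<top>"
  shows "(\<integral>\<^sup>+y. g y * (1 - p * inverse (max p q)) \<partial>M) \<le> q - p"
proof -
  have "(\<integral>\<^sup>+y. g y * (1 - p * inverse (max p q)) \<partial>M) = (\<integral>\<^sup>+y. g y \<partial>M) * (1 - p * inverse (max p q))"
    by (rule nn_integral_multc) measurable
  also have "\<dots> \<le> q * (1 - p * inverse (max p q))" by (intro mult_right_mono g) auto
  also have "\<dots> \<le> q - p" by (rule max_mult_thinning_le[OF fin])
  finally show ?thesis .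
qed

locale mollified_pair =
  M: prob_space M + N: prob_space N for M N :: "'a::euclidean_space measure" +
  fixes \<rho> :: "'a \<Rightarrow> ennreal"
  assumes sM[measurable_cong]: "sets M = sets borel" and sN[measurable_cong]: "sets N = sets borel"
    and \<rho>m[measurable]: "\<rho> \<in> borel_measurable borel"
    and \<rho>1: "(\<integral>\<^sup>+x. \<rho> x \<partial>lborel) = 1"
begin

text \<open>Exchanging the two measures transfers each estimate for the first marginal to the
  second.\<close>

lemma mollified_pair_swap: "mollified_pair N M \<rho>"
  by unfold_locales (auto simp: sM sN \<rho>1)

sublocale MN: pair_sigma_finite M N ..
sublocale Ml: pair_sigma_finite M "lborel :: 'a measure" ..
sublocale Nl: pair_sigma_finite N "lborel :: 'a measure" ..
sublocale MNLL: pair_sigma_finite "M \<Otimes>\<^sub>M N" "lborel \<Otimes>\<^sub>M lborel :: ('a \<times> 'a) measure"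
  by (intro pair_sigma_finite.intro MN.sigma_finite_measure_axioms lborel_pair.sigma_finite_measure_axioms)

abbreviation "p \<equiv> mollify \<rho> M"
abbreviation "r \<equiv> mollify \<rho> N"

lemma p_measurable[measurable]: "p \<in> borel_measurable borel"
  unfolding mollify_def by measurable

lemma r_measurable[measurable]: "r \<in> borel_measurable borel"
  unfolding mollify_def by measurable

lemma p_integral: "(\<integral>\<^sup>+x. p x \<partial>lborel) = 1"
proof -
  have "(\<integral>\<^sup>+x. p x \<partial>lborel) = (\<integral>\<^sup>+X. \<integral>\<^sup>+x. \<rho> (x - X) \<partial>lborel \<partial>M)"
    unfolding mollify_def by (rule Ml.Fubini') measurable
  also have "\<dots> = 1" by (simp add: nn_integral_lborel_shift \<rho>1 M.emeasure_space_1)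
  finally show ?thesis .
qed

lemma sets_quad: "sets ((M \<Otimes>\<^sub>M N) \<Otimes>\<^sub>M (lborel \<Otimes>\<^sub>M lborel)) = sets ((borel \<Otimes>\<^sub>M borel) \<Otimes>\<^sub>M (borel \<Otimes>\<^sub>M borel))"
  by (intro sets_pair_measure_cong) (auto simp: sM sN)

lemma nn_integral_quad:
  fixes H :: "('a \<times> 'a) \<times> ('a \<times> 'a) \<Rightarrow> ennreal"
  assumes H[measurable]: "H \<in> borel_measurable ((M \<Otimes>\<^sub>M N) \<Otimes>\<^sub>M (lborel \<Otimes>\<^sub>M lborel))"
  shows "(\<integral>\<^sup>+z. H z \<partial>((M \<Otimes>\<^sub>M N) \<Otimes>\<^sub>M (lborel \<Otimes>\<^sub>M lborel))) =
      (\<integral>\<^sup>+X. \<integral>\<^sup>+Y. \<integral>\<^sup>+x. \<integral>\<^sup>+y. H ((X, Y), (x, y)) \<partial>lborel \<partial>lborel \<partial>N \<partial>M)" (is ?A)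
    and "(\<integral>\<^sup>+z. H z \<partial>((M \<Otimes>\<^sub>M N) \<Otimes>\<^sub>M (lborel \<Otimes>\<^sub>M lborel))) =
      (\<integral>\<^sup>+x. \<integral>\<^sup>+y. \<integral>\<^sup>+X. \<integral>\<^sup>+Y. H ((X, Y), (x, y)) \<partial>N \<partial>M \<partial>lborel \<partial>lborel)" (is ?B)
proof -
  have "(\<integral>\<^sup>+z. H z \<partial>((M \<Otimes>\<^sub>M N) \<Otimes>\<^sub>M (lborel \<Otimes>\<^sub>M lborel))) =
      (\<integral>\<^sup>+Z. \<integral>\<^sup>+z. H (Z, z) \<partial>(lborel \<Otimes>\<^sub>M lborel) \<partial>(M \<Otimes>\<^sub>M N))"
    by (rule sigma_finite_measure.nn_integral_fst[OF lborel_pair.sigma_finite_measure_axioms, symmetric]) measurable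
  also have "\<dots> = (\<integral>\<^sup>+Z. \<integral>\<^sup>+x. \<integral>\<^sup>+y. H (Z, (x, y)) \<partial>lborel \<partial>lborel \<partial>(M \<Otimes>\<^sub>M N))"
    by (intro nn_integral_cong lborel.nn_integral_fst[symmetric]) measurable
  also have "\<dots> = (\<integral>\<^sup>+X. \<integral>\<^sup>+Y. \<integral>\<^sup>+x. \<integral>\<^sup>+y. H ((X, Y), (x, y)) \<partial>lborel \<partial>lborel \<partial>N \<partial>M)"
    by (rule N.nn_integral_fst[symmetric]) measurable
  finally show ?A .
  have "(\<integral>\<^sup>+z. H z \<partial>((M \<Otimes>\<^sub>M N) \<Otimes>\<^sub>M (lborel \<Otimes>\<^sub>M lborel))) =
      (\<integral>\<^sup>+z. \<integral>\<^sup>+Z. H (Z, z) \<partial>(M \<Otimes>\<^sub>M N) \<partial>(lborel \<Otimes>\<^sub>M lborel))"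
    by (rule MNLL.nn_integral_snd[symmetric]) measurable
  also have "\<dots> = (\<integral>\<^sup>+z. \<integral>\<^sup>+X. \<integral>\<^sup>+Y. H ((X, Y), z) \<partial>N \<partial>M \<partial>(lborel \<Otimes>\<^sub>M lborel))"
    by (intro nn_integral_cong N.nn_integral_fst[symmetric]) measurable
  also have "\<dots> = (\<integral>\<^sup>+x. \<integral>\<^sup>+y. \<integral>\<^sup>+X. \<integral>\<^sup>+Y. H ((X, Y), (x, y)) \<partial>N \<partial>M \<partial>lborel \<partial>lborel)"
    by (rule lborel.nn_integral_fst[symmetric]) measurable
  finally show ?B .
qed

lemma nn_integral_lift:
  assumes [measurable]: "\<theta> \<in> borel_measurable (borel \<Otimes>\<^sub>M borel)"
    and F: "F \<in> borel_measurable ((borel \<Otimes>\<^sub>M borel) \<Otimes>\<^sub>M (borel \<Otimes>\<^sub>M borel))"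
  shows "(\<integral>\<^sup>+z. F z \<partial>lift \<rho> M N \<theta>) =
    (\<integral>\<^sup>+X. \<integral>\<^sup>+Y. \<integral>\<^sup>+x. \<integral>\<^sup>+y. \<theta> (x, y) * \<rho> (x - X) * \<rho> (y - Y) * F ((X, Y), (x, y)) \<partial>lborel \<partial>lborel \<partial>N \<partial>M)" (is ?A)
    and "(\<integral>\<^sup>+z. F z \<partial>lift \<rho> M N \<theta>) =
    (\<integral>\<^sup>+x. \<integral>\<^sup>+y. \<integral>\<^sup>+X. \<integral>\<^sup>+Y. \<theta> (x, y) * \<rho> (x - X) * \<rho> (y - Y) * F ((X, Y), (x, y)) \<partial>N \<partial>M \<partial>lborel \<partial>lborel)" (is ?B)
proof -
  let ?H = "\<lambda>z. \<theta> (snd z) * \<rho> (fst (snd z) - fst (fst z)) * \<rho> (snd (snd z) - snd (fst z)) * F z"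
  have [measurable]: "F \<in> borel_measurable ((M \<Otimes>\<^sub>M N) \<Otimes>\<^sub>M (lborel \<Otimes>\<^sub>M lborel))"
    using F by (simp cong: measurable_cong_sets add: sets_quad)
  have 1: "(\<integral>\<^sup>+z. F z \<partial>lift \<rho> M N \<theta>) = (\<integral>\<^sup>+z. ?H z \<partial>((M \<Otimes>\<^sub>M N) \<Otimes>\<^sub>M (lborel \<Otimes>\<^sub>M lborel)))"
    unfolding lift_def by (rule nn_integral_density) measurable
  have Hm: "?H \<in> borel_measurable ((M \<Otimes>\<^sub>M N) \<Otimes>\<^sub>M (lborel \<Otimes>\<^sub>M lborel))" by measurable
  show ?A
    unfolding 1 nn_integral_quad(1)[OF Hm] by simp
  show ?B
    unfolding 1 nn_integral_quad(2)[OF Hm] by simp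
qed

text \<open>Integrating out \<open>X\<close> and \<open>Y\<close> replaces the two factors \<rho> by
  \<open>p x\<close> and \<open>r y\<close>: resampling leaves the law of \<open>(x, y)\<close>
  untouched.\<close>

lemma nn_integral_lift_snd:
  assumes \<theta>[measurable]: "\<theta> \<in> borel_measurable (borel \<Otimes>\<^sub>M borel)"
    and [measurable]: "G \<in> borel_measurable (borel \<Otimes>\<^sub>M borel)"
  shows "(\<integral>\<^sup>+z. G (snd z) \<partial>lift \<rho> M N \<theta>) = (\<integral>\<^sup>+x. \<integral>\<^sup>+y. G (x, y) * (\<theta> (x, y) * p x * r y) \<partial>lborel \<partial>lborel)"
proof -
  have "(\<integral>\<^sup>+X. \<integral>\<^sup>+Y. \<theta> (x, y) * \<rho> (x - X) * \<rho> (y - Y) * G (x, y) \<partial>N \<partial>M) = G (x, y) * (\<theta> (x, y) * p x * r y)" for x y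
  proof -
    have "(\<integral>\<^sup>+X. \<integral>\<^sup>+Y. \<theta> (x, y) * \<rho> (x - X) * \<rho> (y - Y) * G (x, y) \<partial>N \<partial>M) =
       (\<integral>\<^sup>+X. \<integral>\<^sup>+Y. (G (x, y) * \<theta> (x, y) * \<rho> (x - X)) * \<rho> (y - Y) \<partial>N \<partial>M)" by (simp add: mult_ac)
    also have "\<dots> = (\<integral>\<^sup>+X. (G (x, y) * \<theta> (x, y) * \<rho> (x - X)) * r y \<partial>M)"
      unfolding mollify_def by (intro nn_integral_cong nn_integral_cmult) measurable
    also have "\<dots> = (\<integral>\<^sup>+X. (G (x, y) * \<theta> (x, y) * r y) * \<rho> (x - X) \<partial>M)" by (simp add: mult_ac)
    also have "\<dots> = (G (x, y) * \<theta> (x, y) * r y) * p x"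
      unfolding mollify_def[of \<rho> M] by (intro nn_integral_cmult) measurable
    finally show ?thesis by (simp add: mult_ac)
  qed
  then show ?thesis by (subst nn_integral_lift(2)) auto
qed

lemma row_le_1:
  assumes \<theta>: "feasible p r \<theta>"
  shows "(\<integral>\<^sup>+Y. \<integral>\<^sup>+y. \<theta> (x, y) * \<rho> (y - Y) \<partial>lborel \<partial>N) \<le> 1"
proof -
  have [measurable]: "\<theta> \<in> borel_measurable (borel \<Otimes>\<^sub>M borel)" using \<theta> by (auto simp: feasible_def)
  have "(\<integral>\<^sup>+Y. \<integral>\<^sup>+y. \<theta> (x, y) * \<rho> (y - Y) \<partial>lborel \<partial>N) = (\<integral>\<^sup>+y. \<integral>\<^sup>+Y. \<theta> (x, y) * \<rho> (y - Y) \<partial>N \<partial>lborel)"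
    by (rule Nl.Fubini'[symmetric]) measurable
  also have "\<dots> = (\<integral>\<^sup>+y. \<theta> (x, y) * r y \<partial>lborel)"
    unfolding mollify_def by (intro nn_integral_cong nn_integral_cmult) measurable
  also have "\<dots> \<le> 1" using \<theta> by (auto simp: feasible_def)
  finally show ?thesis .
qed

text \<open>For fixed \<open>X\<close> and \<open>x\<close>, integrating over \<open>Y\<close> and
  \<open>y\<close> costs a factor at most 1 by feasibility; the remaining integral of \<rho> (x - X)
  over \<open>x\<close> is 1. Domination becomes equality once the total mass is 1.\<close>

lemma nn_integral_lift_fst_le:
  assumes \<theta>: "feasible p r \<theta>" and [measurable]: "F \<in> borel_measurable borel"
  shows "(\<integral>\<^sup>+z. F (fst (fst z)) \<partial>lift \<rho> M N \<theta>) \<le> (\<integral>\<^sup>+X. F X \<partial>M)"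
proof -
  have [measurable]: "\<theta> \<in> borel_measurable (borel \<Otimes>\<^sub>M borel)" using \<theta> by (auto simp: feasible_def)
  have inner: "(\<integral>\<^sup>+Y. \<integral>\<^sup>+x. \<integral>\<^sup>+y. \<theta> (x, y) * \<rho> (x - X) * \<rho> (y - Y) * F X \<partial>lborel \<partial>lborel \<partial>N) \<le> F X" for X
  proof -
    have "(\<integral>\<^sup>+Y. \<integral>\<^sup>+x. \<integral>\<^sup>+y. \<theta> (x, y) * \<rho> (x - X) * \<rho> (y - Y) * F X \<partial>lborel \<partial>lborel \<partial>N) =
       (\<integral>\<^sup>+x. \<integral>\<^sup>+Y. \<integral>\<^sup>+y. \<theta> (x, y) * \<rho> (x - X) * \<rho> (y - Y) * F X \<partial>lborel \<partial>N \<partial>lborel)"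
      by (rule Nl.Fubini'[symmetric]) measurable
    also have "\<dots> = (\<integral>\<^sup>+x. F X * \<rho> (x - X) * (\<integral>\<^sup>+Y. \<integral>\<^sup>+y. \<theta> (x, y) * \<rho> (y - Y) \<partial>lborel \<partial>N) \<partial>lborel)"
      by (simp add: nn_integral_cmult[symmetric] mult_ac)
    also have "\<dots> \<le> (\<integral>\<^sup>+x. F X * \<rho> (x - X) * 1 \<partial>lborel)"
      by (intro nn_integral_mono mult_left_mono row_le_1 \<theta>) auto
    also have "\<dots> = F X * (\<integral>\<^sup>+x. \<rho> (x - X) \<partial>lborel)"
      by (simp add: nn_integral_cmult)
    also have "\<dots> = F X" by (simp add: nn_integral_lborel_shift \<rho>1)
    finally show ?thesis .
  qed
  have "(\<integral>\<^sup>+z. F (fst (fst z)) \<partial>lift \<rho> M N \<theta>) =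
    (\<integral>\<^sup>+X. \<integral>\<^sup>+Y. \<integral>\<^sup>+x. \<integral>\<^sup>+y. \<theta> (x, y) * \<rho> (x - X) * \<rho> (y - Y) * F X \<partial>lborel \<partial>lborel \<partial>N \<partial>M)"
    by (subst nn_integral_lift(1)) auto
  also have "\<dots> \<le> (\<integral>\<^sup>+X. F X \<partial>M)" by (intro nn_integral_mono inner)
  finally show ?thesis .
qed

text \<open>The density of the law of \<open>(x + v X, y + v Y)\<close> under \<open>lift\<close>.
  It is relative to Lebesgue measure, whereas \<theta> is relative to the measure with densities
  \<open>p\<close> and \<open>r\<close>.\<close>

definition push :: "('a \<Rightarrow> 'a) \<Rightarrow> ('a \<times> 'a \<Rightarrow> ennreal) \<Rightarrow> 'a \<times> 'a \<Rightarrow> ennreal" where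
  "push v \<theta> z = (\<integral>\<^sup>+X. \<integral>\<^sup>+Y. \<theta> (fst z - v X, snd z - v Y) * \<rho> (fst z - v X - X) * \<rho> (snd z - v Y - Y) \<partial>N \<partial>M)"

lemma push_measurable:
  assumes [measurable]: "\<theta> \<in> borel_measurable (borel \<Otimes>\<^sub>M borel)" "v \<in> borel_measurable borel"
  shows "push v \<theta> \<in> borel_measurable (borel \<Otimes>\<^sub>M borel)"
  unfolding push_def by measurable

text \<open>For fixed \<open>X\<close> and \<open>Y\<close> the shift of \<open>y\<close> disappears
  by translation invariance, and feasibility bounds what is left of the second coordinate by
  1.\<close>

lemma push_marginal_le:
  assumes \<theta>: "feasible p r \<theta>" and v[measurable]: "v \<in> borel_measurable borel"
  shows "(\<integral>\<^sup>+y. push v \<theta> (x, y) \<partial>lborel) \<le> (\<integral>\<^sup>+X. \<rho> (x - v X - X) \<partial>M)"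
proof -
  have [measurable]: "\<theta> \<in> borel_measurable (borel \<Otimes>\<^sub>M borel)" using \<theta> by (auto simp: feasible_def)
  have inner: "(\<integral>\<^sup>+y. \<integral>\<^sup>+Y. \<theta> (x - v X, y - v Y) * \<rho> (x - v X - X) * \<rho> (y - v Y - Y) \<partial>N \<partial>lborel) \<le> \<rho> (x - v X - X)" for X
  proof -
    have "(\<integral>\<^sup>+y. \<integral>\<^sup>+Y. \<theta> (x - v X, y - v Y) * \<rho> (x - v X - X) * \<rho> (y - v Y - Y) \<partial>N \<partial>lborel) =
      (\<integral>\<^sup>+Y. \<integral>\<^sup>+y. \<theta> (x - v X, y - v Y) * \<rho> (x - v X - X) * \<rho> (y - v Y - Y) \<partial>lborel \<partial>N)"
      by (rule Nl.Fubini') measurable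
    also have "\<dots> = (\<integral>\<^sup>+Y. \<integral>\<^sup>+y. \<theta> (x - v X, y) * \<rho> (x - v X - X) * \<rho> (y - Y) \<partial>lborel \<partial>N)"
    proof (rule nn_integral_cong)
      fix Y
      show "(\<integral>\<^sup>+y. \<theta> (x - v X, y - v Y) * \<rho> (x - v X - X) * \<rho> (y - v Y - Y) \<partial>lborel) =
        (\<integral>\<^sup>+y. \<theta> (x - v X, y) * \<rho> (x - v X - X) * \<rho> (y - Y) \<partial>lborel)"
        by (rule nn_integral_lborel_shift[of "\<lambda>y. \<theta> (x - v X, y) * \<rho> (x - v X - X) * \<rho> (y - Y)" "v Y"]) measurable
    qed
    also have "\<dots> = \<rho> (x - v X - X) * (\<integral>\<^sup>+Y. \<integral>\<^sup>+y. \<theta> (x - v X, y) * \<rho> (y - Y) \<partial>lborel \<partial>N)"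
      by (simp add: nn_integral_cmult[symmetric] mult_ac)
    also have "\<dots> \<le> \<rho> (x - v X - X) * 1"
      by (intro mult_left_mono row_le_1 \<theta>) auto
    finally show ?thesis by simp
  qed
  have "(\<integral>\<^sup>+y. push v \<theta> (x, y) \<partial>lborel) =
      (\<integral>\<^sup>+X. \<integral>\<^sup>+y. \<integral>\<^sup>+Y. \<theta> (x - v X, y - v Y) * \<rho> (x - v X - X) * \<rho> (y - v Y - Y) \<partial>N \<partial>lborel \<partial>M)"
    unfolding push_def fst_conv snd_conv by (rule Ml.Fubini') measurable
  also have "\<dots> \<le> (\<integral>\<^sup>+X. \<rho> (x - v X - X) \<partial>M)" by (intro nn_integral_mono inner)
  finally show ?thesis .
qed

text \<open>For fixed \<open>X\<close> and \<open>Y\<close> the move is a translation of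
  \<open>(x, y)\<close>, so Lebesgue measure does not see it and it reappears in the argument of
  \<open>k\<close>.\<close>

lemma push_payoff:
  assumes [measurable]: "\<theta> \<in> borel_measurable (borel \<Otimes>\<^sub>M borel)" "v \<in> borel_measurable borel"
    "k \<in> borel_measurable borel"
  shows "(\<integral>\<^sup>+x. \<integral>\<^sup>+y. k (x - y) * push v \<theta> (x, y) \<partial>lborel \<partial>lborel) =
    (\<integral>\<^sup>+z. k (fst (snd z) - snd (snd z) + (v (fst (fst z)) - v (snd (fst z)))) \<partial>lift \<rho> M N \<theta>)"
proof -
  let ?H = "\<lambda>z. \<theta> (fst (snd z) - v (fst (fst z)), snd (snd z) - v (snd (fst z))) *
    \<rho> (fst (snd z) - v (fst (fst z)) - fst (fst z)) *
    \<rho> (snd (snd z) - v (snd (fst z)) - snd (fst z)) * k (fst (snd z) - snd (snd z))"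
  have Hm[measurable]: "?H \<in> borel_measurable ((M \<Otimes>\<^sub>M N) \<Otimes>\<^sub>M (lborel \<Otimes>\<^sub>M lborel))" by measurable
  have "(\<integral>\<^sup>+x. \<integral>\<^sup>+y. k (x - y) * push v \<theta> (x, y) \<partial>lborel \<partial>lborel) =
    (\<integral>\<^sup>+x. \<integral>\<^sup>+y. \<integral>\<^sup>+X. \<integral>\<^sup>+Y. ?H ((X, Y), (x, y)) \<partial>N \<partial>M \<partial>lborel \<partial>lborel)"
    unfolding push_def fst_conv snd_conv
    by (simp add: nn_integral_cmult[symmetric] mult_ac)
  also have "\<dots> = (\<integral>\<^sup>+X. \<integral>\<^sup>+Y. \<integral>\<^sup>+x. \<integral>\<^sup>+y. ?H ((X, Y), (x, y)) \<partial>lborel \<partial>lborel \<partial>N \<partial>M)"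
    unfolding nn_integral_quad(1)[OF Hm, symmetric] nn_integral_quad(2)[OF Hm] ..
  also have "\<dots> = (\<integral>\<^sup>+X. \<integral>\<^sup>+Y. \<integral>\<^sup>+x. \<integral>\<^sup>+y. \<theta> (x, y) * \<rho> (x - X) * \<rho> (y - Y) * k (x - y + (v X - v Y)) \<partial>lborel \<partial>lborel \<partial>N \<partial>M)"
  proof (rule nn_integral_cong, rule nn_integral_cong)
    fix X Y
    let ?g = "\<lambda>x y. \<theta> (x, y) * \<rho> (x - X) * \<rho> (y - Y) * k (x - y + (v X - v Y))"
    have "(\<integral>\<^sup>+x. \<integral>\<^sup>+y. ?H ((X, Y), (x, y)) \<partial>lborel \<partial>lborel) = (\<integral>\<^sup>+x. \<integral>\<^sup>+y. ?g (x - v X) (y - v Y) \<partial>lborel \<partial>lborel)"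
      by (simp add: algebra_simps)
    also have "\<dots> = (\<integral>\<^sup>+x. \<integral>\<^sup>+y. ?g (x - v X) y \<partial>lborel \<partial>lborel)"
    proof (rule nn_integral_cong)
      fix x
      show "(\<integral>\<^sup>+y. ?g (x - v X) (y - v Y) \<partial>lborel) = (\<integral>\<^sup>+y. ?g (x - v X) y \<partial>lborel)"
        by (rule nn_integral_lborel_shift[of "?g (x - v X)"]) measurable
    qed
    also have "\<dots> = (\<integral>\<^sup>+x. \<integral>\<^sup>+y. ?g x y \<partial>lborel \<partial>lborel)"
      by (rule nn_integral_lborel_shift[of "\<lambda>x. \<integral>\<^sup>+y. ?g x y \<partial>lborel"]) measurable
    finally show "(\<integral>\<^sup>+x. \<integral>\<^sup>+y. ?H ((X, Y), (x, y)) \<partial>lborel \<partial>lborel) = (\<integral>\<^sup>+x. \<integral>\<^sup>+y. ?g x y \<partial>lborel \<partial>lborel)" .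
  qed
  also have "\<dots> = (\<integral>\<^sup>+z. k (fst (snd z) - snd (snd z) + (v (fst (fst z)) - v (snd (fst z)))) \<partial>lift \<rho> M N \<theta>)"
    by (subst nn_integral_lift(1)) auto
  finally show ?thesis .
qed

lemma push_marginal_le':
  assumes \<theta>: "feasible p r \<theta>" and v[measurable]: "v \<in> borel_measurable borel"
  shows "(\<integral>\<^sup>+x. push v \<theta> (x, y) \<partial>lborel) \<le> (\<integral>\<^sup>+Y. \<rho> (y - v Y - Y) \<partial>N)"
proof -
  interpret S: mollified_pair N M \<rho> by (rule mollified_pair_swap)
  have [measurable]: "\<theta> \<in> borel_measurable (borel \<Otimes>\<^sub>M borel)" using \<theta> by (auto simp: feasible_def)
  have "push v \<theta> (x, y) = S.push v (\<lambda>z. \<theta> (snd z, fst z)) (y, x)" for x y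
  proof -
    have "push v \<theta> (x, y) = (\<integral>\<^sup>+Y. \<integral>\<^sup>+X. \<theta> (x - v X, y - v Y) * \<rho> (x - v X - X) * \<rho> (y - v Y - Y) \<partial>M \<partial>N)"
      unfolding push_def fst_conv snd_conv by (rule MN.Fubini'[symmetric]) measurable
    then show ?thesis by (simp add: S.push_def mult_ac)
  qed
  then show ?thesis using S.push_marginal_le[OF feasible_swap[OF \<theta>] v, of y] by simp
qed

lemma nn_integral_lift_snd_le:
  assumes \<theta>: "feasible p r \<theta>" and [measurable]: "F \<in> borel_measurable borel"
  shows "(\<integral>\<^sup>+z. F (snd (fst z)) \<partial>lift \<rho> M N \<theta>) \<le> (\<integral>\<^sup>+Y. F Y \<partial>N)"
proof -
  interpret S: mollified_pair N M \<rho> by (rule mollified_pair_swap)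
  have [measurable]: "\<theta> \<in> borel_measurable (borel \<Otimes>\<^sub>M borel)" using \<theta> by (auto simp: feasible_def)
  have "(\<integral>\<^sup>+z. F (snd (fst z)) \<partial>lift \<rho> M N \<theta>) =
    (\<integral>\<^sup>+x. \<integral>\<^sup>+y. \<integral>\<^sup>+X. \<integral>\<^sup>+Y. \<theta> (x, y) * \<rho> (x - X) * \<rho> (y - Y) * F Y \<partial>N \<partial>M \<partial>lborel \<partial>lborel)"
    by (subst nn_integral_lift(2)) auto
  also have "\<dots> = (\<integral>\<^sup>+x. \<integral>\<^sup>+y. \<integral>\<^sup>+Y. \<integral>\<^sup>+X. \<theta> (x, y) * \<rho> (x - X) * \<rho> (y - Y) * F Y \<partial>M \<partial>N \<partial>lborel \<partial>lborel)"
    by (rule nn_integral_cong, rule nn_integral_cong, rule MN.Fubini'[symmetric]) measurable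
  also have "\<dots> = (\<integral>\<^sup>+y. \<integral>\<^sup>+x. \<integral>\<^sup>+Y. \<integral>\<^sup>+X. \<theta> (x, y) * \<rho> (x - X) * \<rho> (y - Y) * F Y \<partial>M \<partial>N \<partial>lborel \<partial>lborel)"
    by (rule lborel_pair.Fubini'[symmetric]) measurable
  also have "\<dots> = (\<integral>\<^sup>+z. F (fst (fst z)) \<partial>lift \<rho> N M (\<lambda>z. \<theta> (snd z, fst z)))"
    by (subst S.nn_integral_lift(2)) (auto simp: mult_ac)
  also have "\<dots> \<le> (\<integral>\<^sup>+Y. F Y \<partial>N)"
    by (rule S.nn_integral_lift_fst_le[OF feasible_swap[OF \<theta>]]) measurable
  finally show ?thesis .
qed

text \<open>The pushed density may have too large marginals; multiplying it by \<open>p / max p p'\<close> and \<open>r / max r r'\<close>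
  repairs this at a cost of at most the total excess.\<close>

lemma push_thinning:
  fixes v :: "'l::finite \<Rightarrow> 'a \<Rightarrow> 'a"
  assumes \<theta>: "feasible p r \<theta>" and v[measurable]: "\<And>l. v l \<in> borel_measurable borel"
    and k[measurable]: "k \<in> borel_measurable borel" and k1: "\<And>x. k x \<le> 1"
    and fin: "\<And>x. \<rho> x \<le> C" "C < \<top>"
  shows "\<exists>\<theta>'. feasible p r \<theta>' \<and>
    (\<integral>\<^sup>+z. (\<Sum>l\<in>UNIV. k (fst (snd z) - snd (snd z) + (v l (fst (fst z)) - v l (snd (fst z))))) / of_nat CARD('l) \<partial>lift \<rho> M N \<theta>)
    \<le> payoff k p r \<theta>' + (\<integral>\<^sup>+x. shifted_average \<rho> v M x - p x \<partial>lborel) + (\<integral>\<^sup>+x. shifted_average \<rho> v N x - r x \<partial>lborel)"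
proof -
  let ?n = "of_nat CARD('l) :: ennreal"
  let ?pa = "shifted_average \<rho> v M" and ?ra = "shifted_average \<rho> v N"
  have \<theta>m[measurable]: "\<theta> \<in> borel_measurable (borel \<Otimes>\<^sub>M borel)" using \<theta> by (auto simp: feasible_def)
  have [measurable]: "?pa \<in> borel_measurable borel" "?ra \<in> borel_measurable borel"
    unfolding shifted_average_def by measurable
  note push_measurable[OF \<theta>m v, measurable]
  have n: "inverse ?n < \<top>" by (simp add: less_top[symmetric])
  define g where "g z = (\<Sum>l\<in>UNIV. push (v l) \<theta> z) * inverse ?n" for z
  have gm[measurable]: "g \<in> borel_measurable (borel \<Otimes>\<^sub>M borel)" unfolding g_def by measurable
  have gx: "(\<integral>\<^sup>+y. g (x, y) \<partial>lborel) \<le> ?pa x" for x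
  proof -
    have "(\<integral>\<^sup>+y. g (x, y) \<partial>lborel) = (\<Sum>l\<in>UNIV. \<integral>\<^sup>+y. push (v l) \<theta> (x, y) \<partial>lborel) * inverse ?n"
      unfolding g_def by (subst nn_integral_multc) (auto intro!: arg_cong2[where f="(*)"] nn_integral_sum)
    also have "\<dots> \<le> ?pa x" unfolding shifted_average_def divide_ennreal_def
      by (intro mult_right_mono sum_mono push_marginal_le \<theta> v) auto
    finally show ?thesis .
  qed
  have gy: "(\<integral>\<^sup>+x. g (x, y) \<partial>lborel) \<le> ?ra y" for y
  proof -
    have "(\<integral>\<^sup>+x. g (x, y) \<partial>lborel) = (\<Sum>l\<in>UNIV. \<integral>\<^sup>+x. push (v l) \<theta> (x, y) \<partial>lborel) * inverse ?n"
      unfolding g_def by (subst nn_integral_multc) (auto intro!: arg_cong2[where f="(*)"] nn_integral_sum)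
    also have "\<dots> \<le> ?ra y" unfolding shifted_average_def divide_ennreal_def
      by (intro mult_right_mono sum_mono push_marginal_le' \<theta> v) auto
    finally show ?thesis .
  qed
  \<comment> \<open>Boundedness of \<rho> keeps all densities finite, as the truncated differences
    in the loss estimate require.\<close>
  have fin_p: "mollify \<rho> M' x < \<top>" and fin_pa: "shifted_average \<rho> v M' x < \<top>"
    if "prob_space M'" for M' x
  proof -
    interpret prob_space M' by fact
    have "(\<integral>\<^sup>+X. \<rho> (f X) \<partial>M') \<le> C" for f
    proof -
      have "(\<integral>\<^sup>+X. \<rho> (f X) \<partial>M') \<le> (\<integral>\<^sup>+X. C \<partial>M')" by (intro nn_integral_mono fin)
      then show ?thesis by (simp add: emeasure_space_1)
    qed
    then have *: "(\<integral>\<^sup>+X. \<rho> (f X) \<partial>M') < \<top>" for f using fin(2) le_less_trans by blast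
    then show "mollify \<rho> M' x < \<top>" unfolding mollify_def by blast
    show "shifted_average \<rho> v M' x < \<top>" unfolding shifted_average_def using * n
      by (simp add: divide_ennreal_def ennreal_mult_less_top)
  qed
  define A where "A x = p x * inverse (max (p x) (?pa x))" for x
  define B where "B x = r x * inverse (max (r x) (?ra x))" for x
  have [measurable]: "A \<in> borel_measurable borel" "B \<in> borel_measurable borel"
    unfolding A_def B_def by measurable
  have AB: "A x \<le> 1" "B x \<le> 1" for x
    unfolding A_def B_def by (auto intro!: ennreal_mult_inverse_le_1)
  \<comment> \<open>This passes from a Lebesgue density to one relative to \<open>p\<close> and
    \<open>r\<close>. Dividing by the maxima instead of by \<open>p\<close> and \<open>r\<close>
    performs the thinning in the same stroke and makes \<open>\<theta>' p r = g A B\<close> hold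
    where \<open>p\<close> or \<open>r\<close> vanishes as well.\<close>
  define \<theta>' where "\<theta>' z = g z * inverse (max (p (fst z)) (?pa (fst z))) * inverse (max (r (snd z)) (?ra (snd z)))" for z
  have [measurable]: "\<theta>' \<in> borel_measurable (borel \<Otimes>\<^sub>M borel)" unfolding \<theta>'_def by measurable
  have \<theta>'eq: "\<theta>' (x, y) * p x * r y = g (x, y) * (A x * B y)" for x y
    by (simp add: \<theta>'_def A_def B_def mult_ac)
  have f1: "(\<integral>\<^sup>+y. \<theta>' (x, y) * r y \<partial>lborel) \<le> 1" for x
    using thinned_marginal_le[of "\<lambda>y. g (x, y)" lborel "?pa x" B "p x"] gx AB by (simp add: \<theta>'_def B_def mult_ac)
  have f2: "(\<integral>\<^sup>+x. \<theta>' (x, y) * p x \<partial>lborel) \<le> 1" for y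
    using thinned_marginal_le[of "\<lambda>x. g (x, y)" lborel "?ra y" A "r y"] gy AB by (simp add: \<theta>'_def A_def mult_ac)
  have feas: "feasible p r \<theta>'" using f1 f2 by (auto simp: feasible_def)
  have d1: "(\<integral>\<^sup>+x. \<integral>\<^sup>+y. g (x, y) * (1 - A x) \<partial>lborel \<partial>lborel) \<le> (\<integral>\<^sup>+x. ?pa x - p x \<partial>lborel)"
    unfolding A_def
    by (rule nn_integral_mono, rule thinning_loss_le[OF _ gx]) (auto intro: fin_p fin_pa M.prob_space_axioms)
  have d2: "(\<integral>\<^sup>+y. \<integral>\<^sup>+x. g (x, y) * (1 - B y) \<partial>lborel \<partial>lborel) \<le> (\<integral>\<^sup>+x. ?ra x - r x \<partial>lborel)"
    unfolding B_def
    by (rule nn_integral_mono, rule thinning_loss_le[OF _ gy]) (auto intro: fin_p fin_pa N.prob_space_axioms)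
  have pt: "k (x - y) * g (x, y) \<le> k (x - y) * (\<theta>' (x, y) * p x * r y) + g (x, y) * (1 - A x) + g (x, y) * (1 - B y)" for x y
  proof -
    have "k (x - y) * g (x, y) * 1 \<le> k (x - y) * g (x, y) * (A x * B y + (1 - A x) + (1 - B y))"
      by (intro mult_left_mono one_le_thinning AB) auto
    also have "\<dots> = k (x - y) * (\<theta>' (x, y) * p x * r y) + k (x - y) * (g (x, y) * (1 - A x)) + k (x - y) * (g (x, y) * (1 - B y))"
      unfolding \<theta>'eq by (simp add: distrib_left mult_ac)
    also have "\<dots> \<le> k (x - y) * (\<theta>' (x, y) * p x * r y) + 1 * (g (x, y) * (1 - A x)) + 1 * (g (x, y) * (1 - B y))"
      by (intro add_mono order_refl mult_right_mono k1) auto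
    finally show ?thesis by simp
  qed
  have "(\<integral>\<^sup>+z. (\<Sum>l\<in>UNIV. k (fst (snd z) - snd (snd z) + (v l (fst (fst z)) - v l (snd (fst z))))) / ?n \<partial>lift \<rho> M N \<theta>)
    = (\<Sum>l\<in>UNIV. \<integral>\<^sup>+z. k (fst (snd z) - snd (snd z) + (v l (fst (fst z)) - v l (snd (fst z)))) \<partial>lift \<rho> M N \<theta>) * inverse ?n"
    unfolding divide_ennreal_def
    by (subst nn_integral_multc) (auto simp: lift_def intro!: arg_cong2[where f="(*)"] nn_integral_sum)
  also have "\<dots> = (\<Sum>l\<in>UNIV. \<integral>\<^sup>+x. \<integral>\<^sup>+y. k (x - y) * push (v l) \<theta> (x, y) \<partial>lborel \<partial>lborel) * inverse ?n"
    by (simp add: push_payoff)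
  also have "\<dots> = (\<integral>\<^sup>+x. \<integral>\<^sup>+y. k (x - y) * g (x, y) \<partial>lborel \<partial>lborel)"
    unfolding g_def
    by (simp add: nn_integral_sum[symmetric] nn_integral_multc[symmetric] sum_distrib_left mult.assoc[symmetric])
  also have "\<dots> \<le> (\<integral>\<^sup>+x. \<integral>\<^sup>+y. k (x - y) * (\<theta>' (x, y) * p x * r y) + g (x, y) * (1 - A x) + g (x, y) * (1 - B y) \<partial>lborel \<partial>lborel)"
    by (intro nn_integral_mono pt)
  also have "\<dots> = payoff k p r \<theta>' + (\<integral>\<^sup>+x. \<integral>\<^sup>+y. g (x, y) * (1 - A x) \<partial>lborel \<partial>lborel) + (\<integral>\<^sup>+x. \<integral>\<^sup>+y. g (x, y) * (1 - B y) \<partial>lborel \<partial>lborel)"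
    by (simp add: payoff_def nn_integral_add)
  also have "(\<integral>\<^sup>+x. \<integral>\<^sup>+y. g (x, y) * (1 - B y) \<partial>lborel \<partial>lborel) = (\<integral>\<^sup>+y. \<integral>\<^sup>+x. g (x, y) * (1 - B y) \<partial>lborel \<partial>lborel)"
    by (rule lborel_pair.Fubini'[symmetric]) measurable
  also have "payoff k p r \<theta>' + (\<integral>\<^sup>+x. \<integral>\<^sup>+y. g (x, y) * (1 - A x) \<partial>lborel \<partial>lborel) + (\<integral>\<^sup>+y. \<integral>\<^sup>+x. g (x, y) * (1 - B y) \<partial>lborel \<partial>lborel)
     \<le> payoff k p r \<theta>' + (\<integral>\<^sup>+x. ?pa x - p x \<partial>lborel) + (\<integral>\<^sup>+x. ?ra x - r x \<partial>lborel)"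
    by (intro add_mono order_refl d1 d2)
  finally show ?thesis using feas by blast
qed

end

section \<open>Couplings close to the diagonal\<close>

text \<open>Inner regularity of the image measure on the graph replaces Lusin's theorem: \<open>F\<close> is continuous on the
  projection of \<open>K\<close>.\<close>

lemma Lusin_graph:
  fixes F :: "'a::euclidean_space \<Rightarrow> 'b::euclidean_space"
  assumes M: "sets M = sets borel" "prob_space M" and F[measurable]: "F \<in> borel_measurable borel"
    and e: "e > 0"
  shows "\<exists>K. compact K \<and> (\<forall>z\<in>K. snd z = F (fst z)) \<and> emeasure M {x. (x, F x) \<notin> K} \<le> ennreal e"
proof -
  interpret prob_space M by fact
  note [measurable_cong] = M(1)
  let ?G = "{z. snd z = F (fst z)} :: ('a \<times> 'b) set"
  let ?N = "distr M borel (\<lambda>x. (x, F x))"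
  have "?G = {z \<in> space (borel \<Otimes>\<^sub>M borel). dist (snd z) (F (fst z)) \<le> 0}" by (auto simp: space_pair_measure)
  also have "\<dots> \<in> sets (borel \<Otimes>\<^sub>M borel)" by measurable
  finally have G: "?G \<in> sets borel" unfolding borel_prod .
  have m: "(\<lambda>x. (x, F x)) \<in> measurable M borel" by measurable
  interpret N: prob_space ?N by (rule prob_space_distr[OF m])
  have one: "emeasure ?N ?G = 1"
  proof -
    have "emeasure ?N ?G = emeasure M ((\<lambda>x. (x, F x)) -` ?G \<inter> space M)"
      by (rule emeasure_distr[OF m]) (use G in auto)
    also have "(\<lambda>x. (x, F x)) -` ?G \<inter> space M = space M" by auto
    finally show ?thesis using emeasure_space_1 by simp
  qed
  have "emeasure ?N ?G = (SUP K \<in> {K. K \<subseteq> ?G \<and> compact K}. emeasure ?N K)"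
    by (rule inner_regular[OF _ _ G]) (auto simp: N.emeasure_eq_measure)
  moreover have "1 - ennreal e < 1" using e by (simp add: ennreal_minus_if ennreal_1[symmetric] ennreal_lessI del: ennreal_1)
  ultimately have "\<exists>K\<in>{K. K \<subseteq> ?G \<and> compact K}. 1 - ennreal e < emeasure ?N K"
    unfolding one by (metis (no_types, lifting) less_SUP_iff)
  then obtain K where K: "K \<subseteq> ?G" "compact K" "1 - ennreal e < emeasure ?N K" by blast
  have Kb[measurable]: "K \<in> sets borel" using K(2) by (simp add: compact_imp_closed)
  have eK: "emeasure ?N K = emeasure M {x\<in>space M. (x, F x) \<in> K}"
    by (subst emeasure_distr[OF m]) (auto intro!: arg_cong[where f="emeasure M"])
  have sp: "space M = UNIV" using M(1) sets_eq_imp_space_eq space_borel by metis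
  have "emeasure M {x. (x, F x) \<notin> K} = emeasure M (space M - {x\<in>space M. (x, F x) \<in> K})"
    by (rule arg_cong[where f="emeasure M"]) (auto simp: sp)
  also have "\<dots> = 1 - emeasure M {x\<in>space M. (x, F x) \<in> K}"
    by (subst emeasure_compl) (auto simp: emeasure_space_1)
  also have "\<dots> \<le> ennreal e"
    using K(3) unfolding eK emeasure_eq_measure using e
    by (auto simp: ennreal_minus_if ennreal_1[symmetric] ennreal_less_iff simp del: ennreal_1 intro!: ennreal_leI split: if_splits)
  finally show ?thesis using K by blast
qed

definition coupling :: "'a::euclidean_space measure \<Rightarrow> 'a measure \<Rightarrow> ('a \<times> 'a) measure \<Rightarrow> bool" where
  "coupling M N P \<longleftrightarrow> sets P = sets (borel \<Otimes>\<^sub>M borel) \<and> distr P borel fst = M \<and> distr P borel snd = N"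

text \<open>If \<open>x\<close> lies in \<open>C\<close> and \<open>y\<close> is within
  \<open>1/(n+1)\<close> of \<open>x\<close>, then \<open>y\<close> lies in the neighbourhood
  \<open>A n\<close>. Taking both distance and exceptional mass equal to \<open>1/(n+1)\<close> and
  letting \<open>n\<close> grow, \<open>A n\<close> shrinks to the closed set
  \<open>C\<close>.\<close>

lemma coupling_near_diagonal_le:
  fixes M N :: "'a::euclidean_space measure"
  assumes M: "sets M = sets borel" "prob_space M" and N: "sets N = sets borel" "prob_space N"
    and P: "\<And>\<eta> \<alpha>. \<eta> > 0 \<Longrightarrow> \<alpha> > 0 \<Longrightarrow>
      \<exists>P. coupling M N P \<and> emeasure P {z. dist (fst z) (snd z) \<ge> \<eta>} \<le> ennreal \<alpha>"
    and C: "closed C"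
  shows "emeasure M C \<le> emeasure N C"
proof (cases "C = {}")
  case False
  interpret N: prob_space N by fact
  define A where "A n = {x. infdist x C \<le> 1 / real (Suc n)}" for n
  have Ab[measurable]: "A n \<in> sets borel" for n unfolding A_def
    by (intro borel_closed closed_Collect_le continuous_intros)
  have le: "emeasure M C \<le> emeasure N (A n) + ennreal (1 / real (Suc n))" for n
  proof -
    obtain P where cP: "coupling M N P"
      and P: "emeasure P {z. dist (fst z) (snd z) \<ge> 1 / real (Suc n)} \<le> ennreal (1 / real (Suc n))"
      using P[of "1 / real (Suc n)" "1 / real (Suc n)"] by auto
    have sP[measurable_cong]: "sets P = sets (borel \<Otimes>\<^sub>M borel)" and dM: "distr P borel fst = M" and dN: "distr P borel snd = N"
      using cP by (auto simp: coupling_def)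
    have [measurable]: "C \<in> sets borel" using C by simp
    have spP: "space P = UNIV" using sets_eq_imp_space_eq[OF sP] by (simp add: space_pair_measure)
    have "emeasure M C = emeasure P (fst -` C)"
      unfolding dM[symmetric] by (subst emeasure_distr) (auto simp: spP)
    also have "\<dots> \<le> emeasure P (snd -` A n \<union> {z. dist (fst z) (snd z) \<ge> 1 / real (Suc n)})"
    proof (rule emeasure_mono)
      show "fst -` C \<subseteq> snd -` A n \<union> {z. dist (fst z) (snd z) \<ge> 1 / real (Suc n)}"
      proof clarsimp
        fix x y assume "x \<in> C" "y \<notin> A n"
        then show "1 / (1 + real n) \<le> dist x y"
          using infdist_le[of x C y] by (simp add: A_def dist_commute)
      qed
      have "snd -` A n \<inter> space P \<in> sets P" by measurable
      moreover have "{z\<in>space P. dist (fst z) (snd z) \<ge> 1 / real (Suc n)} \<in> sets P" by measurable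
      ultimately show "snd -` A n \<union> {z. dist (fst z) (snd z) \<ge> 1 / real (Suc n)} \<in> sets P"
        by (auto simp: spP)
    qed
    also have "\<dots> \<le> emeasure P (snd -` A n) + emeasure P {z. dist (fst z) (snd z) \<ge> 1 / real (Suc n)}"
    proof (rule emeasure_subadditive)
      have "snd -` A n \<inter> space P \<in> sets P" by measurable
      then show "snd -` A n \<in> sets P" by (simp add: spP)
      have "{z\<in>space P. dist (fst z) (snd z) \<ge> 1 / real (Suc n)} \<in> sets P" by measurable
      then show "{z. dist (fst z) (snd z) \<ge> 1 / real (Suc n)} \<in> sets P" by (simp add: spP)
    qed
    also have "emeasure P (snd -` A n) = emeasure N (A n)"
      unfolding dN[symmetric] by (subst emeasure_distr) (auto simp: spP)
    finally show ?thesis by (rule order_trans) (intro add_left_mono P)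
  qed
  have "(\<lambda>n. emeasure N (A n)) \<longlonglongrightarrow> emeasure N (\<Inter>n. A n)"
  proof (rule Lim_emeasure_decseq)
    show "range A \<subseteq> sets N" unfolding N(1) image_subset_iff by (intro ballI Ab)
    have "A n \<subseteq> A m" if "m \<le> n" for m n
      unfolding A_def using frac_le[of 1 1 "real (Suc m)" "real (Suc n)"] that by auto
    then show "decseq A" by (auto simp: decseq_def)
  qed (simp add: N.emeasure_eq_measure)
  moreover have "(\<Inter>n. A n) = C"
  proof (intro equalityI subsetI)
    fix x assume "x \<in> (\<Inter>n. A n)"
    then have "infdist x C \<le> 1 / real (Suc n)" for n by (auto simp: A_def)
    then have "infdist x C \<le> 0"
      by (intro LIMSEQ_le_const[OF LIMSEQ_Suc[OF lim_1_over_n]]) auto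
    then have "infdist x C = 0" using infdist_nonneg[of x C] by linarith
    then show "x \<in> C" using in_closed_iff_infdist_zero[OF C False] by blast
  qed (auto simp: A_def)
  moreover have "(\<lambda>n. ennreal (1 / real (Suc n))) \<longlonglongrightarrow> ennreal 0"
    by (intro tendsto_ennrealI LIMSEQ_Suc[OF lim_1_over_n])
  ultimately have "(\<lambda>n. emeasure N (A n) + ennreal (1 / real (Suc n))) \<longlonglongrightarrow> emeasure N C + 0"
    by (intro tendsto_add) auto
  then show ?thesis using le by (intro LIMSEQ_le_const[where X="\<lambda>n. emeasure N (A n) + ennreal (1 / real (Suc n))"]) auto
qed simp

lemma coupling_near_diagonal_imp_eq:
  fixes M N :: "'a::euclidean_space measure"
  assumes M: "sets M = sets borel" "prob_space M" and N: "sets N = sets borel" "prob_space N"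
    and P: "\<And>\<eta> \<alpha>. \<eta> > 0 \<Longrightarrow> \<alpha> > 0 \<Longrightarrow>
      \<exists>P. coupling M N P \<and> emeasure P {z. dist (fst z) (snd z) \<ge> \<eta>} \<le> ennreal \<alpha>"
  shows "M = N"
proof -
  interpret M: prob_space M by fact
  interpret N: prob_space N by fact
  have le: "emeasure M C \<le> emeasure N C" if "closed C" for C
    using coupling_near_diagonal_le[OF M N P that] .
  have le2: "emeasure N C \<le> emeasure M C" if "closed C" for C
  proof (rule coupling_near_diagonal_le[OF N M _ that])
    fix \<eta> \<alpha> :: real assume "\<eta> > 0" "\<alpha> > 0"
    then obtain P where cP: "coupling M N P"
      and e: "emeasure P {z. dist (fst z) (snd z) \<ge> \<eta>} \<le> ennreal \<alpha>" using P by blast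
    have sP[measurable_cong]: "sets P = sets (borel \<Otimes>\<^sub>M borel)" and dM: "distr P borel fst = M" and dN: "distr P borel snd = N"
      using cP by (auto simp: coupling_def)
    have spP: "space P = UNIV" using sets_eq_imp_space_eq[OF sP] by (simp add: space_pair_measure)
    let ?sw = "\<lambda>z. (snd z, fst z)"
    let ?B = "borel \<Otimes>\<^sub>M borel :: ('a \<times> 'a) measure"
    have m: "?sw \<in> measurable P ?B" by measurable
    have "coupling N M (distr P ?B ?sw)"
      unfolding coupling_def dM[symmetric] dN[symmetric]
      by (auto simp: distr_distr m comp_def)
    moreover have "{z \<in> space ?B. dist (fst z) (snd z) \<ge> \<eta>} \<in> sets ?B" by measurable
    then have "{z. dist (fst z) (snd z) \<ge> \<eta>} \<in> sets ?B" by (simp add: space_pair_measure)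
    then have "emeasure (distr P ?B ?sw) {z. dist (fst z) (snd z) \<ge> \<eta>} \<le> ennreal \<alpha>"
      using e by (subst emeasure_distr[OF m]) (auto simp: spP dist_commute vimage_def)
    ultimately show "\<exists>P. coupling N M P \<and> emeasure P {z. dist (fst z) (snd z) \<ge> \<eta>} \<le> ennreal \<alpha>"
      by blast
  qed
  show ?thesis
  proof (rule measure_eqI_generator_eq[where E="Collect closed" and \<Omega>=UNIV and A="\<lambda>_. UNIV"])
    show "Int_stable (Collect closed)" by (auto simp: Int_stable_def)
    show "emeasure M X = emeasure N X" if "X \<in> Collect closed" for X
      using le[of X] le2[of X] that by auto
  qed (auto simp: M N borel_eq_closed)
qed

text \<open>With discontinuous coefficients \<open>q\<close> need not stay away from 0 off the
  diagonal, not even on compact sets. Compact pieces of the graphs of the coefficients repair this: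
  on separated pairs from them the integrand has a positive minimum \<tau>, and Markov's inequality
  bounds the mass of such pairs. The three shares \<alpha> / 3 are for the two exceptional sets and
  for Markov. Since the pieces determine both \<tau> and the bound on the coefficients, the
  couplings are assumed for every \<open>R\<close> and \<delta>.\<close>

lemma dissipative_coupling_imp_eq:
  fixes Sig :: "real^'n::finite \<Rightarrow> real^'m::finite^'n"
  assumes meas[measurable]: "Sig \<in> borel_measurable borel" "b \<in> borel_measurable borel"
    and q: "\<And>x y. x \<noteq> y \<Longrightarrow> qfun Sig b x y < 0"
    and M: "sets M = sets borel" "prob_space M" and N: "sets N = sets borel" "prob_space N"
    and P: "\<And>R \<delta>. \<delta> > 0 \<Longrightarrow> \<exists>P. coupling M N P \<and>
      (\<integral>\<^sup>+z. (case z of (x, y) \<Rightarrow> if norm (b x) + (norm (Sig x))\<^sup>2 \<le> R \<and> norm (b y) + (norm (Sig y))\<^sup>2 \<le> R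
         then ennreal (exp (- (norm (x - y) + 2)\<^sup>2 / 2) * - qfun Sig b x y) else 0) \<partial>P) \<le> ennreal \<delta>"
  shows "M = N"
proof (rule coupling_near_diagonal_imp_eq[OF M N])
  fix \<eta> \<alpha> :: real assume pos: "\<eta> > 0" "\<alpha> > 0"
  interpret M: prob_space M by fact
  interpret N: prob_space N by fact
  let ?F = "\<lambda>x. (b x, Sig x)"
  obtain K1 where K1: "compact K1" "\<And>z. z \<in> K1 \<Longrightarrow> snd z = ?F (fst z)" "emeasure M {x. (x, ?F x) \<notin> K1} \<le> ennreal (\<alpha> / 3)"
    using Lusin_graph[OF M, of ?F "\<alpha> / 3"] pos by auto
  obtain K2 where K2: "compact K2" "\<And>z. z \<in> K2 \<Longrightarrow> snd z = ?F (fst z)" "emeasure N {x. (x, ?F x) \<notin> K2} \<le> ennreal (\<alpha> / 3)"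
    using Lusin_graph[OF N, of ?F "\<alpha> / 3"] pos by auto
  \<comment> \<open>The coefficient values are separate arguments here, which makes \<open>g\<close>
    continuous although \<open>q\<close> is only measurable.\<close>
  define g where "g = (\<lambda>z :: ((real^'n) \<times> (real^'n) \<times> (real^'m^'n)) \<times> ((real^'n) \<times> (real^'n) \<times> (real^'m^'n)).
     exp (- (norm (fst (fst z) - fst (snd z)) + 2)\<^sup>2 / 2) *
     - ((fst (fst z) - fst (snd z)) \<bullet> (fst (snd (fst z)) - fst (snd (snd z)))
        + (norm (snd (snd (fst z)) - snd (snd (snd z))))\<^sup>2))"
  have g: "g ((x, ?F x), (y, ?F y)) = exp (- (norm (x - y) + 2)\<^sup>2 / 2) * - qfun Sig b x y" for x y
    by (simp add: g_def qfun_def trace_mult_transpose)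
  let ?D = "(K1 \<times> K2) \<inter> {z. dist (fst (fst z)) (fst (snd z)) \<ge> \<eta>}"
  have D: "compact ?D"
    by (intro compact_Int_closed compact_Times K1 K2 closed_Collect_le continuous_intros)
  have gpos: "g z > 0" if "z \<in> ?D" for z
  proof -
    obtain x y where xy: "z = ((x, ?F x), (y, ?F y))"
    proof
      have "fst z \<in> K1" "snd z \<in> K2" using \<open>z \<in> ?D\<close> by auto
      then show "z = ((fst (fst z), ?F (fst (fst z))), (fst (snd z), ?F (fst (snd z))))"
        by (intro prod_eqI) (simp_all only: fst_conv snd_conv K1(2) K2(2))
    qed
    then have "x \<noteq> y" using that pos by auto
    then show ?thesis using q[of x y] unfolding xy g by (simp add: mult_pos_neg)
  qed
  have "\<exists>\<tau>>0. \<forall>z\<in>?D. \<tau> \<le> g z"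
  proof (cases "?D = {}")
    case True
    then show ?thesis by (intro exI[of _ 1]) auto
  next
    case False
    have "continuous_on ?D g" unfolding g_def by (intro continuous_intros) auto
    from continuous_attains_inf[OF D False this] gpos show ?thesis by blast
  qed
  then obtain \<tau> where \<tau>: "\<tau> > 0" "\<And>z. z \<in> ?D \<Longrightarrow> \<tau> \<le> g z" by blast
  define c where "c = (\<lambda>z :: (real^'n) \<times> (real^'n) \<times> (real^'m^'n). norm (fst (snd z)) + (norm (snd (snd z)))\<^sup>2)"
  have "bounded (c ` (K1 \<union> K2))"
    unfolding c_def by (intro compact_imp_bounded compact_continuous_image compact_Un K1 K2 continuous_intros)
  \<comment> \<open>\<open>R\<close> bounds the coefficients on both compact pieces, so the
    truncation in the integrand is inactive there.\<close>
  then obtain R where R: "\<And>z. z \<in> K1 \<union> K2 \<Longrightarrow> norm (c z) \<le> R"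
    by (auto simp: bounded_iff)
  let ?I = "\<lambda>z. (case z of (x, y) \<Rightarrow> if norm (b x) + (norm (Sig x))\<^sup>2 \<le> R \<and> norm (b y) + (norm (Sig y))\<^sup>2 \<le> R
         then ennreal (exp (- (norm (x - y) + 2)\<^sup>2 / 2) * - qfun Sig b x y) else 0)"
  obtain P where cP: "coupling M N P" and IP: "(\<integral>\<^sup>+z. ?I z \<partial>P) \<le> ennreal (\<tau> * (\<alpha> / 3))"
    using P[of "\<tau> * (\<alpha> / 3)" R] pos \<tau> by auto
  have sP[measurable_cong]: "sets P = sets (borel \<Otimes>\<^sub>M borel)" and dM: "distr P borel fst = M" and dN: "distr P borel snd = N"
    using cP by (auto simp: coupling_def)
  have spP: "space P = UNIV" using sets_eq_imp_space_eq[OF sP] by (simp add: space_pair_measure)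
  have [measurable]: "K1 \<in> sets borel" "K2 \<in> sets borel"
    using K1(1) K2(1) by (auto simp: compact_imp_closed)
  have Im[measurable]: "?I \<in> borel_measurable P"
    unfolding qfun_def trace_mult_transpose by measurable
  let ?A = "{z. (fst z, ?F (fst z)) \<notin> K1}" and ?B = "{z. (snd z, ?F (snd z)) \<notin> K2}"
    and ?E = "{z. ennreal \<tau> \<le> ?I z}"
  have mm: "?A \<in> sets P" "?B \<in> sets P" "?E \<in> sets P"
  proof -
    have "{z\<in>space P. (fst z, ?F (fst z)) \<notin> K1} \<in> sets P" by measurable
    then show "?A \<in> sets P" by (simp add: spP)
    have "{z\<in>space P. (snd z, ?F (snd z)) \<notin> K2} \<in> sets P" by measurable
    then show "?B \<in> sets P" by (simp add: spP)
    have "{z\<in>space P. ennreal \<tau> \<le> ?I z} \<in> sets P" by measurable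
    then show "?E \<in> sets P" by (simp add: spP)
  qed
  have eA: "emeasure P ?A \<le> ennreal (\<alpha> / 3)"
  proof -
    have "{x. (x, ?F x) \<notin> K1} \<in> sets borel" by measurable
    then have "emeasure P ?A = emeasure M {x. (x, ?F x) \<notin> K1}"
      unfolding dM[symmetric] by (subst emeasure_distr) (auto simp: spP vimage_def)
    then show ?thesis using K1 by simp
  qed
  have eB: "emeasure P ?B \<le> ennreal (\<alpha> / 3)"
  proof -
    have "{x. (x, ?F x) \<notin> K2} \<in> sets borel" by measurable
    then have "emeasure P ?B = emeasure N {x. (x, ?F x) \<notin> K2}"
      unfolding dN[symmetric] by (subst emeasure_distr) (auto simp: spP vimage_def)
    then show ?thesis using K2 by simp
  qed
  have eE: "emeasure P ?E \<le> ennreal (\<alpha> / 3)"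
  proof -
    have "ennreal \<tau> * emeasure P ?E \<le> (\<integral>\<^sup>+z. ?I z \<partial>P)"
      by (subst nn_integral_cmult_indicator[symmetric, OF mm(3)])
        (auto intro!: nn_integral_mono simp: indicator_def)
    also have "\<dots> \<le> ennreal (\<tau> * (\<alpha> / 3))" by (rule IP)
    also have "\<dots> = ennreal \<tau> * ennreal (\<alpha> / 3)"
      using \<tau>(1) pos by (intro ennreal_mult) auto
    finally show ?thesis
      using \<tau>(1) by (simp add: ennreal_mult_le_mult_iff)
  qed
  have "{z. dist (fst z) (snd z) \<ge> \<eta>} \<subseteq> ?A \<union> ?B \<union> ?E"
  proof
    fix z assume z: "z \<in> {z :: (real^'n) \<times> (real^'n). dist (fst z) (snd z) \<ge> \<eta>}"
    obtain x y where xy: "z = (x, y)" by (cases z)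
    show "z \<in> ?A \<union> ?B \<union> ?E"
    proof (cases "z \<in> ?A \<union> ?B")
      case False
      then have K: "(x, ?F x) \<in> K1" "(y, ?F y) \<in> K2" using xy by auto
      then have "((x, ?F x), (y, ?F y)) \<in> ?D" using z xy by auto
      from \<tau>(2)[OF this] have "\<tau> \<le> exp (- (norm (x - y) + 2)\<^sup>2 / 2) * - qfun Sig b x y"
        unfolding g .
      moreover have "norm (b x) + (norm (Sig x))\<^sup>2 \<le> R" "norm (b y) + (norm (Sig y))\<^sup>2 \<le> R"
        using R[of "(x, ?F x)"] R[of "(y, ?F y)"] K by (auto simp: c_def)
      ultimately have "z \<in> ?E" using xy by (simp add: ennreal_leI)
      then show ?thesis by blast
    qed blast
  qed
  then have "emeasure P {z. dist (fst z) (snd z) \<ge> \<eta>} \<le> emeasure P (?A \<union> ?B \<union> ?E)"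
    using mm by (intro emeasure_mono) auto
  also have "\<dots> \<le> emeasure P ?A + emeasure P ?B + emeasure P ?E"
    using mm by (meson add_right_mono emeasure_subadditive order_trans sets.Un)
  also have "\<dots> \<le> ennreal (\<alpha> / 3) + ennreal (\<alpha> / 3) + ennreal (\<alpha> / 3)"
    by (intro add_mono eA eB eE)
  also have "\<dots> = ennreal \<alpha>" using pos by (simp add: ennreal_plus[symmetric] del: ennreal_plus)
  finally show "\<exists>P. coupling M N P \<and> emeasure P {z. dist (fst z) (snd z) \<ge> \<eta>} \<le> ennreal \<alpha>"
    using cP by blast
qed

section \<open>Invariance of the mollified measure under a step\<close>

lemma continuous_tbump: "continuous_on UNIV (tbump c s a)"
  unfolding tbump_def by (intro continuous_intros)

lemma tbump_measurable[measurable]: "tbump c s a \<in> borel_measurable borel"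
  by (intro borel_measurable_continuous_onI continuous_tbump)

lemma tbump_nonneg: "c \<ge> 0 \<Longrightarrow> tbump c s a x \<ge> 0"
  by (simp add: tbump_def prod_nonneg bump_0_nonneg)

lemma tbump_reflect: "tbump c s 0 (x - X) = tbump c (- s) (s *\<^sub>R x) X"
  by (simp add: tbump_def algebra_simps)

text \<open>The last condition confines the support to the ball of radius \<epsilon>: all
  coordinates are below \<open>1 / s\<close> in absolute value, so the l1 norm is at most
  \<open>CARD('n) / s\<close>.\<close>

lemma exists_mollifier:
  assumes "\<epsilon> > 0"
  shows "\<exists>c s. c > 0 \<and> s > 0 \<and> (\<integral>\<^sup>+x. ennreal (tbump c s (0::real^'n::finite) x) \<partial>lborel) = 1 \<and>
    real CARD('n) \<le> s * \<epsilon>"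
proof -
  define s where "s = real CARD('n) / \<epsilon>"
  have s: "s > 0" using assms by (simp add: s_def)
  let ?f = "tbump 1 s (0::real^'n)"
  let ?I = "\<integral>\<^sup>+x. ennreal (?f x) \<partial>lborel"
  have "continuous_on UNIV ?f" by (rule continuous_tbump)
  have "compact (closure {x. ?f x \<noteq> 0})" using tbump_C0_inf[of s 1 "0::real^'n"] s by (simp add: C0_inf_def)
  then have "bounded {x. ?f x \<noteq> 0}" using bounded_closure_image compact_imp_bounded bounded_subset closure_subset by metis
  then obtain B where "\<And>x. ?f x \<noteq> 0 \<Longrightarrow> norm x \<le> B" unfolding bounded_iff by blast
  then have B: "\<not> norm x \<le> B \<Longrightarrow> ?f x = 0" for x by blast
  obtain C where C: "\<And>n t. n \<le> 0 \<Longrightarrow> \<bar>bump n t\<bar> \<le> C" using bump_bounded[of 0] by blast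
  have le: "?f x \<le> C ^ CARD('n)" for x
    using iter_pdiff_tbump_bound[of 0 C "[]" 1 s "0::real^'n" x, OF C] by simp
  have "?I \<le> (\<integral>\<^sup>+x. ennreal (C ^ CARD('n)) * indicator (cball (0::real^'n) B) x \<partial>lborel)"
    by (intro nn_integral_mono) (auto simp: indicator_def B intro!: ennreal_leI le)
  also have "\<dots> < \<top>"
    using emeasure_lborel_cball_finite[of "0::real^'n" B] by (simp add: nn_integral_cmult_indicator ennreal_mult_less_top)
  finally have fin: "?I < \<top>" .
  \<comment> \<open>If the integral vanished, the open set where the bump is nonzero would be
    negligible, hence empty; but it contains 0.\<close>
  have pos: "?I \<noteq> 0"
  proof
    assume "?I = 0"
    then have ae: "AE x in lborel. ennreal (?f x) = 0" by (subst (asm) nn_integral_0_iff_AE) auto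
    have op: "open {x. ?f x \<noteq> 0}" 
      using continuous_tbump[of 1 s 0] by (intro open_Collect_neq) auto
    have "{x. ?f x \<noteq> 0} \<in> null_sets lborel"
    proof (rule AE_iff_null_sets[THEN iffD2])
      show "{x. ?f x \<noteq> 0} \<in> sets lborel" using op by simp
      show "AE x in lborel. x \<notin> {x. ?f x \<noteq> 0}" using ae
        by eventually_elim (auto simp: ennreal_eq_0_iff intro!: order.antisym tbump_nonneg)
    qed
    then have "negligible {x. ?f x \<noteq> 0}" by (simp add: negligible_iff_null_sets null_sets_completionI)
    then have "{x. ?f x \<noteq> 0} = {}" using op open_not_negligible by blast
    moreover have "?f 0 \<noteq> 0" by (simp add: tbump_def bump_0_eq)
    ultimately show False by blast
  qed
  define c where "c = 1 / enn2real ?I"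
  have I: "?I = ennreal (enn2real ?I)" "enn2real ?I > 0"
    using fin pos by (auto simp: enn2real_positive_iff zero_less_iff_neq_zero)
  have c: "c > 0" using I by (simp add: c_def)
  have "(\<integral>\<^sup>+x. ennreal (tbump c s (0::real^'n) x) \<partial>lborel) = (\<integral>\<^sup>+x. ennreal c * ennreal (?f x) \<partial>lborel)"
    using c by (intro nn_integral_cong) (simp add: tbump_def ennreal_mult' )
  also have "\<dots> = ennreal c * ennreal (enn2real ?I)"
    unfolding I(1)[symmetric] by (rule nn_integral_cmult) measurable
  also have "\<dots> = 1" using I(2) c by (simp add: ennreal_mult[symmetric] c_def)
  finally show ?thesis using c s assms by (intro exI[of _ c] exI[of _ s]) (auto simp: s_def)
qed

text \<open>At distance beyond \<epsilon> some coordinate of \<open>x - X\<close> exceeds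
  \<open>\<epsilon> / CARD('n) >= 1 / s\<close>, and there every derivative of the bump is
  0.\<close>

lemma iter_pdiff_tbump_eq_0:
  fixes x :: "real^'n::finite"
  assumes "norm (x - X) > \<epsilon>" "real CARD('n) \<le> s * \<epsilon>" "s > 0"
  shows "iter_pdiff is (tbump c (- s) (s *\<^sub>R x)) X = 0"
proof -
  have "\<exists>i. \<bar>(x - X) $ i\<bar> > \<epsilon> / CARD('n)"
  proof (rule ccontr)
    assume "\<not> ?thesis"
    then have "(\<Sum>i\<in>UNIV. \<bar>(x - X) $ i\<bar>) \<le> (\<Sum>i\<in>(UNIV::'n set). \<epsilon> / CARD('n))"
      by (intro sum_mono) (auto simp: not_less)
    then show False using norm_le_l1_cart[of "x - X"] assms(1) by simp
  qed
  then obtain i where i: "\<bar>(x - X) $ i\<bar> > \<epsilon> / CARD('n)" by blast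
  have "1 \<le> s * (\<epsilon> / CARD('n))" using assms by (simp add: field_simps)
  also have "\<dots> \<le> s * \<bar>(x - X) $ i\<bar>" using i assms(3) by (intro mult_left_mono) auto
  also have "\<dots> = \<bar>(s *\<^sub>R x) $ i + - s * X $ i\<bar>"
    using abs_mult[of s "(x - X) $ i"] assms(3) by (simp add: algebra_simps)
  finally have "bump (count_list is i) ((s *\<^sub>R x) $ i + - s * X $ i) = 0" by (rule bump_support)
  then show ?thesis unfolding iter_pdiff_tbump by (auto intro: prod_zero)
qed

text \<open>Uniformity in \<open>a\<close> matters: it will be \<open>s *\<^sub>R x\<close> with
  \<open>x\<close> ranging over the whole space.\<close>

lemma iter_pdiff_tbump_uniform_bound:
  "\<exists>D\<ge>0. \<forall>is a (x::real^'n::finite). length is \<le> 3 \<longrightarrow> \<bar>iter_pdiff is (tbump c s a) x\<bar> \<le> D"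
proof -
  obtain C where C: "C \<ge> 1" "\<And>n t. n \<le> 3 \<Longrightarrow> \<bar>bump n t\<bar> \<le> C" using bump_bounded[of 3] by blast
  let ?D = "\<bar>c\<bar> * (max 1 \<bar>s\<bar>) ^ 3 * C ^ CARD('n)"
  have "\<bar>iter_pdiff is (tbump c s a) x\<bar> \<le> ?D" if "length is \<le> 3" for "is" a and x :: "real^'n"
  proof -
    have "\<bar>s\<bar> ^ length is \<le> (max 1 \<bar>s\<bar>) ^ length is" by (intro power_mono) auto
    also have "\<dots> \<le> (max 1 \<bar>s\<bar>) ^ 3" using that by (intro power_increasing) auto
    finally have "\<bar>c\<bar> * \<bar>s\<bar> ^ length is * C ^ CARD('n) \<le> ?D"
      using C by (intro mult_right_mono mult_left_mono) auto
    then show ?thesis using iter_pdiff_tbump_bound[OF C(2) that, where c=c and s=s and a=a and x=x] by linarith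
  qed
  moreover have "?D \<ge> 0" using C(1) by simp
  ultimately show ?thesis by blast
qed

section \<open>Truncated steps and their effect on mollified densities\<close>

abbreviation coef_size :: "(real^'n::finite \<Rightarrow> real^'m::finite^'n) \<Rightarrow> (real^'n \<Rightarrow> real^'n) \<Rightarrow> real^'n \<Rightarrow> real" where
  "coef_size Sig b x \<equiv> norm (b x) + (norm (Sig x))\<^sup>2"

abbreviation moment_size :: "(real^'n::finite \<Rightarrow> real^'m::finite^'n) \<Rightarrow> (real^'n \<Rightarrow> real^'n) \<Rightarrow> real^'n \<Rightarrow> real" where
  "moment_size Sig b x \<equiv> (norm (Sig x))\<^sup>2 + norm (b x) * norm x"

text \<open>Points with large coefficients stay put. All steps are then of size
  \<open>sqrt h\<close> with a constant depending on \<open>R\<close>, and the price is an integral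
  of \<open>coef_size\<close> over its tail.\<close>

definition trunc_step :: "(real^'n::finite \<Rightarrow> real^'m::finite^'n) \<Rightarrow> (real^'n \<Rightarrow> real^'n) \<Rightarrow> real \<Rightarrow> real \<Rightarrow> 'm \<times> bool \<Rightarrow> real^'n \<Rightarrow> real^'n" where
  "trunc_step Sig b R h l x = (if coef_size Sig b x \<le> R then em_step h (b x) (Sig x) l else 0)"

lemma trunc_step_measurable:
  fixes Sig :: "real^'n::finite \<Rightarrow> real^'m::finite^'n"
  assumes [measurable]: "Sig \<in> borel_measurable borel" "b \<in> borel_measurable borel"
  shows "trunc_step Sig b R h l \<in> borel_measurable borel"
proof -
  have c: "(\<lambda>x. column (fst l) (Sig x)) = (\<lambda>S. \<chi> i. S $ i $ fst l) \<circ> Sig" by (auto simp: column_def)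
  have "continuous_on UNIV (\<lambda>S :: real^'m^'n. \<chi> i. S $ i $ fst l)" by (intro continuous_intros)
  then have [measurable]: "(\<lambda>x. column (fst l) (Sig x)) \<in> borel_measurable borel"
    unfolding c by (intro measurable_comp[OF assms(1)] borel_measurable_continuous_onI)
  show ?thesis unfolding trunc_step_def em_step_def by measurable
qed

text \<open>Outside the unit ball \<open>|b| <= |b| |x|\<close>; inside it the local integrability
  contained in \<open>prob_solution\<close> is used.\<close>

lemma coef_size_integrable:
  fixes Sig :: "real^'n::finite \<Rightarrow> real^'m::finite^'n"
  assumes [measurable]: "Sig \<in> borel_measurable borel" "b \<in> borel_measurable borel"
    and sol: "prob_solution Sig b M"
    and fin: "(\<integral>\<^sup>+x. ennreal (moment_size Sig b x) \<partial>M) < \<infinity>"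
  shows "integrable M (coef_size Sig b)"
proof -
  have sM[measurable_cong]: "sets M = sets borel" using sol by (simp add: prob_solution_def)
  have 1: "integrable M (moment_size Sig b)"
    by (rule integrableI_nonneg) (use fin in auto)
  have 2: "integrable M (\<lambda>x. indicator (cball 0 1) x *\<^sub>R b x $ i)" for i
    using sol by (simp add: prob_solution_def set_integrable_def)
  have 3: "integrable M (\<lambda>x. (moment_size Sig b x) + (\<Sum>i\<in>UNIV. \<bar>indicator (cball 0 1) x *\<^sub>R b x $ i\<bar>))"
    by (intro Bochner_Integration.integrable_add Bochner_Integration.integrable_sum integrable_abs 1 2)
  show ?thesis
  proof (rule Bochner_Integration.integrable_bound[OF 3])
    show "AE x in M. norm (coef_size Sig b x) \<le> norm ((moment_size Sig b x) + (\<Sum>i\<in>UNIV. \<bar>indicator (cball 0 1) x *\<^sub>R b x $ i\<bar>))"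
    proof (rule AE_I2)
      fix x
      have s: "(\<Sum>i\<in>UNIV. \<bar>indicator (cball 0 1) x *\<^sub>R b x $ i\<bar>) \<ge> 0" by (simp add: sum_nonneg)
      have "norm (b x) \<le> norm (b x) * norm x + (\<Sum>i\<in>UNIV. \<bar>indicator (cball 0 1) x *\<^sub>R b x $ i\<bar>)"
      proof (cases "norm x \<le> 1")
        case True
        then have "norm (b x) \<le> (\<Sum>i\<in>UNIV. \<bar>indicator (cball 0 1) x *\<^sub>R b x $ i\<bar>)"
          using norm_le_l1_cart[of "b x"] by simp
        then show ?thesis by (simp add: add_increasing)
      next
        case False
        then have "norm (b x) * 1 \<le> norm (b x) * norm x" by (intro mult_left_mono) auto
        then show ?thesis using s by linarith
      qed
      then show "norm (coef_size Sig b x) \<le> norm ((moment_size Sig b x) + (\<Sum>i\<in>UNIV. \<bar>indicator (cball 0 1) x *\<^sub>R b x $ i\<bar>))"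
        by simp
    qed
  qed measurable
qed

text \<open>If the coefficients at \<open>X\<close> are at most \<open>R\<close>, the Taylor
  estimate applies, and both sides vanish beyond the reach of a step. Otherwise \<open>X\<close>
  does not move, and the term \<open>h * diff_op\<close> has to be compensated by its own bound. The
  indicators make the errors integrable in \<open>x\<close>. An upper bound is enough, because
  thinning pays only for the excess of the new density.\<close>

lemma tbump_step_defect:
  fixes Sig :: "real^'n::finite \<Rightarrow> real^'m::finite^'n"
  assumes D: "\<And>is a (x::real^'n). length is \<le> 3 \<Longrightarrow> \<bar>iter_pdiff is (tbump c (- s) a) x\<bar> \<le> D"
    and s: "s > 0" "real CARD('n) \<le> s * \<epsilon>" and \<epsilon>: "\<epsilon> > 0"
    and h: "0 \<le> h" "h \<le> 1" and R: "R \<ge> 1"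
  shows "(\<Sum>l\<in>UNIV. tbump c s 0 (x - trunc_step Sig b R h l X - X)) / (2 * real CARD('m)) \<le>
    tbump c s 0 (x - X) + h * diff_op Sig b (tbump c (- s) (s *\<^sub>R x)) X
    + h * (D * (real CARD('n))\<^sup>2 * (coef_size Sig b X * indicator {X. coef_size Sig b X > R} X)) * indicator (cball 0 \<epsilon>) (x - X)
    + D * ((real CARD('n) * R * (1 + sqrt (2 * CARD('m)))) ^ 3 + (real CARD('n) * R)\<^sup>2) * (h * sqrt h)
      * indicator (cball 0 (\<epsilon> + R * (1 + sqrt (2 * CARD('m))))) (x - X)"
proof -
  let ?f = "tbump c (- s) (s *\<^sub>R x)" and ?r = "R * (1 + sqrt (2 * CARD('m)))"
  let ?K = "D * ((real CARD('n) * R * (1 + sqrt (2 * CARD('m)))) ^ 3 + (real CARD('n) * R)\<^sup>2) * (h * sqrt h)"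
  have D0: "D \<ge> 0" using D[of "[]" undefined undefined] by simp
  have f: "tbump c s 0 (x - Y) = ?f Y" for Y by (rule tbump_reflect)
  have f': "tbump c s 0 (x - v - X) = ?f (X + v)" for v
    using f[of "X + v"] by (simp add: algebra_simps)
  have b1: "\<bar>pdiff i ?f y\<bar> \<le> D" for i y using D[of "[i]"] by simp
  have b2: "\<bar>pdiff i (pdiff j ?f) y\<bar> \<le> D" for i j y using D[of "[i, j]"] by simp
  have b3: "\<bar>pdiff i (pdiff j (pdiff l ?f)) y\<bar> \<le> D" for i j l y using D[of "[i, j, l]"] by simp
  have far: "?f y = 0" "pdiff i ?f y = 0" "pdiff i (pdiff j ?f) y = 0" if "norm (x - y) > \<epsilon>" for y i j
    using iter_pdiff_tbump_eq_0[OF that s(2,1), of "[]"] iter_pdiff_tbump_eq_0[OF that s(2,1), of "[i]"]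
      iter_pdiff_tbump_eq_0[OF that s(2,1), of "[i, j]"] by auto
  have gfar: "gen S v ?f X = 0" if "norm (x - X) > \<epsilon>" for S :: "real^'m^'n" and v
    unfolding gen_def using far[OF that] by simp
  have n0: "real CARD('n) > 0" "real CARD('m) > 0" by auto
  have K0: "?K \<ge> 0" using D0 h R by (intro mult_nonneg_nonneg add_nonneg_nonneg) auto
  show ?thesis
  proof (cases "coef_size Sig b X \<le> R")
    case True
    have nb: "norm (b X) \<le> R" using True zero_le_power2[of "norm (Sig X)"] by linarith
    have "(norm (Sig X))\<^sup>2 \<le> R" using True norm_ge_zero[of "b X"] by linarith
    \<comment> \<open>\<open>R >= 1\<close> turns the bound on the squared norm of
      \<open>Sig X\<close> into one on the norm itself.\<close>
    also have "R \<le> R\<^sup>2" using R by (simp add: power2_eq_square)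
    finally have nS: "norm (Sig X) \<le> R" using R by (simp add: power2_le_iff_abs_le)
    have L: "diff_op Sig b ?f X = gen (Sig X) (b X) ?f X" by (rule diff_op_eq_gen)
    have sum: "(\<Sum>l\<in>UNIV. tbump c s 0 (x - trunc_step Sig b R h l X - X)) = (\<Sum>l\<in>UNIV. ?f (X + em_step h (b X) (Sig X) l))"
      using True by (simp add: trunc_step_def f')
    show ?thesis
    proof (cases "norm (x - X) \<le> \<epsilon> + ?r")
      case near: True
      have "\<bar>(\<Sum>l\<in>UNIV. ?f (X + em_step h (b X) (Sig X) l)) / (2 * real CARD('m)) - (?f X + h * gen (Sig X) (b X) ?f X)\<bar> \<le> ?K"
        by (rule em_step_average[OF iter_pdiff_tbump_differentiable b2 b3 h nb nS])
      then show ?thesis unfolding sum L f using near True by (simp add: indicator_def)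
    next
      case False
      have "?f (X + em_step h (b X) (Sig X) l) = 0" for l
      proof -
        have "norm (em_step h (b X) (Sig X) l) \<le> ?r * sqrt h" by (rule norm_em_step_le[OF h nb nS])
        also have "\<dots> \<le> ?r * 1" using h R by (intro mult_left_mono) auto
        finally have "norm (em_step h (b X) (Sig X) l) \<le> ?r" by simp
        moreover have "norm (x - X) \<le> norm (x - (X + em_step h (b X) (Sig X) l)) + norm (em_step h (b X) (Sig X) l)"
          using norm_triangle_ineq[of "x - (X + em_step h (b X) (Sig X) l)" "em_step h (b X) (Sig X) l"] by (simp add: algebra_simps)
        ultimately have "norm (x - (X + em_step h (b X) (Sig X) l)) > \<epsilon>" using False by linarith
        then show ?thesis by (rule far)
      qed
      moreover have "norm (x - X) > \<epsilon>"
      proof -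
        have "?r \<ge> 0" using R by simp
        then show ?thesis using False by linarith
      qed
      then have "?f X = 0" "gen (Sig X) (b X) ?f X = 0" using far gfar by auto
      ultimately show ?thesis unfolding sum L f using False True by (simp add: indicator_def)
    qed
  next
    case False
    have L: "diff_op Sig b ?f X = gen (Sig X) (b X) ?f X" by (rule diff_op_eq_gen)
    have sum: "(\<Sum>l\<in>(UNIV::('m\<times>bool) set). tbump c s 0 (x - trunc_step Sig b R h l X - X)) / (2 * real CARD('m)) = ?f X"
      using False f[of X] by (simp add: trunc_step_def)
    have g: "\<bar>gen (Sig X) (b X) ?f X\<bar> \<le> D * (real CARD('n))\<^sup>2 * coef_size Sig b X"
      using abs_gen_le[OF b1 b2, of "Sig X" "b X" X] by (simp add: algebra_simps)
    have k: "0 \<le> ?K * indicator (cball 0 (\<epsilon> + ?r)) (x - X)" using K0 by (simp add: indicator_def)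
    show ?thesis
    proof (cases "norm (x - X) \<le> \<epsilon>")
      case True
      have "0 \<le> h * (gen (Sig X) (b X) ?f X + D * (real CARD('n))\<^sup>2 * coef_size Sig b X)"
        using g h by (intro mult_nonneg_nonneg) (auto simp: abs_le_iff)
      then show ?thesis unfolding sum L f using True False k by (simp add: indicator_def algebra_simps)
    next
      case far': False
      then show ?thesis unfolding sum L f using gfar k False by (simp add: indicator_def)
    qed
  qed
qed

lemma diff_op_tbump_measurable:
  fixes Sig :: "real^'n::finite \<Rightarrow> real^'m::finite^'n"
  assumes [measurable]: "Sig \<in> borel_measurable borel" "b \<in> borel_measurable borel"
  shows "diff_op Sig b (tbump c s a) \<in> borel_measurable borel"
proof -
  have "iter_pdiff is (tbump c s a) \<in> borel_measurable borel" for "is"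
    by (intro borel_measurable_continuous_onI continuous_at_imp_continuous_on ballI
        differentiable_imp_continuous_within iter_pdiff_tbump_differentiable)
  from this[of "[_]"] this[of "[_, _]"]
  have m1: "pdiff i (tbump c s a) \<in> borel_measurable borel"
    and m2: "pdiff i (pdiff j (tbump c s a)) \<in> borel_measurable borel" for i j
    by auto
  have m3: "(\<lambda>x. Sig x $ i $ j) \<in> borel_measurable borel" for i j
    by (rule measurable_compose[OF assms(1)]) (intro borel_measurable_continuous_onI continuous_intros)
  have m4: "(\<lambda>x. b x $ i) \<in> borel_measurable borel" for i
    by (rule measurable_compose[OF assms(2)]) (intro borel_measurable_continuous_onI continuous_intros)
  show ?thesis
    unfolding diff_op_def matrix_matrix_mult_def transpose_def vec_lambda_beta
    by (intro borel_measurable_add borel_measurable_sum borel_measurable_times m1 m2 m3 m4)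
qed

lemma cball_indicator_measurable [measurable]:
  fixes f :: "'b \<Rightarrow> 'a::real_normed_vector"
  assumes "f \<in> borel_measurable M"
  shows "(\<lambda>x. indicator (cball 0 e) (f x) :: real) \<in> borel_measurable M"
    and "(\<lambda>x. indicator (cball 0 e) (f x) :: ennreal) \<in> borel_measurable M"
  by (rule measurable_compose[OF assms], rule borel_measurable_indicator, simp)+

text \<open>Integrability, needed to integrate the defect term by term, follows from that of
  \<open>coef_size\<close>, since the derivatives of the bump are bounded.\<close>

lemma integral_diff_op_tbump:
  fixes Sig :: "real^'n::finite \<Rightarrow> real^'m::finite^'n"
  assumes [measurable]: "Sig \<in> borel_measurable borel" "b \<in> borel_measurable borel"
    and sol: "prob_solution Sig b M" and int: "integrable M (coef_size Sig b)" and s: "s \<noteq> 0"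
  shows "integrable M (diff_op Sig b (tbump c s a))" "(\<integral>x. diff_op Sig b (tbump c s a) x \<partial>M) = 0"
proof -
  have sM[measurable_cong]: "sets M = sets borel" using sol by (simp add: prob_solution_def)
  obtain D where D: "D \<ge> 0" "\<And>is a x. length is \<le> 3 \<Longrightarrow> \<bar>iter_pdiff is (tbump c s (a::real^'n)) x\<bar> \<le> D"
    using iter_pdiff_tbump_uniform_bound[of c s, where 'n='n] by blast
  note diff_op_tbump_measurable[measurable]
  show "integrable M (diff_op Sig b (tbump c s a))"
  proof (rule Bochner_Integration.integrable_bound)
    show "integrable M (\<lambda>x. D * (real CARD('n))\<^sup>2 * coef_size Sig b x)" using int by simp
    show "AE x in M. norm (diff_op Sig b (tbump c s a) x) \<le> norm (D * (real CARD('n))\<^sup>2 * coef_size Sig b x)"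
    proof (rule AE_I2)
      fix x
      have "\<bar>diff_op Sig b (tbump c s a) x\<bar> \<le> D * (real CARD('n))\<^sup>2 * coef_size Sig b x"
        using abs_gen_le[of "tbump c s a" x D D "Sig x" "b x"] D(2)[of "[_]" a x] D(2)[of "[_, _]" a x]
        by (simp add: diff_op_eq_gen algebra_simps)
      then show "norm (diff_op Sig b (tbump c s a) x) \<le> norm (D * (real CARD('n))\<^sup>2 * coef_size Sig b x)"
        by simp
    qed
  qed measurable
  show "(\<integral>x. diff_op Sig b (tbump c s a) x \<partial>M) = 0"
    using sol tbump_C0_inf[OF s, of c a] unfolding prob_solution_def by blast
qed

text \<open>Here stationarity enters the dissipative case: as a function of \<open>X\<close>, the
  bump at \<open>x - X\<close> is a test function, so integrating the pointwise defect over
  \<open>M\<close> removes the term of order \<open>h\<close>. Integration in \<open>x\<close> turns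
  the indicators into ball volumes. The first error is \<open>h\<close> times a tail, small for
  large \<open>R\<close>; the second has order \<open>h^(3/2)\<close> once \<open>R\<close> is
  fixed.\<close>

lemma mollify_defect:
  fixes Sig :: "real^'n::finite \<Rightarrow> real^'m::finite^'n"
  assumes meas[measurable]: "Sig \<in> borel_measurable borel" "b \<in> borel_measurable borel"
    and sol: "prob_solution Sig b M" and int: "integrable M (coef_size Sig b)"
    and D: "\<And>is a (x::real^'n). length is \<le> 3 \<Longrightarrow> \<bar>iter_pdiff is (tbump c (- s) a) x\<bar> \<le> D"
    and c: "c \<ge> 0" and s: "s > 0" "real CARD('n) \<le> s * \<epsilon>" and \<epsilon>: "\<epsilon> > 0"
    and h: "0 \<le> h" "h \<le> 1" and R: "R \<ge> 1"
  defines "\<rho> \<equiv> \<lambda>x. ennreal (tbump c s (0::real^'n) x)"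
    and "K \<equiv> D * ((real CARD('n) * R * (1 + sqrt (2 * CARD('m)))) ^ 3 + (real CARD('n) * R)\<^sup>2)"
  shows "(\<integral>\<^sup>+x. shifted_average \<rho> (trunc_step Sig b R h) M x - mollify \<rho> M x \<partial>lborel) \<le>
    ennreal (h * (D * (real CARD('n))\<^sup>2)) * (\<integral>\<^sup>+X. ennreal (coef_size Sig b X * indicator {X. coef_size Sig b X > R} X) \<partial>M)
      * emeasure lborel (cball (0::real^'n) \<epsilon>)
    + ennreal (K * (h * sqrt h)) * emeasure lborel (cball (0::real^'n) (\<epsilon> + R * (1 + sqrt (2 * CARD('m)))))"
proof -
  have sM[measurable_cong]: "sets M = sets borel" and "prob_space M" using sol by (auto simp: prob_solution_def)
  interpret prob_space M by fact
  interpret Ml': pair_sigma_finite M "lborel :: (real^'n) measure" ..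
  note diff_op_tbump_measurable[measurable] trunc_step_measurable[measurable]
  let ?r = "\<epsilon> + R * (1 + sqrt (2 * CARD('m)))"
  define t where "t X = coef_size Sig b X * indicator {X. coef_size Sig b X > R} X" for X
  have tm[measurable]: "t \<in> borel_measurable borel" unfolding t_def by measurable
  have t0: "t X \<ge> 0" for X by (simp add: t_def)
  have tint: "integrable M t"
    by (rule Bochner_Integration.integrable_bound[OF int]) (auto simp: t_def indicator_def)
  have D0: "D \<ge> 0" using D[of "[]" undefined undefined] by simp
  have K0: "K \<ge> 0" using D0 R unfolding K_def by (intro mult_nonneg_nonneg add_nonneg_nonneg) auto
  define K1 where "K1 = h * (D * (real CARD('n))\<^sup>2)"
  define K2 where "K2 = K * (h * sqrt h)"
  have K12: "K1 \<ge> 0" "K2 \<ge> 0" using D0 K0 h by (auto simp: K1_def K2_def)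
  have bd: "\<bar>tbump c s 0 y\<bar> \<le> D" for y :: "real^'n"
    using D[of "[]" "s *\<^sub>R y" 0] tbump_reflect[of c s y 0] by simp
  have pt: "shifted_average \<rho> (trunc_step Sig b R h) M x - mollify \<rho> M x \<le>
     (\<integral>\<^sup>+X. ennreal (K1 * t X) * indicator (cball 0 \<epsilon>) (x - X) + ennreal K2 * indicator (cball 0 ?r) (x - X) \<partial>M)" for x
  proof -
    let ?E = "\<lambda>X. (\<Sum>l\<in>UNIV. tbump c s 0 (x - trunc_step Sig b R h l X - X)) / (2 * real CARD('m))"
    let ?L = "diff_op Sig b (tbump c (- s) (s *\<^sub>R x))"
    let ?rest = "\<lambda>X. K1 * t X * indicator (cball 0 \<epsilon>) (x - X) + K2 * indicator (cball 0 ?r) (x - X)"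
    have le: "?E X \<le> tbump c s 0 (x - X) + h * ?L X + ?rest X" for X
      using tbump_step_defect[OF D s \<epsilon> h R, of x Sig b X] unfolding K1_def K2_def K_def t_def
      by (simp add: mult.assoc add.assoc)
    have fint: "integrable M (\<lambda>X. tbump c s 0 (x - X))"
      by (rule integrable_const_bound[where B=D]) (use bd in auto)
    have Eint: "integrable M ?E"
      by (intro Bochner_Integration.integrable_sum integrable_divide integrable_const_bound[where B=D]) (use bd in auto)
    have Lint: "integrable M ?L" "(\<integral>X. ?L X \<partial>M) = 0"
      using integral_diff_op_tbump[OF meas sol int, of "- s" c "s *\<^sub>R x"] s by auto
    have rint: "integrable M ?rest"
    proof (rule Bochner_Integration.integrable_bound)
      show "integrable M (\<lambda>X. K1 * t X + K2)" using tint by simp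
      show "AE X in M. norm (?rest X) \<le> norm (K1 * t X + K2)"
        using K12 t0 by (intro AE_I2) (auto simp: indicator_def)
    qed measurable
    have r0: "?rest X \<ge> 0" for X using K12 t0 by (simp add: indicator_def)
    have "(\<integral>X. ?E X \<partial>M) \<le> (\<integral>X. tbump c s 0 (x - X) + h * ?L X + ?rest X \<partial>M)"
      by (intro integral_mono Eint le Bochner_Integration.integrable_add fint integrable_mult_right Lint rint)
    also have "\<dots> = (\<integral>X. tbump c s 0 (x - X) \<partial>M) + h * (\<integral>X. ?L X \<partial>M) + (\<integral>X. ?rest X \<partial>M)"
      using fint Lint(1) rint
      by (simp only: Bochner_Integration.integral_add Bochner_Integration.integrable_add integrable_mult_right integral_mult_right_zero)
    finally have le': "(\<integral>X. ?E X \<partial>M) \<le> (\<integral>X. tbump c s 0 (x - X) \<partial>M) + (\<integral>X. ?rest X \<partial>M)"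
      using Lint(2) by simp
    have sa: "shifted_average \<rho> (trunc_step Sig b R h) M x = ennreal (\<integral>X. ?E X \<partial>M)"
    proof -
      have "shifted_average \<rho> (trunc_step Sig b R h) M x =
        (\<integral>\<^sup>+X. (\<Sum>l\<in>UNIV. \<rho> (x - trunc_step Sig b R h l X - X)) \<partial>M) / of_nat CARD('m \<times> bool)"
        unfolding shifted_average_def \<rho>_def by (subst nn_integral_sum) auto
      also have "\<dots> = (\<integral>\<^sup>+X. (\<Sum>l\<in>UNIV. \<rho> (x - trunc_step Sig b R h l X - X)) / of_nat CARD('m \<times> bool) \<partial>M)"
        unfolding \<rho>_def by (rule nn_integral_divide[symmetric]) measurable
      also have "\<dots> = (\<integral>\<^sup>+X. ennreal (?E X) \<partial>M)"
      proof (rule nn_integral_cong)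
        fix X
        have "of_nat CARD('m \<times> bool) = ennreal (2 * real CARD('m))"
          by (simp add: ennreal_of_nat_eq_real_of_nat)
        then show "(\<Sum>l\<in>UNIV. \<rho> (x - trunc_step Sig b R h l X - X)) / of_nat CARD('m \<times> bool) = ennreal (?E X)"
          unfolding \<rho>_def using c by (simp add: sum_ennreal tbump_nonneg sum_nonneg divide_ennreal)
      qed
      also have "\<dots> = ennreal (\<integral>X. ?E X \<partial>M)"
        using c by (intro nn_integral_eq_integral Eint AE_I2) (auto intro!: divide_nonneg_nonneg sum_nonneg tbump_nonneg)
      finally show ?thesis .
    qed
    have mo: "mollify \<rho> M x = ennreal (\<integral>X. tbump c s 0 (x - X) \<partial>M)"
      unfolding mollify_def \<rho>_def using c by (intro nn_integral_eq_integral fint AE_I2) (auto intro!: tbump_nonneg)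
    have re: "(\<integral>\<^sup>+X. ennreal (K1 * t X) * indicator (cball 0 \<epsilon>) (x - X) + ennreal K2 * indicator (cball 0 ?r) (x - X) \<partial>M) = ennreal (\<integral>X. ?rest X \<partial>M)"
    proof -
      have "(\<integral>\<^sup>+X. ennreal (K1 * t X) * indicator (cball 0 \<epsilon>) (x - X) + ennreal K2 * indicator (cball 0 ?r) (x - X) \<partial>M) = (\<integral>\<^sup>+X. ennreal (?rest X) \<partial>M)"
        using K12 t0 by (intro nn_integral_cong) (auto simp: indicator_def)
      also have "\<dots> = ennreal (\<integral>X. ?rest X \<partial>M)"
        by (intro nn_integral_eq_integral rint AE_I2 r0)
      finally show ?thesis .
    qed
    have i0: "0 \<le> (\<integral>X. tbump c s 0 (x - X) \<partial>M)"
      using c by (intro integral_nonneg_AE AE_I2 tbump_nonneg)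
    show ?thesis unfolding sa mo re using le' i0 by (subst ennreal_minus) (auto intro!: ennreal_leI)
  qed
  have ball: "(\<integral>\<^sup>+x. indicator (cball 0 e) (x - X) \<partial>lborel) = emeasure lborel (cball (0::real^'n) e)" for e and X :: "real^'n"
    using nn_integral_lborel_shift[of "indicator (cball (0::real^'n) e)" X] by simp
  have "(\<integral>\<^sup>+x. shifted_average \<rho> (trunc_step Sig b R h) M x - mollify \<rho> M x \<partial>lborel) \<le>
    (\<integral>\<^sup>+x. \<integral>\<^sup>+X. ennreal (K1 * t X) * indicator (cball 0 \<epsilon>) (x - X) + ennreal K2 * indicator (cball 0 ?r) (x - X) \<partial>M \<partial>lborel)"
    by (intro nn_integral_mono pt)
  also have "\<dots> = (\<integral>\<^sup>+X. \<integral>\<^sup>+x. ennreal (K1 * t X) * indicator (cball 0 \<epsilon>) (x - X) + ennreal K2 * indicator (cball 0 ?r) (x - X) \<partial>lborel \<partial>M)"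
    by (rule Ml'.Fubini') measurable
  also have "\<dots> = (\<integral>\<^sup>+X. ennreal (K1 * t X) * emeasure lborel (cball (0::real^'n) \<epsilon>) + ennreal K2 * emeasure lborel (cball (0::real^'n) ?r) \<partial>M)"
    by (intro nn_integral_cong) (simp add: nn_integral_add nn_integral_cmult ball)
  also have "\<dots> = (\<integral>\<^sup>+X. ennreal (K1 * t X) \<partial>M) * emeasure lborel (cball (0::real^'n) \<epsilon>) + ennreal K2 * emeasure lborel (cball (0::real^'n) ?r)"
    by (simp add: nn_integral_add nn_integral_multc emeasure_space_1)
  also have "(\<integral>\<^sup>+X. ennreal (K1 * t X) \<partial>M) = ennreal K1 * (\<integral>\<^sup>+X. ennreal (t X) \<partial>M)"
    using K12 t0 by (simp add: ennreal_mult nn_integral_cmult)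
  finally show ?thesis unfolding K1_def K2_def t_def .
qed

section \<open>The dissipative case\<close>

abbreviation gauss :: "'a::real_inner \<Rightarrow> real" where
  "gauss z \<equiv> exp (- (norm z)\<^sup>2 / 2)"

lemma norm_times_gauss_le: "norm z * gauss z \<le> 1"
proof -
  have "0 \<le> (norm z - 1)\<^sup>2" by simp
  then have "norm z \<le> 1 + (norm z)\<^sup>2 / 2" by (simp add: power2_diff)
  also have "\<dots> \<le> exp ((norm z)\<^sup>2 / 2)" by (rule exp_ge_add_one_self)
  finally show ?thesis by (simp add: exp_minus field_simps)
qed

text \<open>Because \<open>e\<^sup>t \<ge> 1 + t\<close>, the second-order expansion of the Gaussian along a step is a lower bound.\<close>

lemma gauss_step_ge:
  "gauss (z + u) \<ge> gauss z * (1 - inner z u - (norm u)\<^sup>2 / 2)"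
proof -
  have "(norm (z + u))\<^sup>2 = (norm z)\<^sup>2 + 2 * inner z u + (norm u)\<^sup>2"
    by (simp add: power2_norm_eq_inner inner_add_left inner_add_right inner_commute)
  then have "gauss (z + u) = gauss z * exp (- inner z u - (norm u)\<^sup>2 / 2)"
    by (simp add: exp_add[symmetric] field_simps)
  moreover have "1 - inner z u - (norm u)\<^sup>2 / 2 \<le> exp (- inner z u - (norm u)\<^sup>2 / 2)"
    using exp_ge_add_one_self[of "- inner z u - (norm u)\<^sup>2 / 2"] by linarith
  ultimately show ?thesis by simp
qed

text \<open>The two signs of the noise cancel in the inner product, and summing over the columns
  gives the squared norm of \<open>S\<close>. Bounding the exponential from below drops the
  nonnegative part of the Hessian, so no third-order remainder appears. For differences of
  coefficients, \<open>inner z v + (norm S)^2\<close> has the form of \<open>q\<close>.\<close>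

lemma gauss_average_ge:
  fixes S :: "real^'m::finite^'n::finite"
  assumes "h \<ge> 0"
  shows "(\<Sum>l\<in>UNIV. gauss (z + em_step h v S l)) / (2 * real CARD('m)) \<ge>
    gauss z * (1 - h * (inner z v + (norm S)\<^sup>2) - h\<^sup>2 * (norm v)\<^sup>2 / 2)"
proof -
  let ?\<kappa> = "sqrt (2 * h * CARD('m))" and ?m = "real CARD('m)"
  have pair: "gauss z * (2 - 2 * h * inner z v - h\<^sup>2 * (norm v)\<^sup>2 - 2 * h * ?m * (norm (column j S))\<^sup>2) \<le>
    gauss (z + (h *\<^sub>R v + ?\<kappa> *\<^sub>R column j S)) + gauss (z + (h *\<^sub>R v - ?\<kappa> *\<^sub>R column j S))" for j
  proof -
    let ?a = "h *\<^sub>R v" and ?c = "?\<kappa> *\<^sub>R column j S"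
    have n: "(norm (a + c))\<^sup>2 + (norm (a - c))\<^sup>2 = 2 * (norm a)\<^sup>2 + 2 * (norm c)\<^sup>2" for a c :: "real^'n"
      by (simp add: power2_norm_eq_inner inner_add_left inner_add_right inner_diff_left inner_diff_right)
    have a: "(norm ?a)\<^sup>2 = h\<^sup>2 * (norm v)\<^sup>2" by (simp add: power_mult_distrib)
    have c: "(norm ?c)\<^sup>2 = 2 * h * ?m * (norm (column j S))\<^sup>2" using assms by (simp add: power_mult_distrib)
    have i: "inner z (?a + ?c) + inner z (?a - ?c) = 2 * h * inner z v"
      by (simp add: inner_add_right inner_diff_right)
    have "2 - 2 * h * inner z v - h\<^sup>2 * (norm v)\<^sup>2 - 2 * h * ?m * (norm (column j S))\<^sup>2 =
      (1 - inner z (?a + ?c) - (norm (?a + ?c))\<^sup>2 / 2) + (1 - inner z (?a - ?c) - (norm (?a - ?c))\<^sup>2 / 2)"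
      using n[of ?a ?c] i unfolding a c by linarith
    then have "gauss z * (2 - 2 * h * inner z v - h\<^sup>2 * (norm v)\<^sup>2 - 2 * h * ?m * (norm (column j S))\<^sup>2) =
      gauss z * ((1 - inner z (?a + ?c) - (norm (?a + ?c))\<^sup>2 / 2) + (1 - inner z (?a - ?c) - (norm (?a - ?c))\<^sup>2 / 2))"
      by (simp only:)
    also have "\<dots> \<le> gauss (z + (?a + ?c)) + gauss (z + (?a - ?c))"
      unfolding distrib_left by (intro add_mono gauss_step_ge)
    finally show ?thesis .
  qed
  have "(\<Sum>j\<in>(UNIV::'m set). gauss z * (2 - 2 * h * inner z v - h\<^sup>2 * (norm v)\<^sup>2 - 2 * h * ?m * (norm (column j S))\<^sup>2))
    \<le> (\<Sum>l\<in>UNIV. gauss (z + em_step h v S l))"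
    unfolding sum_em_step[of "\<lambda>u. gauss (z + u)"] by (intro sum_mono pair)
  moreover have "(\<Sum>j\<in>(UNIV::'m set). gauss z * (2 - 2 * h * inner z v - h\<^sup>2 * (norm v)\<^sup>2 - 2 * h * ?m * (norm (column j S))\<^sup>2))
    = gauss z * (1 - h * (inner z v + (norm S)\<^sup>2) - h\<^sup>2 * (norm v)\<^sup>2 / 2) * (2 * ?m)"
    unfolding sum_distrib_left[symmetric] sum_subtractf sum_norm_column_power2 by (simp add: algebra_simps)
  ultimately show ?thesis by (simp add: pos_le_divide_eq)
qed

text \<open>A step is linear in the coefficients. With the same noise \<open>l\<close> at both
  points, the difference therefore has the covariance of \<open>S - S'\<close>, which is the one in
  \<open>q\<close>.\<close>

lemma em_step_diff: "em_step h v S l - em_step h v' S' l = em_step h (v - v') (S - S') l"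
proof -
  have "column (fst l) (S - S') = column (fst l) S - column (fst l) S'" by (simp add: column_def vec_eq_iff)
  then show ?thesis unfolding em_step_def by (simp add: scaleR_diff_right)
qed

lemma em_step_zero: "em_step h 0 (0 :: real^'m::finite^'n::finite) l = 0"
proof -
  have "column j (0 :: real^'m^'n) = 0" for j by (simp add: column_def vec_eq_iff)
  then show ?thesis by (simp add: em_step_def)
qed

text \<open>Where only one of the two points has large coefficients, the truncated step is not the coupled one;
  the error is then dominated by the size of the coefficients at the bad point.\<close>

lemma coupled_step_gain:
  fixes Sig :: "real^'n::finite \<Rightarrow> real^'m::finite^'n"
  assumes q: "\<And>x y. x \<noteq> y \<Longrightarrow> qfun Sig b x y < 0"
    and h: "h \<ge> 0" and R: "R \<ge> 0" and \<epsilon>: "\<epsilon> \<le> 1" "norm (x - X) \<le> \<epsilon>" "norm (y - Y) \<le> \<epsilon>"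
  defines "t \<equiv> \<lambda>X. coef_size Sig b X * indicator {X. coef_size Sig b X > R} X"
  shows "gauss (x - y) + h * (if coef_size Sig b X \<le> R \<and> coef_size Sig b Y \<le> R
         then exp (- (norm (X - Y) + 2)\<^sup>2 / 2) * - qfun Sig b X Y else 0)
    \<le> (\<Sum>l\<in>UNIV. gauss (x - y + (trunc_step Sig b R h l X - trunc_step Sig b R h l Y))) / (2 * real CARD('m))
      + (2 * h\<^sup>2 * R\<^sup>2 + h * (2 * \<epsilon>) * (coef_size Sig b X + coef_size Sig b Y) + h * (t X + t Y))"
proof -
  let ?z = "x - y" and ?F = "coef_size Sig b"
  \<comment> \<open>A frozen point is treated as having zero coefficients, so in every case the
    difference of the truncated steps is a single step with coefficients \<open>v\<close> and
    \<open>S\<close>.\<close>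
  define v where "v = (if ?F X \<le> R then b X else 0) - (if ?F Y \<le> R then b Y else 0)"
  define S where "S = (if ?F X \<le> R then Sig X else 0) - (if ?F Y \<le> R then Sig Y else 0)"
  have ts: "trunc_step Sig b R h l X - trunc_step Sig b R h l Y = em_step h v S l" for l
    unfolding v_def S_def em_step_diff[symmetric] by (simp add: trunc_step_def em_step_zero)
  have F0: "?F x \<ge> 0" for x by simp
  have t0: "t x \<ge> 0" for x by (simp add: t_def)
  have \<epsilon>0: "\<epsilon> \<ge> 0" using \<epsilon>(2) norm_ge_zero order_trans by blast
  have g1: "gauss ?z \<le> 1" by simp
  have bF: "norm (b x) \<le> ?F x" for x by simp
  have avg: "(\<Sum>l\<in>UNIV. gauss (?z + (trunc_step Sig b R h l X - trunc_step Sig b R h l Y))) / (2 * real CARD('m))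
    \<ge> gauss ?z * (1 - h * (inner ?z v + (norm S)\<^sup>2) - h\<^sup>2 * (norm v)\<^sup>2 / 2)"
    unfolding ts by (rule gauss_average_ge[OF h])
  have nv: "norm v \<le> 2 * R"
  proof -
    define w where "w x = (if ?F x \<le> R then b x else 0)" for x
    have "norm (w x) \<le> R" for x unfolding w_def using R by (auto intro: order_trans[OF bF])
    from this[of X] this[of Y] have "norm (w X - w Y) \<le> 2 * R"
      using norm_triangle_ineq4[of "w X" "w Y"] by linarith
    then show ?thesis unfolding v_def w_def .
  qed
  have "gauss ?z * (h\<^sup>2 * (norm v)\<^sup>2 / 2) \<le> 1 * (h\<^sup>2 * (2 * R)\<^sup>2 / 2)"
    by (intro mult_mono divide_right_mono mult_left_mono power_mono nv g1) auto
  then have e1: "gauss ?z * (h\<^sup>2 * (norm v)\<^sup>2 / 2) \<le> 2 * h\<^sup>2 * R\<^sup>2" by (simp add: power_mult_distrib mult_ac)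
  have main: "h * (if ?F X \<le> R \<and> ?F Y \<le> R then exp (- (norm (X - Y) + 2)\<^sup>2 / 2) * - qfun Sig b X Y else 0)
    \<le> h * (2 * \<epsilon> * (?F X + ?F Y) + (t X + t Y) - gauss ?z * (inner ?z v + (norm S)\<^sup>2))"
  proof (rule mult_left_mono[OF _ h])
    have one_bad: "0 \<le> 2 * \<epsilon> * (?F X + ?F Y) + (t X + t Y) - gauss ?z * (inner ?z v + (norm S)\<^sup>2)"
      if c: "norm v + (norm S)\<^sup>2 \<le> t X + t Y"
    proof -
      have "gauss ?z * inner ?z v \<le> gauss ?z * (norm ?z * norm v)"
        by (intro mult_left_mono norm_cauchy_schwarz) auto
      also have "\<dots> = (norm ?z * gauss ?z) * norm v" by simp
      also have "\<dots> \<le> 1 * norm v" by (intro mult_right_mono norm_times_gauss_le) auto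
      finally have "gauss ?z * inner ?z v \<le> norm v" by simp
      moreover have "gauss ?z * (norm S)\<^sup>2 \<le> 1 * (norm S)\<^sup>2" by (intro mult_right_mono g1) auto
      moreover have "0 \<le> 2 * \<epsilon> * (?F X + ?F Y)" using \<epsilon>0 by simp
      ultimately show ?thesis using c unfolding distrib_left by linarith
    qed
    consider "?F X \<le> R" "?F Y \<le> R" | "?F X > R" "?F Y \<le> R" | "?F X \<le> R" "?F Y > R" | "?F X > R" "?F Y > R"
      by linarith
    then show "(if ?F X \<le> R \<and> ?F Y \<le> R then exp (- (norm (X - Y) + 2)\<^sup>2 / 2) * - qfun Sig b X Y else 0)
      \<le> 2 * \<epsilon> * (?F X + ?F Y) + (t X + t Y) - gauss ?z * (inner ?z v + (norm S)\<^sup>2)"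
    proof cases
      case 1
      have vS: "v = b X - b Y" "S = Sig X - Sig Y" using 1 by (auto simp: v_def S_def)
      have q0: "qfun Sig b X Y \<le> 0"
      proof (cases "X = Y")
        case True
        then show ?thesis unfolding qfun_def trace_mult_transpose by simp
      qed (use q[of X Y] in auto)
      \<comment> \<open>The coefficients are taken at \<open>X\<close> and \<open>Y\<close> but the
        Gaussian at \<open>x - y\<close>; the mismatch is at most \<open>2 \<epsilon>\<close> times
        the sizes of the coefficients.\<close>
      have qeq: "inner ?z v + (norm S)\<^sup>2 = qfun Sig b X Y + inner ((x - X) - (y - Y)) (b X - b Y)"
        unfolding vS qfun_def trace_mult_transpose by (simp add: inner_diff_left)
      have "inner ((x - X) - (y - Y)) (b X - b Y) \<le> norm ((x - X) - (y - Y)) * norm (b X - b Y)"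
        by (rule norm_cauchy_schwarz)
      also have "\<dots> \<le> (2 * \<epsilon>) * (?F X + ?F Y)"
      proof (intro mult_mono)
        show "norm ((x - X) - (y - Y)) \<le> 2 * \<epsilon>"
          using norm_triangle_ineq4[of "x - X" "y - Y"] \<epsilon> by linarith
        show "norm (b X - b Y) \<le> ?F X + ?F Y"
          using norm_triangle_ineq4[of "b X" "b Y"] bF[of X] bF[of Y] by linarith
      qed (use \<epsilon>0 in auto)
      finally have in': "inner ((x - X) - (y - Y)) (b X - b Y) \<le> 2 * \<epsilon> * (?F X + ?F Y)" .
      have "gauss ?z * inner ((x - X) - (y - Y)) (b X - b Y) \<le> gauss ?z * (2 * \<epsilon> * (?F X + ?F Y))"
        by (rule mult_left_mono[OF in']) simp
      also have "\<dots> \<le> 1 * (2 * \<epsilon> * (?F X + ?F Y))"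
        using \<epsilon>0 by (intro mult_right_mono g1) auto
      finally have e2: "gauss ?z * inner ((x - X) - (y - Y)) (b X - b Y) \<le> 2 * \<epsilon> * (?F X + ?F Y)" by simp
      \<comment> \<open>This is the origin of the \<open>+ 2\<close> in the weight: mollification
        moves each point by at most 1, so the weight bounds the Gaussian of \<open>x - y\<close>
        from below in terms of \<open>X\<close> and \<open>Y\<close> alone.\<close>
      have "norm ?z \<le> norm (X - Y) + 2"
      proof -
        have "?z = (X - Y) + ((x - X) - (y - Y))" by simp
        then have "norm ?z \<le> norm (X - Y) + norm ((x - X) - (y - Y))" by (metis norm_triangle_ineq)
        then show ?thesis using norm_triangle_ineq4[of "x - X" "y - Y"] \<epsilon> by linarith
      qed
      then have "(norm ?z)\<^sup>2 \<le> (norm (X - Y) + 2)\<^sup>2" by (intro power_mono) auto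
      then have "exp (- (norm (X - Y) + 2)\<^sup>2 / 2) \<le> gauss ?z" by simp
      then have "exp (- (norm (X - Y) + 2)\<^sup>2 / 2) * - qfun Sig b X Y \<le> gauss ?z * - qfun Sig b X Y"
        using q0 by (intro mult_right_mono) auto
      then show ?thesis using 1 e2 t0[of X] t0[of Y] unfolding qeq distrib_left by (simp add: t_def)
    next
      case 2
      have "norm v + (norm S)\<^sup>2 = ?F Y" using 2 by (simp add: v_def S_def)
      \<comment> \<open>The good point has size at most \<open>R\<close>, which is less than the
        size at the bad point, and the latter is counted in full by \<open>t X\<close>.\<close>
      also have "\<dots> \<le> t X + t Y" using 2 by (simp add: t_def indicator_def)
      finally show ?thesis using one_bad 2 by auto
    next
      case 3
      have "norm v + (norm S)\<^sup>2 = ?F X" using 3 by (simp add: v_def S_def)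
      also have "\<dots> \<le> t X + t Y" using 3 by (simp add: t_def indicator_def)
      finally show ?thesis using one_bad 3 by auto
    next
      case 4
      have "norm v + (norm S)\<^sup>2 = 0" using 4 by (simp add: v_def S_def)
      also have "\<dots> \<le> t X + t Y" using t0[of X] t0[of Y] by simp
      finally show ?thesis using one_bad 4 by auto
    qed
  qed
  show ?thesis using avg e1 main by (simp add: algebra_simps)
qed

section \<open>Tails of the coefficients and almost optimal couplings\<close>

lemma tail_integral_tendsto_0:
  fixes f :: "'a \<Rightarrow> real"
  assumes f: "integrable M f" and f0: "\<And>x. f x \<ge> 0"
  shows "(\<lambda>n. \<integral>x. f x * indicator {x. f x > real n} x \<partial>M) \<longlonglongrightarrow> 0"
proof -
  have [measurable]: "f \<in> borel_measurable M" using f by auto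
  have "(\<lambda>n. \<integral>x. f x * indicator {x. f x > real n} x \<partial>M) \<longlonglongrightarrow> (\<integral>x. 0 \<partial>M)"
  proof (rule integral_dominated_convergence[where w=f])
    show "AE x in M. (\<lambda>n. f x * indicator {x. f x > real n} x) \<longlonglongrightarrow> 0"
    proof (rule AE_I2)
      fix x
      obtain n0 where "f x \<le> real n0" using real_arch_simple by blast
      then have "\<forall>\<^sub>F n in sequentially. f x * indicator {x. f x > real n} x = 0"
        by (intro eventually_sequentiallyI[of n0]) (auto simp: indicator_def)
      then show "(\<lambda>n. f x * indicator {x. f x > real n} x) \<longlonglongrightarrow> 0" by (rule tendsto_eventually)
    qed
    show "AE x in M. norm (f x * indicator {x. f x > real n} x) \<le> f x" for n
      using f0 by (auto simp: indicator_def)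
    show "(\<lambda>x. f x * indicator {x. f x > real n} x) \<in> borel_measurable M" for n
    proof -
      have "(\<lambda>x. f x * indicator {x. f x > real n} x) = (\<lambda>x. if f x > real n then f x else 0)"
        by (auto simp: indicator_def)
      then show ?thesis by simp
    qed
  qed (use f in auto)
  then show ?thesis by simp
qed

text \<open>Applying the domination to complements reverses it, as both masses are 1.\<close>

lemma prob_measure_eqI_le:
  assumes M: "prob_space M" and N: "prob_space N" and s: "sets M = sets N"
    and le: "\<And>A. A \<in> sets M \<Longrightarrow> emeasure M A \<le> emeasure N A"
  shows "M = N"
proof (rule measure_eqI[OF s])
  interpret M: prob_space M by fact
  interpret N: prob_space N by fact
  fix A assume A: "A \<in> sets M"
  have sp: "space M = space N" using s sets_eq_imp_space_eq by blast
  have "measure M (space M - A) \<le> measure N (space M - A)"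
    using le[of "space M - A"] A by (auto simp: M.emeasure_eq_measure N.emeasure_eq_measure)
  then have "1 - measure M A \<le> 1 - measure N A"
    using A s M.prob_compl[of A] N.prob_compl[of A] by (simp add: sp)
  moreover have "measure M A \<le> measure N A"
    using le[OF A] by (simp add: M.emeasure_eq_measure N.emeasure_eq_measure)
  ultimately show "emeasure M A = emeasure N A"
    by (simp add: M.emeasure_eq_measure N.emeasure_eq_measure)
qed

lemma distr_eqI_le:
  assumes L: "prob_space L" and f: "f \<in> measurable L borel" and M: "prob_space M" "sets M = sets borel"
    and le: "\<And>A. A \<in> sets borel \<Longrightarrow> (\<integral>\<^sup>+z. indicator A (f z) \<partial>L) \<le> (\<integral>\<^sup>+x. indicator A x \<partial>M)"
  shows "distr L borel f = M"
proof (rule prob_measure_eqI_le)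
  interpret L: prob_space L by fact
  show "prob_space (distr L borel f)" by (rule L.prob_space_distr[OF f])
  fix A assume "A \<in> sets (distr L borel f)"
  then have A: "A \<in> sets borel" by simp
  have "emeasure (distr L borel f) A = (\<integral>\<^sup>+z. indicator A (f z) \<partial>L)"
    using nn_integral_distr[OF f, of "indicator A"] A by simp
  then show "emeasure (distr L borel f) A \<le> emeasure M A" using le[OF A] A M(2) by simp
qed (use M in auto)

context mollified_pair
begin

lemma prob_space_lift:
  assumes \<theta>: "feasible p r \<theta>" and 1: "payoff (\<lambda>_. 1) p r \<theta> = 1"
  shows "prob_space (lift \<rho> M N \<theta>)"
proof
  have [measurable]: "\<theta> \<in> borel_measurable (borel \<Otimes>\<^sub>M borel)" using \<theta> by (auto simp: feasible_def)
  have "emeasure (lift \<rho> M N \<theta>) (space (lift \<rho> M N \<theta>)) = (\<integral>\<^sup>+z. 1 \<partial>lift \<rho> M N \<theta>)" by simp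
  also have "\<dots> = payoff (\<lambda>_. 1) p r \<theta>"
    using nn_integral_lift_snd[of \<theta> "\<lambda>_. 1"] by (simp add: payoff_def)
  finally show "emeasure (lift \<rho> M N \<theta>) (space (lift \<rho> M N \<theta>)) = 1" using 1 by simp
qed

lemma sets_lift: "sets (lift \<rho> M N \<theta>) = sets ((borel \<Otimes>\<^sub>M borel) \<Otimes>\<^sub>M (borel \<Otimes>\<^sub>M borel))"
  unfolding lift_def sets_density by (rule sets_quad)

text \<open>Each marginal is dominated by \<open>M\<close> or \<open>N\<close> and has mass 1, hence
  is equal to it.\<close>

lemma coupling_lift:
  assumes \<theta>: "feasible p r \<theta>" and 1: "payoff (\<lambda>_. 1) p r \<theta> = 1"
  shows "coupling M N (distr (lift \<rho> M N \<theta>) (borel \<Otimes>\<^sub>M borel) fst)"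
proof -
  note L = prob_space_lift[OF \<theta> 1] and [measurable_cong] = sets_lift
  have "distr (lift \<rho> M N \<theta>) borel (\<lambda>z. fst (fst z)) = M"
    by (rule distr_eqI_le[OF L _ M.prob_space_axioms sM]) (measurable, rule nn_integral_lift_fst_le[OF \<theta>], simp)
  moreover have "distr (lift \<rho> M N \<theta>) borel (\<lambda>z. snd (fst z)) = N"
    by (rule distr_eqI_le[OF L _ N.prob_space_axioms sN]) (measurable, rule nn_integral_lift_snd_le[OF \<theta>], simp)
  moreover have "fst \<in> measurable (lift \<rho> M N \<theta>) (borel \<Otimes>\<^sub>M borel)" by measurable
  ultimately show ?thesis
    unfolding coupling_def by (auto simp: distr_distr comp_def)
qed

lemma payoff_le_1:
  assumes \<theta>: "feasible p r \<theta>" and k: "\<And>x. k x \<le> 1"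
  shows "payoff k p r \<theta> \<le> 1"
proof -
  have [measurable]: "\<theta> \<in> borel_measurable (borel \<Otimes>\<^sub>M borel)"
    and \<theta>1: "\<And>x. (\<integral>\<^sup>+y. \<theta> (x, y) * r y \<partial>lborel) \<le> 1" using \<theta> by (auto simp: feasible_def)
  have "payoff k p r \<theta> \<le> (\<integral>\<^sup>+x. p x \<partial>lborel)"
    unfolding payoff_def
  proof (rule nn_integral_mono)
    fix x
    have "(\<integral>\<^sup>+y. k (x - y) * (\<theta> (x, y) * p x * r y) \<partial>lborel) \<le> (\<integral>\<^sup>+y. 1 * (\<theta> (x, y) * p x * r y) \<partial>lborel)"
      by (intro nn_integral_mono mult_right_mono k) auto
    also have "\<dots> = (\<integral>\<^sup>+y. p x * (\<theta> (x, y) * r y) \<partial>lborel)" by (simp add: mult_ac)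
    also have "\<dots> = p x * (\<integral>\<^sup>+y. \<theta> (x, y) * r y \<partial>lborel)" by (rule nn_integral_cmult) measurable
    also have "\<dots> \<le> p x * 1" by (intro mult_left_mono \<theta>1) auto
    finally show "(\<integral>\<^sup>+y. k (x - y) * (\<theta> (x, y) * p x * r y) \<partial>lborel) \<le> p x" by simp
  qed
  then show ?thesis by (simp add: p_integral)
qed

text \<open>The supremum over sub-couplings is finite, so it can be approached; completing the
  approximant to full mass does not lower its payoff, and the comparison still covers every
  sub-coupling.\<close>

lemma exists_almost_optimal:
  assumes k[measurable]: "k \<in> borel_measurable borel" and k1: "\<And>x. k x \<le> 1" and e: "e > 0"
  shows "\<exists>\<theta>. feasible p r \<theta> \<and> payoff (\<lambda>_. 1) p r \<theta> = 1 \<and>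
    (\<forall>\<theta>'. feasible p r \<theta>' \<longrightarrow> payoff k p r \<theta>' \<le> payoff k p r \<theta> + ennreal e)"
proof -
  interpret S: mollified_pair N M \<rho> by (rule mollified_pair_swap)
  define V where "V = (SUP \<theta>\<in>Collect (feasible p r). payoff k p r \<theta>)"
  have "V \<le> 1" unfolding V_def using payoff_le_1[OF _ k1] by (auto intro!: SUP_least)
  then have Vf: "V \<noteq> \<infinity>" by (auto simp: top_unique)
  have "Collect (feasible p r) \<noteq> {}"
  proof -
    have "feasible p r (\<lambda>_. 0)" by (simp add: feasible_def)
    then show ?thesis by blast
  qed
  from SUP_approx_ennreal[OF _ this V_def Vf, of e] e
  obtain \<theta> where \<theta>: "feasible p r \<theta>" "V < payoff k p r \<theta> + ennreal e" by auto
  obtain \<theta>' where \<theta>': "feasible p r \<theta>'" "\<And>z. \<theta> z \<le> \<theta>' z" "payoff (\<lambda>_. 1) p r \<theta>' = 1"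
    using feasible_completion[OF p_measurable r_measurable p_integral S.p_integral \<theta>(1)] by blast
  have "payoff k p r \<theta> \<le> payoff k p r \<theta>'"
    unfolding payoff_def by (intro nn_integral_mono mult_left_mono mult_right_mono \<theta>'(2)) auto
  then have V: "V \<le> payoff k p r \<theta>' + ennreal e"
    using \<theta>(2) by (meson add_right_mono less_imp_le order_trans)
  have "payoff k p r \<theta>'' \<le> payoff k p r \<theta>' + ennreal e" if "feasible p r \<theta>''" for \<theta>''
    using that V by (intro order_trans[OF _ V]) (auto simp: V_def intro!: SUP_upper)
  then show ?thesis using \<theta>' by blast
qed

end

text \<open>The payoff of the almost optimal \<theta> plus \<open>h\<close> times the sought
  integral is at most the payoff after the step plus errors. By thinning and almost optimality, this
  is at most the payoff of \<theta> plus \<open>h^2\<close>, the two marginal defects and the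
  errors. The finite payoff cancels and \<open>h\<close> divides out. The parameters are chosen in
  the order \<epsilon>, mollifier, \<open>R\<close>, \<open>h\<close>; each of the bounds
  \<open>b1\<close>, \<open>b2\<close>, \<open>b3\<close> takes \<delta> / 4.\<close>

lemma dissipative_couplings:
  fixes Sig :: "real^'n::finite \<Rightarrow> real^'m::finite^'n"
  assumes meas[measurable]: "Sig \<in> borel_measurable borel" "b \<in> borel_measurable borel"
    and q: "\<And>x y. x \<noteq> y \<Longrightarrow> qfun Sig b x y < 0"
    and M: "prob_solution Sig b M" "integrable M (coef_size Sig b)"
    and N: "prob_solution Sig b N" "integrable N (coef_size Sig b)"
    and \<delta>: "\<delta> > 0"
  shows "\<exists>P. coupling M N P \<and>
      (\<integral>\<^sup>+z. (case z of (x, y) \<Rightarrow> if coef_size Sig b x \<le> R0 \<and> coef_size Sig b y \<le> R0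
         then ennreal (exp (- (norm (x - y) + 2)\<^sup>2 / 2) * - qfun Sig b x y) else 0) \<partial>P) \<le> ennreal \<delta>"
proof -
  let ?F = "coef_size Sig b" and ?n = "real CARD('n)"
  have sM[measurable_cong]: "sets M = sets borel" and pM: "prob_space M" using M(1) by (auto simp: prob_solution_def)
  have sN[measurable_cong]: "sets N = sets borel" and pN: "prob_space N" using N(1) by (auto simp: prob_solution_def)
  define I where "I = (\<integral>x. ?F x \<partial>M) + (\<integral>x. ?F x \<partial>N)"
  have I0: "I \<ge> 0" by (simp add: I_def)
  \<comment> \<open>Chosen so that \<open>2 \<epsilon> I <= \<delta> / 4\<close>; adding 1 to
    \<open>I\<close> avoids a zero denominator, and \<open>\<epsilon> <= 1\<close> is what the
    \<open>+ 2\<close> in the weight presupposes.\<close>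
  define \<epsilon> where "\<epsilon> = min 1 (\<delta> / (8 * (I + 1)))"
  have \<epsilon>: "\<epsilon> > 0" "\<epsilon> \<le> 1" using \<delta> I0 by (auto simp: \<epsilon>_def)
  have "2 * \<epsilon> * I \<le> 2 * (\<delta> / (8 * (I + 1))) * I" using I0 by (intro mult_right_mono mult_left_mono) (auto simp: \<epsilon>_def)
  also have "\<dots> \<le> \<delta> / 4" using \<delta> I0 by (simp add: field_simps)
  finally have b1: "2 * \<epsilon> * I \<le> \<delta> / 4" .
  obtain c s where cs: "c > 0" "s > 0" "(\<integral>\<^sup>+x. ennreal (tbump c s (0::real^'n) x) \<partial>lborel) = 1" "?n \<le> s * \<epsilon>"
    using exists_mollifier[OF \<epsilon>(1), where 'n='n] by blast
  define \<rho> where "\<rho> = (\<lambda>x. ennreal (tbump c s (0::real^'n) x))"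
  obtain D where D: "D \<ge> 0" "\<And>is a x. length is \<le> 3 \<Longrightarrow> \<bar>iter_pdiff is (tbump c (- s) (a::real^'n)) x\<bar> \<le> D"
    using iter_pdiff_tbump_uniform_bound[of c "- s", where 'n='n] by blast
  define A0 where "A0 = measure lborel (cball (0::real^'n) \<epsilon>)"
  define K1 where "K1 = D * ?n\<^sup>2"
  have K1: "K1 \<ge> 0" using D(1) by (simp add: K1_def)
  define t where "t R x = ?F x * indicator {x. ?F x > R} x" for R x
  have tm[measurable]: "t R \<in> borel_measurable borel" for R unfolding t_def by measurable
  have t0: "t R x \<ge> 0" for R x by (simp add: t_def)
  have tint: "integrable M (t R)" "integrable N (t R)" for R
    by (rule Bochner_Integration.integrable_bound[OF M(2)], auto simp: t_def indicator_def)
       (rule Bochner_Integration.integrable_bound[OF N(2)], auto simp: t_def indicator_def)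
  \<comment> \<open>\<open>R\<close> comes after the mollifier because \<open>K1 * A0\<close>
    depends on \<epsilon>. The summand 1 accounts for the tails lost in the coupled step
    itself.\<close>
  have "(\<lambda>n. ((\<integral>x. t (real n) x \<partial>M) + (\<integral>x. t (real n) x \<partial>N)) * (K1 * A0 + 1)) \<longlonglongrightarrow> (0 + 0) * (K1 * A0 + 1)"
    unfolding t_def by (intro tendsto_intros tail_integral_tendsto_0 M N) auto
  then have "\<forall>\<^sub>F n in sequentially. ((\<integral>x. t (real n) x \<partial>M) + (\<integral>x. t (real n) x \<partial>N)) * (K1 * A0 + 1) < \<delta> / 4"
    by (rule order_tendstoD) (use \<delta> in simp)
  moreover have "\<forall>\<^sub>F n in sequentially. real n \<ge> max 1 R0"
    using filterlim_real_sequentially unfolding filterlim_at_top by blast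
  ultimately have "\<forall>\<^sub>F n in sequentially. real n \<ge> max 1 R0 \<and> ((\<integral>x. t (real n) x \<partial>M) + (\<integral>x. t (real n) x \<partial>N)) * (K1 * A0 + 1) < \<delta> / 4"
    by eventually_elim blast
  then obtain n where n: "real n \<ge> max 1 R0" "((\<integral>x. t (real n) x \<partial>M) + (\<integral>x. t (real n) x \<partial>N)) * (K1 * A0 + 1) < \<delta> / 4"
    using eventually_happens'[OF sequentially_bot] by blast
  define R where "R = real n"
  have R: "R \<ge> 1" "R \<ge> R0" using n by (auto simp: R_def)
  define TM where "TM = (\<integral>x. t R x \<partial>M)"
  define TN where "TN = (\<integral>x. t R x \<partial>N)"
  have T0: "TM \<ge> 0" "TN \<ge> 0" using t0 by (auto simp: TM_def TN_def)
  have b2: "(TM + TN) * (K1 * A0 + 1) \<le> \<delta> / 4" using n(2) by (simp add: TM_def TN_def R_def)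
  define K where "K = D * ((?n * R * (1 + sqrt (2 * CARD('m)))) ^ 3 + (?n * R)\<^sup>2)"
  have K0: "K \<ge> 0" using D R by (auto simp: K_def)
  define A1 where "A1 = measure lborel (cball (0::real^'n) (\<epsilon> + R * (1 + sqrt (2 * CARD('m)))))"
  have A: "A0 \<ge> 0" "A1 \<ge> 0" by (auto simp: A0_def A1_def)
  define B where "B = 1 + 2 * R\<^sup>2 + 2 * K * A1"
  have "2 * R\<^sup>2 + 2 * K * A1 \<ge> 0" using K0 A by (intro add_nonneg_nonneg mult_nonneg_nonneg) auto
  then have B1: "B \<ge> 1" by (simp add: B_def)
  define \<eta> where "\<eta> = min 1 (\<delta> / (4 * B))"
  have \<eta>: "\<eta> > 0" "\<eta> \<le> 1" using \<delta> B1 by (auto simp: \<eta>_def)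
  have "\<eta> * B \<le> \<delta> / (4 * B) * B" using B1 by (intro mult_right_mono) (auto simp: \<eta>_def)
  then have \<eta>B: "\<eta> * B \<le> \<delta> / 4" using B1 by simp
  \<comment> \<open>As a square, \<open>h\<close> has root \<eta>; since \<open>h <= \<eta>\<close>,
    the terms in \<open>h\<close> and in \<open>sqrt h\<close> are together at most
    \<open>\<eta> B\<close>.\<close>
  define h where "h = \<eta>\<^sup>2"
  have "\<eta> * \<eta> \<le> \<eta>" using \<eta> by (intro mult_left_le) auto
  then have h: "h > 0" "h \<le> 1" "sqrt h = \<eta>" "h \<le> \<eta>"
    using \<eta> by (simp_all add: h_def power2_eq_square mult_le_one)
  have b3: "h * (1 + 2 * R\<^sup>2) + 2 * K * A1 * sqrt h \<le> \<delta> / 4"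
  proof -
    have "h * (1 + 2 * R\<^sup>2) \<le> \<eta> * (1 + 2 * R\<^sup>2)" by (intro mult_right_mono h) auto
    then have "h * (1 + 2 * R\<^sup>2) + 2 * K * A1 * sqrt h \<le> \<eta> * B" unfolding h(3) B_def by (simp add: algebra_simps)
    then show ?thesis using \<eta>B by linarith
  qed
  interpret mollified_pair M N \<rho>
    using pM pN sM sN cs(3) by (intro mollified_pair.intro mollified_pair_axioms.intro) (auto simp: \<rho>_def)
  define k where "k z = ennreal (gauss z)" for z :: "real^'n"
  have km[measurable]: "k \<in> borel_measurable borel" unfolding k_def by measurable
  have k1: "k z \<le> 1" for z by (simp add: k_def ennreal_le_1)
  \<comment> \<open>After division by \<open>h\<close> the tolerance \<open>h^2\<close> becomes
    \<open>h\<close>, which is the 1 in \<open>h * (1 + 2 R^2)\<close> of \<open>b3\<close>.\<close>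
  obtain \<theta> where \<theta>: "feasible p r \<theta>" "payoff (\<lambda>_. 1) p r \<theta> = 1"
    "\<And>\<theta>'. feasible p r \<theta>' \<Longrightarrow> payoff k p r \<theta>' \<le> payoff k p r \<theta> + ennreal (h\<^sup>2)"
    using exists_almost_optimal[OF km k1, of "h\<^sup>2"] h by auto
  have \<theta>m[measurable]: "\<theta> \<in> borel_measurable (borel \<Otimes>\<^sub>M borel)" using \<theta>(1) by (auto simp: feasible_def)
  let ?v = "trunc_step Sig b R h"
  have vm[measurable]: "?v l \<in> borel_measurable borel" for l by (rule trunc_step_measurable[OF meas])
  let ?L = "lift \<rho> M N \<theta>"
  interpret L: prob_space ?L by (rule prob_space_lift[OF \<theta>(1,2)])
  note sets_lift[measurable_cong]
  have \<rho>D: "\<rho> x \<le> ennreal D" for x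
  proof -
    have "\<bar>tbump c s 0 x\<bar> \<le> D" using D(2)[of "[]" "s *\<^sub>R x" 0] tbump_reflect[of c s x 0] by simp
    then show ?thesis by (auto simp: \<rho>_def intro!: ennreal_leI)
  qed
  define avg where "avg = (\<lambda>z. (\<Sum>l\<in>UNIV. k (fst (snd z) - snd (snd z) + (?v l (fst (fst z)) - ?v l (snd (fst z))))) / of_nat CARD('m \<times> bool))"
  have avgm[measurable]: "avg \<in> borel_measurable ?L" unfolding avg_def by measurable
  define dM where "dM = (\<integral>\<^sup>+x. shifted_average \<rho> ?v M x - p x \<partial>lborel)"
  define dN where "dN = (\<integral>\<^sup>+x. shifted_average \<rho> ?v N x - r x \<partial>lborel)"
  obtain \<theta>' where \<theta>': "feasible p r \<theta>'" "(\<integral>\<^sup>+z. avg z \<partial>?L) \<le> payoff k p r \<theta>' + dM + dN"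
    using push_thinning[where v="?v", OF \<theta>(1) vm km k1 \<rho>D ennreal_less_top] unfolding avg_def dM_def dN_def by blast
  have defect: "(\<integral>\<^sup>+x. shifted_average \<rho> ?v M' x - mollify \<rho> M' x \<partial>lborel) \<le> ennreal (h * K1 * (\<integral>x. t R x \<partial>M') * A0 + K * (h * sqrt h) * A1)"
    if M': "prob_solution Sig b M'" "integrable M' ?F" "integrable M' (t R)" for M'
  proof -
    have fin: "emeasure lborel (cball (0::real^'n) e) = ennreal (measure lborel (cball (0::real^'n) e))" for e
      using emeasure_lborel_cball_finite[of "0::real^'n" e] by (intro emeasure_eq_ennreal_measure) auto
    have ti: "(\<integral>\<^sup>+x. ennreal (t R x) \<partial>M') = ennreal (\<integral>x. t R x \<partial>M')"
      by (intro nn_integral_eq_integral M'(3) AE_I2 t0)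
    have "(\<integral>\<^sup>+x. shifted_average \<rho> ?v M' x - mollify \<rho> M' x \<partial>lborel) \<le>
      ennreal (h * K1) * (\<integral>\<^sup>+x. ennreal (t R x) \<partial>M') * ennreal A0 + ennreal (K * (h * sqrt h)) * ennreal A1"
      using mollify_defect[OF meas M'(1,2) D(2) _ cs(2) cs(4) \<epsilon>(1) _ h(2) R(1)] cs(1) h(1)
      unfolding K1_def K_def A0_def A1_def t_def \<rho>_def fin[symmetric] by simp
    also have "\<dots> = ennreal (h * K1 * (\<integral>x. t R x \<partial>M') * A0 + K * (h * sqrt h) * A1)"
      unfolding ti using h K1 K0 A t0 by (simp add: ennreal_mult ennreal_plus)
    finally show ?thesis .
  qed
  have dM: "dM \<le> ennreal (h * K1 * TM * A0 + K * (h * sqrt h) * A1)"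
    unfolding dM_def TM_def by (rule defect[OF M tint(1)])
  have dN: "dN \<le> ennreal (h * K1 * TN * A0 + K * (h * sqrt h) * A1)"
    unfolding dN_def TN_def by (rule defect[OF N tint(2)])
  define \<Phi> where "\<Phi> R = (\<lambda>z. (case z of (x, y) \<Rightarrow> if ?F x \<le> R \<and> ?F y \<le> R
         then ennreal (exp (- (norm (x - y) + 2)\<^sup>2 / 2) * - qfun Sig b x y) else 0))" for R
  have \<Phi>m[measurable]: "\<Phi> R \<in> borel_measurable (borel \<Otimes>\<^sub>M borel)" for R
    unfolding \<Phi>_def qfun_def trace_mult_transpose by measurable
  \<comment> \<open>The estimate is proved at the larger level \<open>R\<close>; the level
    \<open>R0\<close> of the claim only restricts a nonnegative integrand.\<close>
  have \<Phi>mono: "\<Phi> R0 z \<le> \<Phi> R z" for z using R by (auto simp: \<Phi>_def split: prod.split)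
  define rest where "rest = (\<lambda>z :: ((real^'n) \<times> (real^'n)) \<times> ((real^'n) \<times> (real^'n)). ennreal (2 * h\<^sup>2 * R\<^sup>2) + (ennreal (h * (2 * \<epsilon>)) * ennreal (?F (fst (fst z))) + ennreal (h * (2 * \<epsilon>)) * ennreal (?F (snd (fst z))))
     + (ennreal h * ennreal (t R (fst (fst z))) + ennreal h * ennreal (t R (snd (fst z)))) :: ennreal)"
  \<comment> \<open>\<open>lift\<close> charges only pairs for which \<rho> is nonzero, that is,
    within \<epsilon> of each other.\<close>
  have ae: "AE z in ?L. norm (fst (snd z) - fst (fst z)) \<le> \<epsilon> \<and> norm (snd (snd z) - snd (fst z)) \<le> \<epsilon>"
  proof -
    have z: "\<rho> (x - X) = 0" if "norm (x - X) > \<epsilon>" for x X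
      using iter_pdiff_tbump_eq_0[OF that cs(4,2), of "[]" c] by (simp add: \<rho>_def tbump_reflect)
    have z': "norm (x - X) \<le> \<epsilon>" if "\<rho> (x - X) \<noteq> 0" for x X using z[of x X] that by linarith
    show ?thesis unfolding lift_def
      by (subst AE_density) (measurable, auto intro!: AE_I2 z' simp: zero_less_iff_neq_zero)
  qed
  have "(\<integral>\<^sup>+z. k (fst (snd z) - snd (snd z)) + ennreal h * \<Phi> R (fst z) \<partial>?L) \<le> (\<integral>\<^sup>+z. avg z + rest z \<partial>?L)"
  proof (rule nn_integral_mono_AE)
    show "AE z in ?L. k (fst (snd z) - snd (snd z)) + ennreal h * \<Phi> R (fst z) \<le> avg z + rest z"
      using ae
    proof eventually_elim
      fix z :: "((real^'n) \<times> (real^'n)) \<times> ((real^'n) \<times> (real^'n))"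
      assume z: "norm (fst (snd z) - fst (fst z)) \<le> \<epsilon> \<and> norm (snd (snd z) - snd (fst z)) \<le> \<epsilon>"
      obtain X Y x y where zz: "z = ((X, Y), (x, y))" by (metis surj_pair)
      let ?\<phi> = "if ?F X \<le> R \<and> ?F Y \<le> R then exp (- (norm (X - Y) + 2)\<^sup>2 / 2) * - qfun Sig b X Y else 0"
      let ?a = "(\<Sum>l\<in>UNIV. gauss (x - y + (?v l X - ?v l Y))) / (2 * real CARD('m))"
      let ?r = "2 * h\<^sup>2 * R\<^sup>2 + h * (2 * \<epsilon>) * (?F X + ?F Y) + h * (t R X + t R Y)"
      have "gauss (x - y) + h * ?\<phi> \<le> ?a + ?r"
        unfolding t_def using z h R \<epsilon> by (intro coupled_step_gain q) (auto simp: zz)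
      then have le: "ennreal (gauss (x - y) + h * ?\<phi>) \<le> ennreal (?a + ?r)" by (rule ennreal_leI)
      have q0: "qfun Sig b X Y \<le> 0"
      proof (cases "X = Y")
        case True
        then show ?thesis unfolding qfun_def trace_mult_transpose by simp
      qed (use q[of X Y] in auto)
      then have "?\<phi> \<ge> 0" by (auto simp: mult_nonneg_nonpos)
      then have "ennreal (gauss (x - y) + h * ?\<phi>) = k (x - y) + ennreal h * \<Phi> R (X, Y)"
        using h by (subst ennreal_plus) (auto simp: k_def \<Phi>_def ennreal_mult)
      moreover have "ennreal ?a = avg z"
      proof -
        have "of_nat CARD('m \<times> bool) = ennreal (2 * real CARD('m))"
          by (simp add: ennreal_of_nat_eq_real_of_nat)
        then show ?thesis unfolding avg_def k_def zz
          by (simp add: sum_ennreal divide_ennreal sum_nonneg)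
      qed
      moreover have "ennreal ?r = rest z"
        using h \<epsilon> t0 unfolding rest_def zz
        by (simp add: ennreal_plus[symmetric] ennreal_mult[symmetric] algebra_simps del: ennreal_plus)
      moreover have "ennreal (?a + ?r) = ennreal ?a + ennreal ?r"
        using h \<epsilon> t0 by (intro ennreal_plus divide_nonneg_nonneg sum_nonneg add_nonneg_nonneg mult_nonneg_nonneg) auto
      ultimately show "k (fst (snd z) - snd (snd z)) + ennreal h * \<Phi> R (fst z) \<le> avg z + rest z"
        using le by (simp add: zz)
    qed
  qed
  moreover have "(\<integral>\<^sup>+z. k (fst (snd z) - snd (snd z)) + ennreal h * \<Phi> R (fst z) \<partial>?L) = payoff k p r \<theta> + ennreal h * (\<integral>\<^sup>+z. \<Phi> R (fst z) \<partial>?L)"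
  proof -
    have "(\<integral>\<^sup>+z. k (fst (snd z) - snd (snd z)) \<partial>?L) = payoff k p r \<theta>"
      using nn_integral_lift_snd[of \<theta> "\<lambda>z. k (fst z - snd z)"] by (simp add: payoff_def)
    then show ?thesis by (simp add: nn_integral_add nn_integral_cmult)
  qed
  moreover have "(\<integral>\<^sup>+z. avg z + rest z \<partial>?L) \<le> payoff k p r \<theta> + ennreal (h\<^sup>2) + dM + dN + ennreal (2 * h\<^sup>2 * R\<^sup>2 + h * (2 * \<epsilon>) * I + h * (TM + TN))"
  proof -
    have FM: "(\<integral>\<^sup>+z. ennreal (?F (fst (fst z))) \<partial>?L) \<le> ennreal (\<integral>x. ?F x \<partial>M)"
      using nn_integral_lift_fst_le[OF \<theta>(1), of "\<lambda>x. ennreal (?F x)"] nn_integral_eq_integral[OF M(2)] by simp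
    have FN: "(\<integral>\<^sup>+z. ennreal (?F (snd (fst z))) \<partial>?L) \<le> ennreal (\<integral>x. ?F x \<partial>N)"
      using nn_integral_lift_snd_le[OF \<theta>(1), of "\<lambda>x. ennreal (?F x)"] nn_integral_eq_integral[OF N(2)] by simp
    have tM: "(\<integral>\<^sup>+z. ennreal (t R (fst (fst z))) \<partial>?L) \<le> ennreal TM"
      using nn_integral_lift_fst_le[OF \<theta>(1), of "\<lambda>x. ennreal (t R x)"] nn_integral_eq_integral[OF tint(1), of R] t0 by (simp add: TM_def)
    have tN: "(\<integral>\<^sup>+z. ennreal (t R (snd (fst z))) \<partial>?L) \<le> ennreal TN"
      using nn_integral_lift_snd_le[OF \<theta>(1), of "\<lambda>x. ennreal (t R x)"] nn_integral_eq_integral[OF tint(2), of R] t0 by (simp add: TN_def)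
    have "(\<integral>\<^sup>+z. rest z \<partial>?L) = ennreal (2 * h\<^sup>2 * R\<^sup>2)
      + (ennreal (h * (2 * \<epsilon>)) * (\<integral>\<^sup>+z. ennreal (?F (fst (fst z))) \<partial>?L) + ennreal (h * (2 * \<epsilon>)) * (\<integral>\<^sup>+z. ennreal (?F (snd (fst z))) \<partial>?L))
      + (ennreal h * (\<integral>\<^sup>+z. ennreal (t R (fst (fst z))) \<partial>?L) + ennreal h * (\<integral>\<^sup>+z. ennreal (t R (snd (fst z))) \<partial>?L))"
      unfolding rest_def by (simp add: nn_integral_add nn_integral_cmult L.emeasure_space_1 del: ennreal_plus)
    also have "\<dots> \<le> ennreal (2 * h\<^sup>2 * R\<^sup>2)
      + (ennreal (h * (2 * \<epsilon>)) * ennreal (\<integral>x. ?F x \<partial>M) + ennreal (h * (2 * \<epsilon>)) * ennreal (\<integral>x. ?F x \<partial>N))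
      + (ennreal h * ennreal TM + ennreal h * ennreal TN)"
      by (intro add_mono mult_left_mono FM FN tM tN) auto
    also have "\<dots> = ennreal (2 * h\<^sup>2 * R\<^sup>2 + h * (2 * \<epsilon>) * I + h * (TM + TN))"
      using h \<epsilon> T0 unfolding I_def
      by (simp add: ennreal_plus[symmetric] ennreal_mult[symmetric] algebra_simps del: ennreal_plus)
    finally have rest: "(\<integral>\<^sup>+z. rest z \<partial>?L) \<le> ennreal (2 * h\<^sup>2 * R\<^sup>2 + h * (2 * \<epsilon>) * I + h * (TM + TN))" .
    have restm: "rest \<in> borel_measurable ?L" unfolding rest_def by measurable
    have "(\<integral>\<^sup>+z. avg z + rest z \<partial>?L) = (\<integral>\<^sup>+z. avg z \<partial>?L) + (\<integral>\<^sup>+z. rest z \<partial>?L)"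
      by (rule nn_integral_add[OF avgm restm])
    also have "\<dots> \<le> (payoff k p r \<theta> + ennreal (h\<^sup>2) + dM + dN) + ennreal (2 * h\<^sup>2 * R\<^sup>2 + h * (2 * \<epsilon>) * I + h * (TM + TN))"
      by (intro add_mono rest order_trans[OF \<theta>'(2)] \<theta>(3) \<theta>'(1) order_refl)
    finally show ?thesis .
  qed
  ultimately have "payoff k p r \<theta> + ennreal h * (\<integral>\<^sup>+z. \<Phi> R (fst z) \<partial>?L) \<le>
    payoff k p r \<theta> + (ennreal (h\<^sup>2) + dM + dN + ennreal (2 * h\<^sup>2 * R\<^sup>2 + h * (2 * \<epsilon>) * I + h * (TM + TN)))"
    by (simp only: add.assoc)
  moreover have "payoff k p r \<theta> \<noteq> \<top>" using payoff_le_1[OF \<theta>(1), of k] k1 by (auto simp: top_unique)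
  ultimately have "ennreal h * (\<integral>\<^sup>+z. \<Phi> R (fst z) \<partial>?L) \<le>
    ennreal (h\<^sup>2) + dM + dN + ennreal (2 * h\<^sup>2 * R\<^sup>2 + h * (2 * \<epsilon>) * I + h * (TM + TN))"
    by (simp add: ennreal_add_left_cancel_le)
  also have "\<dots> \<le> ennreal (h\<^sup>2) + ennreal (h * K1 * TM * A0 + K * (h * sqrt h) * A1) + ennreal (h * K1 * TN * A0 + K * (h * sqrt h) * A1)
     + ennreal (2 * h\<^sup>2 * R\<^sup>2 + h * (2 * \<epsilon>) * I + h * (TM + TN))"
    by (intro add_mono dM dN order_refl)
  also have "\<dots> = ennreal (h\<^sup>2 + (h * K1 * TM * A0 + K * (h * sqrt h) * A1) + (h * K1 * TN * A0 + K * (h * sqrt h) * A1)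
     + (2 * h\<^sup>2 * R\<^sup>2 + h * (2 * \<epsilon>) * I + h * (TM + TN)))"
    using h K1 K0 A T0 I0 \<epsilon> by (simp add: ennreal_plus[symmetric] del: ennreal_plus)
  also have "\<dots> \<le> ennreal (h * \<delta>)"
  proof (rule ennreal_leI)
    have "h\<^sup>2 + (h * K1 * TM * A0 + K * (h * sqrt h) * A1) + (h * K1 * TN * A0 + K * (h * sqrt h) * A1)
     + (2 * h\<^sup>2 * R\<^sup>2 + h * (2 * \<epsilon>) * I + h * (TM + TN)) =
      h * ((h * (1 + 2 * R\<^sup>2) + 2 * K * A1 * sqrt h) + (TM + TN) * (K1 * A0 + 1) + 2 * \<epsilon> * I)"
      by (simp add: algebra_simps power2_eq_square)
    also have "\<dots> \<le> h * \<delta>" using b1 b2 b3 \<delta> h by (intro mult_left_mono) auto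
    finally show "h\<^sup>2 + (h * K1 * TM * A0 + K * (h * sqrt h) * A1) + (h * K1 * TN * A0 + K * (h * sqrt h) * A1)
     + (2 * h\<^sup>2 * R\<^sup>2 + h * (2 * \<epsilon>) * I + h * (TM + TN)) \<le> h * \<delta>" .
  qed
  also have "\<dots> = ennreal h * ennreal \<delta>" using h \<delta> by (simp add: ennreal_mult)
  finally have fin: "(\<integral>\<^sup>+z. \<Phi> R (fst z) \<partial>?L) \<le> ennreal \<delta>"
    using h by (simp add: ennreal_mult_le_mult_iff)
  have "(\<integral>\<^sup>+z. \<Phi> R0 z \<partial>distr ?L (borel \<Otimes>\<^sub>M borel) fst) = (\<integral>\<^sup>+z. \<Phi> R0 (fst z) \<partial>?L)"
    by (rule nn_integral_distr) measurable
  also have "\<dots> \<le> (\<integral>\<^sup>+z. \<Phi> R (fst z) \<partial>?L)" by (intro nn_integral_mono \<Phi>mono)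
  finally have "(\<integral>\<^sup>+z. \<Phi> R0 z \<partial>distr ?L (borel \<Otimes>\<^sub>M borel) fst) \<le> ennreal \<delta>" using fin by simp
  then show ?thesis using coupling_lift[OF \<theta>(1,2)] unfolding \<Phi>_def by blast
qed

section \<open>The expansive case\<close>

text \<open>Dominated convergence from test functions to functions of linear or quadratic growth. A
  gradient growing at most linearly meets \<open>b\<close> in the integrable
  \<open>|b| (1 + |x|)\<close>, and bounded second derivatives meet the squared norm of
  \<open>Sig\<close>. A constant limit Hessian covers both functions needed.\<close>

lemma integral_limit_generator_eq_0:
  fixes Sig :: "real^'n::finite \<Rightarrow> real^'m::finite^'n"
  assumes meas[measurable]: "Sig \<in> borel_measurable borel" "b \<in> borel_measurable borel"
    and sol: "prob_solution Sig b M" and int: "integrable M (coef_size Sig b)"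
    and int2: "integrable M (moment_size Sig b)"
    and s: "\<And>k. s k \<noteq> 0"
    and b1: "\<And>k i x. \<bar>pdiff i (tbump (c k) (s k) a) x\<bar> \<le> K * (1 + norm x)"
    and b2: "\<And>k i j x. \<bar>pdiff i (pdiff j (tbump (c k) (s k) a)) x\<bar> \<le> K"
    and l1: "\<And>i x. (\<lambda>k. pdiff i (tbump (c k) (s k) a) x) \<longlonglongrightarrow> g i x"
    and l2: "\<And>i j x. (\<lambda>k. pdiff i (pdiff j (tbump (c k) (s k) a)) x) \<longlonglongrightarrow> H i j"
  shows "(\<integral>x. (\<Sum>i\<in>UNIV. \<Sum>j\<in>UNIV. ((Sig x ** transpose (Sig x)) $ i $ j) * H i j) + (\<Sum>i\<in>UNIV. b x $ i * g i x) \<partial>M) = 0"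
proof -
  have sM[measurable_cong]: "sets M = sets borel" using sol by (simp add: prob_solution_def)
  note diff_op_tbump_measurable[OF meas, measurable]
  let ?G = "\<lambda>x. (\<Sum>i\<in>UNIV. \<Sum>j\<in>UNIV. ((Sig x ** transpose (Sig x)) $ i $ j) * H i j) + (\<Sum>i\<in>UNIV. b x $ i * g i x)"
  have lim: "(\<lambda>k. diff_op Sig b (tbump (c k) (s k) a) x) \<longlonglongrightarrow> ?G x" for x
    unfolding diff_op_def by (intro tendsto_intros l1 l2)
  have K: "K \<ge> 0" using b2[of undefined undefined undefined undefined] by linarith
  have "(\<lambda>k. \<integral>x. diff_op Sig b (tbump (c k) (s k) a) x \<partial>M) \<longlonglongrightarrow> (\<integral>x. ?G x \<partial>M)"
  proof (rule integral_dominated_convergence)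
    show "integrable M (\<lambda>x. (real CARD('n))\<^sup>2 * K * (coef_size Sig b x + moment_size Sig b x))"
      by (intro integrable_mult_right Bochner_Integration.integrable_add int int2)
    show "?G \<in> borel_measurable M"
      by (rule borel_measurable_LIMSEQ_real[OF lim]) measurable
    show "AE x in M. norm (diff_op Sig b (tbump (c k) (s k) a) x) \<le>
        (real CARD('n))\<^sup>2 * K * (coef_size Sig b x + moment_size Sig b x)" for k
    proof (rule AE_I2)
      fix x
      have "\<bar>diff_op Sig b (tbump (c k) (s k) a) x\<bar> \<le> (real CARD('n))\<^sup>2 * (K * (1 + norm x) * norm (b x) + K * (norm (Sig x))\<^sup>2)"
        unfolding diff_op_eq_gen by (rule abs_gen_le[OF b1 b2])
      also have "\<dots> \<le> (real CARD('n))\<^sup>2 * (K * (1 + norm x) * norm (b x) + K * (norm (Sig x))\<^sup>2 + K * (norm (Sig x))\<^sup>2)"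
        using K by (intro mult_left_mono) auto
      finally show "norm (diff_op Sig b (tbump (c k) (s k) a) x) \<le>
        (real CARD('n))\<^sup>2 * K * (coef_size Sig b x + moment_size Sig b x)"
        by (simp add: algebra_simps)
    qed
  qed (auto intro!: AE_I2 lim)
  moreover have "(\<integral>x. diff_op Sig b (tbump (c k) (s k) a) x \<partial>M) = 0" for k
    by (rule integral_diff_op_tbump(2)[OF meas sol int s])
  ultimately show ?thesis using LIMSEQ_unique[of "\<lambda>_. 0 :: real"] by (metis (no_types, lifting) LIMSEQ_unique tendsto_const ext)
qed

lemma bump_tendsto:
  "s \<longlonglongrightarrow> 0 \<Longrightarrow> (\<lambda>k. bump n (a + s k * x)) \<longlonglongrightarrow> bump n a"
proof -
  assume "s \<longlonglongrightarrow> 0"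
  then have "(\<lambda>k. a + s k * x) \<longlonglongrightarrow> a + 0 * x" by (intro tendsto_intros)
  then have "(\<lambda>k. a + s k * x) \<longlonglongrightarrow> a" by simp
  then show ?thesis by (rule isCont_tendsto_compose[OF isCont_bump])
qed

lemma bump_at_0: "bump 0 0 > 0" "bump 1 0 = 0" "bump 2 0 \<noteq> 0" "bump 1 (1/2) \<noteq> 0"
  by (auto simp: bump_0_eq bump_1_eq[unfolded One_nat_def] bump_2_at_0 power2_eq_square)

text \<open>For small \<open>s\<close> the test function behaves like
  \<open>const / s + \<kappa> x_i\<close>. The shift 1/2 in coordinate \<open>i\<close> makes its
  slope nonzero there, while the other coordinates sit at 0, a critical point of the bump. Second
  derivatives carry a factor \<open>s\<close> and vanish in the limit.\<close>

lemma integral_drift: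
  fixes Sig :: "real^'n::finite \<Rightarrow> real^'m::finite^'n"
  assumes meas[measurable]: "Sig \<in> borel_measurable borel" "b \<in> borel_measurable borel"
    and sol: "prob_solution Sig b M" and int: "integrable M (coef_size Sig b)"
    and int2: "integrable M (moment_size Sig b)"
  shows "(\<integral>x. b x $ i \<partial>M) = 0"
proof -
  define s :: "nat \<Rightarrow> real" where "s k = 1 / Suc k" for k
  have s: "s k \<noteq> 0" "\<bar>s k\<bar> \<le> 1" for k by (auto simp: s_def)
  have s0: "s \<longlonglongrightarrow> 0" unfolding s_def using LIMSEQ_Suc[OF lim_1_over_n] by simp
  obtain C where C: "C \<ge> 1" "\<And>n t. n \<le> 2 \<Longrightarrow> \<bar>bump n t\<bar> \<le> C" using bump_bounded[of 2] by blast
  let ?C = "C ^ CARD('n)"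
  have C0: "?C \<ge> 0" using C(1) by simp
  define a :: "real^'n" where "a = axis i (1/2)"
  let ?f = "\<lambda>k. tbump (1 / s k) (s k) a"
  define \<kappa> where "\<kappa> = (\<Prod>l\<in>UNIV. bump (count_list [i] l) (a $ l))"
  have \<kappa>: "\<kappa> \<noteq> 0" unfolding \<kappa>_def using bump_at_0 by (auto simp: a_def axis_def)
  have p1: "pdiff j (?f k) x = (\<Prod>l\<in>UNIV. bump (count_list [j] l) (a $ l + s k * x $ l))" for j k x
    using iter_pdiff_tbump[of "[j]" "1 / s k" "s k" a] s by simp
  have p2: "pdiff j (pdiff l (?f k)) x = s k * (\<Prod>m\<in>UNIV. bump (count_list [j, l] m) (a $ m + s k * x $ m))" for j l k x
    using iter_pdiff_tbump[of "[j, l]" "1 / s k" "s k" a] s by (simp add: power2_eq_square)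
  have "(\<integral>x. (\<Sum>i\<in>UNIV. \<Sum>j\<in>UNIV. ((Sig x ** transpose (Sig x)) $ i $ j) * 0) + (\<Sum>j\<in>UNIV. b x $ j * (if j = i then \<kappa> else 0)) \<partial>M) = 0"
  proof (rule integral_limit_generator_eq_0[OF meas sol int int2, of s "\<lambda>k. 1 / s k" a ?C])
    show "s k \<noteq> 0" for k by (rule s)
    show "\<bar>pdiff j (?f k) x\<bar> \<le> ?C * (1 + norm x)" for j k x
    proof -
      have "\<bar>pdiff j (?f k) x\<bar> \<le> ?C"
        using iter_pdiff_tbump_bound[of 2 C "[j]" "1 / s k" "s k" a x, OF C(2)] s by (simp add: abs_mult[symmetric])
      also have "?C * 1 \<le> ?C * (1 + norm x)" by (intro mult_left_mono C0) auto
      finally show ?thesis by simp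
    qed
    show "\<bar>pdiff j (pdiff l (?f k)) x\<bar> \<le> ?C" for j l k x
    proof -
      have "\<bar>pdiff j (pdiff l (?f k)) x\<bar> \<le> \<bar>1 / s k\<bar> * \<bar>s k\<bar> ^ 2 * ?C"
        using iter_pdiff_tbump_bound[of 2 C "[j, l]" "1 / s k" "s k" a x, OF C(2)] by (simp add: power2_eq_square)
      also have "\<bar>1 / s k\<bar> * \<bar>s k\<bar> ^ 2 = \<bar>s k\<bar>" by (simp add: power2_eq_square s_def)
      also have "\<bar>s k\<bar> * ?C \<le> 1 * ?C" by (intro mult_right_mono s C0)
      finally show ?thesis by simp
    qed
    show "(\<lambda>k. pdiff j (?f k) x) \<longlonglongrightarrow> (if j = i then \<kappa> else 0)" for j x
    proof -
      have "(\<lambda>k. pdiff j (?f k) x) \<longlonglongrightarrow> (\<Prod>l\<in>UNIV. bump (count_list [j] l) (a $ l))"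
        unfolding p1 by (intro tendsto_prod bump_tendsto s0)
      moreover have "(\<Prod>l\<in>UNIV. bump (count_list [j] l) (a $ l)) = (if j = i then \<kappa> else 0)"
        using bump_at_0 by (auto simp: \<kappa>_def a_def axis_def intro!: prod_zero bexI[of _ j])
      ultimately show ?thesis by simp
    qed
    show "(\<lambda>k. pdiff j (pdiff l (?f k)) x) \<longlonglongrightarrow> 0" for j l x
    proof -
      have "(\<lambda>k. pdiff j (pdiff l (?f k)) x) \<longlonglongrightarrow> 0 * (\<Prod>m\<in>UNIV. bump (count_list [j, l] m) (a $ m))"
        unfolding p2 by (intro tendsto_mult s0 tendsto_prod bump_tendsto)
      then show ?thesis by simp
    qed
  qed
  then have "(\<integral>x. b x $ i * \<kappa> \<partial>M) = 0"
    by (simp add: if_distrib[of "\<lambda>t. _ * t"] cong: if_cong)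
  then show ?thesis using \<kappa> by simp
qed

text \<open>Centred at the critical point 0 and scaled by \<open>1 / s^2\<close>, the test function
  behaves like \<open>const / s^2 + \<kappa> |x|^2 / 2\<close>: gradients tend to
  \<open>\<kappa> x\<close> and Hessians to \<kappa> times the identity.\<close>

lemma integral_energy:
  fixes Sig :: "real^'n::finite \<Rightarrow> real^'m::finite^'n"
  assumes meas[measurable]: "Sig \<in> borel_measurable borel" "b \<in> borel_measurable borel"
    and sol: "prob_solution Sig b M" and int: "integrable M (coef_size Sig b)"
    and int2: "integrable M (moment_size Sig b)"
  shows "(\<integral>x. inner x (b x) + (norm (Sig x))\<^sup>2 \<partial>M) = 0"
proof -
  define s :: "nat \<Rightarrow> real" where "s k = 1 / Suc k" for k
  have s: "s k > 0" "s k \<noteq> 0" "\<bar>s k\<bar> \<le> 1" for k by (auto simp: s_def)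
  have s0: "s \<longlonglongrightarrow> 0" unfolding s_def using LIMSEQ_Suc[OF lim_1_over_n] by simp
  obtain C where C: "C \<ge> 1" "\<And>n t. n \<le> 2 \<Longrightarrow> \<bar>bump n t\<bar> \<le> C" using bump_bounded[of 2] by blast
  let ?C = "C ^ CARD('n)"
  have C0: "?C \<ge> 0" using C(1) by simp
  let ?f = "\<lambda>k. tbump (1 / (s k)\<^sup>2) (s k) (0::real^'n)"
  define \<kappa> where "\<kappa> = bump 2 0 * bump 0 0 ^ (CARD('n) - 1)"
  have \<kappa>: "\<kappa> \<noteq> 0" unfolding \<kappa>_def using bump_at_0 by auto
  have p1: "pdiff j (?f k) x = (bump 1 (s k * x $ j) / s k) * (\<Prod>l\<in>UNIV - {j}. bump 0 (s k * x $ l))" for j k x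
  proof -
    have "pdiff j (?f k) x = (1 / s k) * (\<Prod>l\<in>UNIV. bump (count_list [j] l) (s k * x $ l))"
      using iter_pdiff_tbump[of "[j]" "1 / (s k)\<^sup>2" "s k" "0::real^'n"] s(2)[of k] by (simp add: power2_eq_square)
    also have "(\<Prod>l\<in>UNIV. bump (count_list [j] l) (s k * x $ l)) = bump 1 (s k * x $ j) * (\<Prod>l\<in>UNIV - {j}. bump 0 (s k * x $ l))"
      by (subst prod.remove[of UNIV j]) (auto intro!: prod.cong)
    finally show ?thesis by simp
  qed
  have p2: "pdiff j (pdiff l (?f k)) x = (\<Prod>m\<in>UNIV. bump (count_list [j, l] m) (0 + s k * x $ m))" for j l k x
    using iter_pdiff_tbump[of "[j, l]" "1 / (s k)\<^sup>2" "s k" "0::real^'n"] s(2)[of k] by (simp add: power2_eq_square)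
  \<comment> \<open>Since \<open>bump 1\<close> vanishes at 0, this bounds
    \<open>bump 1 (s x_j) / s\<close> by \<open>C |x_j|\<close> uniformly in \<open>s\<close>, which
    is the linear growth required of the gradients.\<close>
  have mvt: "\<bar>bump 1 t\<bar> \<le> C * \<bar>t\<bar>" for t
  proof -
    have "norm (bump 1 t - bump 1 0) \<le> C * norm (t - 0)"
    proof (rule field_differentiable_bound[of UNIV "bump 1" "bump 2"])
      show "(bump 1 has_field_derivative bump 2 z) (at z within UNIV)" for z
        using bump_has_derivative[of 1 z] by (simp add: numeral_2_eq_2)
      show "norm (bump 2 z) \<le> C" for z using C(2)[of 2 z] by simp
    qed auto
    then show ?thesis using bump_at_0 by simp
  qed
  have "(\<integral>x. (\<Sum>i\<in>UNIV. \<Sum>j\<in>UNIV. ((Sig x ** transpose (Sig x)) $ i $ j) * (if i = j then \<kappa> else 0)) + (\<Sum>j\<in>UNIV. b x $ j * (\<kappa> * x $ j)) \<partial>M) = 0"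
  proof (rule integral_limit_generator_eq_0[OF meas sol int int2, of s "\<lambda>k. 1 / (s k)\<^sup>2" 0 ?C])
    show "s k \<noteq> 0" for k by (rule s)
    show "\<bar>pdiff j (?f k) x\<bar> \<le> ?C * (1 + norm x)" for j k x
    proof -
      have "\<bar>bump 1 (s k * x $ j) / s k\<bar> \<le> C * \<bar>x $ j\<bar>"
        using mvt[of "s k * x $ j"] s(1)[of k] by (simp add: abs_mult field_simps)
      also have "\<dots> \<le> C * (1 + norm x)"
        using C(1) component_le_norm_cart[of x j] by (intro mult_left_mono) auto
      finally have 1: "\<bar>bump 1 (s k * x $ j) / s k\<bar> \<le> C * (1 + norm x)" .
      have "(\<Prod>l\<in>UNIV - {j}. \<bar>bump 0 (s k * x $ l)\<bar>) \<le> (\<Prod>l\<in>UNIV - {j}. C)"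
        by (intro prod_mono) (auto intro: C(2))
      then have 2: "(\<Prod>l\<in>UNIV - {j}. \<bar>bump 0 (s k * x $ l)\<bar>) \<le> C ^ (CARD('n) - 1)"
        by (simp add: card_Diff_singleton)
      have "\<bar>pdiff j (?f k) x\<bar> \<le> (C * (1 + norm x)) * C ^ (CARD('n) - 1)"
        unfolding p1 abs_mult abs_prod using C(1) by (intro mult_mono 1 2) (auto intro!: prod_nonneg)
      also have "\<dots> = C * C ^ (CARD('n) - 1) * (1 + norm x)" by simp
      also have "C * C ^ (CARD('n) - 1) = ?C"
        by (metis power_Suc Suc_diff_1 zero_less_card_finite)
      finally show ?thesis .
    qed
    show "\<bar>pdiff j (pdiff l (?f k)) x\<bar> \<le> ?C" for j l k x
      using iter_pdiff_tbump_bound[of 2 C "[j, l]" "1 / (s k)\<^sup>2" "s k" 0 x, OF C(2)] s(2)[of k] by (simp add: power2_eq_square)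
    show "(\<lambda>k. pdiff j (?f k) x) \<longlonglongrightarrow> \<kappa> * x $ j" for j x
    proof -
      have "(\<lambda>k. bump 1 (s k * x $ j) / s k) \<longlonglongrightarrow> bump 2 0 * x $ j"
      proof -
        have "((\<lambda>t. bump 1 (t * x $ j)) has_real_derivative bump (Suc 1) (0 * x $ j) * x $ j) (at 0)"
          by (rule DERIV_chain2[OF bump_has_derivative]) (auto intro!: derivative_eq_intros)
        then have "((\<lambda>t. bump 1 (t * x $ j) / t) \<longlongrightarrow> bump 2 0 * x $ j) (at 0)"
          using bump_at_0(2) by (simp add: DERIV_def numeral_2_eq_2)
        then show ?thesis
          by (rule filterlim_compose) (use s s0 in \<open>auto simp: filterlim_at\<close>)
      qed
      moreover have "(\<lambda>k. \<Prod>l\<in>UNIV - {j}. bump 0 (s k * x $ l)) \<longlonglongrightarrow> (\<Prod>l\<in>UNIV - {j}. bump 0 0)"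
        using bump_tendsto[OF s0, of 0 0] by (intro tendsto_prod) simp
      ultimately have "(\<lambda>k. pdiff j (?f k) x) \<longlonglongrightarrow> (bump 2 0 * x $ j) * (\<Prod>l\<in>UNIV - {j}. bump 0 0)"
        unfolding p1 by (rule tendsto_mult)
      then show ?thesis by (simp add: \<kappa>_def card_Diff_singleton mult_ac)
    qed
    show "(\<lambda>k. pdiff j (pdiff l (?f k)) x) \<longlonglongrightarrow> (if j = l then \<kappa> else 0)" for j l x
    proof -
      have "(\<lambda>k. pdiff j (pdiff l (?f k)) x) \<longlonglongrightarrow> (\<Prod>m\<in>UNIV. bump (count_list [j, l] m) 0)"
        unfolding p2 by (intro tendsto_prod bump_tendsto s0)
      moreover have "(\<Prod>m\<in>UNIV. bump (count_list [j, l] m) 0) = (if j = l then \<kappa> else 0)"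
      proof (cases "j = l")
        case True
        have "(\<Prod>m\<in>UNIV. bump (count_list [j, l] m) 0) = bump 2 0 * (\<Prod>m\<in>UNIV - {j}. bump (count_list [j, l] m) 0)"
          using True by (subst prod.remove[of UNIV j]) (auto simp: numeral_2_eq_2)
        also have "(\<Prod>m\<in>UNIV - {j}. bump (count_list [j, l] m) 0) = (\<Prod>m\<in>UNIV - {j}. bump 0 0)"
          using True by (intro prod.cong) auto
        finally show ?thesis using True by (simp add: \<kappa>_def card_Diff_singleton)
      next
        case False
        then show ?thesis using bump_at_0 by (auto intro!: prod_zero bexI[of _ j])
      qed
      ultimately show ?thesis by simp
    qed
  qed
  moreover have "(\<Sum>i\<in>UNIV. \<Sum>j\<in>UNIV. ((Sig x ** transpose (Sig x)) $ i $ j) * (if i = j then \<kappa> else 0)) + (\<Sum>j\<in>UNIV. b x $ j * (\<kappa> * x $ j))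
    = (inner x (b x) + (norm (Sig x))\<^sup>2) * \<kappa>" for x
  proof -
    have "(\<Sum>i\<in>UNIV. \<Sum>j\<in>UNIV. ((Sig x ** transpose (Sig x)) $ i $ j) * (if i = j then \<kappa> else 0)) = trace (Sig x ** transpose (Sig x)) * \<kappa>"
      by (simp add: trace_def sum_distrib_right if_distrib[of "\<lambda>t. _ * t"] cong: if_cong)
    then show ?thesis
      unfolding trace_mult_transpose by (simp add: inner_vec_def algebra_simps sum_distrib_left)
  qed
  ultimately have "(\<integral>x. (inner x (b x) + (norm (Sig x))\<^sup>2) * \<kappa> \<partial>M) = 0" by simp
  then show ?thesis using \<kappa> by simp
qed

text \<open>With \<open>u x = inner x (b x) + (norm (Sig x))^2\<close>, expanding \<open>q\<close>
  leaves \<open>u x + u y\<close> and cross terms. Restricting both variables to \<open>B n\<close>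
  gives the integral \<open>J n = 2 m U - 2 inner \<xi> \<beta> - 2 inner S S\<close> with every
  quantity taken at \<open>n\<close>. Here \<open>U n\<close> tends to 0 by the energy identity, the
  last term has a favourable sign, and the middle one is bounded by a tail of the moment. As
  \<open>q >= 0\<close>, \<open>J\<close> increases with \<open>n\<close>, so an upper bound tending
  to 0 makes every \<open>J k\<close> vanish.\<close>

lemma expansive_solution_is_Dirac:
  fixes Sig :: "real^'n::finite \<Rightarrow> real^'m::finite^'n"
  assumes meas[measurable]: "Sig \<in> borel_measurable borel" "b \<in> borel_measurable borel"
    and q: "\<And>x y. x \<noteq> y \<Longrightarrow> qfun Sig b x y > 0"
    and sol: "prob_solution Sig b M" and int: "integrable M (coef_size Sig b)"
    and int2: "integrable M (moment_size Sig b)"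
  shows "\<exists>x0. (AE x in M. x = x0) \<and> b x0 = 0 \<and> Sig x0 = 0"
proof -
  have sM[measurable_cong]: "sets M = sets borel" and "prob_space M" using sol by (auto simp: prob_solution_def)
  interpret prob_space M by fact
  define u where "u x = inner x (b x) + (norm (Sig x))\<^sup>2" for x
  have [measurable]: "u \<in> borel_measurable borel" unfolding u_def by measurable
  have uint: "integrable M u"
  proof (rule Bochner_Integration.integrable_bound[OF int2])
    show "AE x in M. norm (u x) \<le> norm (moment_size Sig b x)"
    proof (rule AE_I2)
      fix x
      have "\<bar>inner x (b x)\<bar> \<le> norm x * norm (b x)" by (rule Cauchy_Schwarz_ineq2)
      then show "norm (u x) \<le> norm (moment_size Sig b x)"
        unfolding u_def using abs_triangle_ineq[of "inner x (b x)" "(norm (Sig x))\<^sup>2"] by (simp add: mult.commute)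
    qed
  qed measurable
  have u0: "(\<integral>x. u x \<partial>M) = 0" unfolding u_def by (rule integral_energy[OF meas sol int int2])
  have bint: "integrable M b"
    by (rule Bochner_Integration.integrable_bound[OF int]) auto
  have Sint: "integrable M Sig"
  proof (rule Bochner_Integration.integrable_bound)
    show "integrable M (\<lambda>x. 1 + coef_size Sig b x)" using int by simp
    show "AE x in M. norm (Sig x) \<le> norm (1 + coef_size Sig b x)"
    proof (rule AE_I2)
      fix x
      have "0 \<le> (norm (Sig x) - 1)\<^sup>2" by simp
      then have "2 * norm (Sig x) \<le> 1 + (norm (Sig x))\<^sup>2" by (simp add: power2_diff)
      then have "norm (Sig x) \<le> 1 + coef_size Sig b x"
        using norm_ge_zero[of "b x"] norm_ge_zero[of "Sig x"] by linarith
      then show "norm (Sig x) \<le> norm (1 + coef_size Sig b x)" by simp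
    qed
  qed measurable
  have b0: "(\<integral>x. b x \<partial>M) = 0"
  proof (rule vec_eq_iff[THEN iffD2], rule allI)
    fix i
    have "(\<integral>x. b x \<partial>M) $ i = (\<integral>x. b x $ i \<partial>M)"
      using integral_bounded_linear[OF bounded_linear_vec_nth bint, of i] by simp
    then show "(\<integral>x. b x \<partial>M) $ i = 0 $ i" using integral_drift[OF meas sol int int2] by simp
  qed
  define B where "B n = cball (0::real^'n) (real n)" for n :: nat
  have Bm[measurable]: "B n \<in> sets borel" for n by (simp add: B_def)
  have Bm'[measurable]: "B n \<in> sets M" for n by (simp add: sM)
  define ind where "ind n x = (indicator (B n) x :: real)" for n x
  have indm[measurable]: "ind n \<in> borel_measurable borel" for n unfolding ind_def by measurable
  have ind01: "0 \<le> ind n x" "ind n x \<le> 1" for n x by (auto simp: ind_def)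
  have intB: "integrable M (\<lambda>x. ind n x *\<^sub>R f x)" if "integrable M f" for f :: "real^'n \<Rightarrow> 'c::{banach, second_countable_topology}" and n
    unfolding ind_def by (rule integrable_mult_indicator[OF Bm' that])
  have xint: "integrable M (\<lambda>x. ind n x *\<^sub>R x)" for n
    by (rule integrable_const_bound[where B="real n"]) (auto simp: ind_def indicator_def B_def)
  define m where "m n = (\<integral>x. ind n x \<partial>M)" for n
  define \<beta> where "\<beta> n = (\<integral>x. ind n x *\<^sub>R b x \<partial>M)" for n
  define \<xi> where "\<xi> n = (\<integral>x. ind n x *\<^sub>R x \<partial>M)" for n
  define S where "S n = (\<integral>x. ind n x *\<^sub>R Sig x \<partial>M)" for n
  define U where "U n = (\<integral>x. ind n x *\<^sub>R u x \<partial>M)" for n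
  have indint: "integrable M (ind n)" for n
    by (rule integrable_const_bound[where B=1]) (auto simp: ind_def)
  have qeq: "qfun Sig b x y = u x + u y - inner x (b y) - inner y (b x) - 2 * inner (Sig x) (Sig y)" for x y
    unfolding qfun_def trace_mult_transpose u_def power2_norm_eq_inner
    by (simp add: inner_diff_left inner_diff_right inner_commute)
  have q0: "qfun Sig b x y \<ge> 0" for x y
    using q[of x y] unfolding qeq by (cases "x = y") (auto simp: u_def power2_norm_eq_inner inner_commute)
  have qm[measurable]: "qfun Sig b x \<in> borel_measurable borel" for x
    unfolding qfun_def trace_mult_transpose by measurable
  let ?Q = "\<lambda>n x y. ind n y * qfun Sig b x y"
  have Qint: "integrable M (?Q n x)" and Qval: "(\<integral>y. ?Q n x y \<partial>M) = m n * u x + U n - inner x (\<beta> n) - inner (\<xi> n) (b x) - 2 * inner (Sig x) (S n)" for n x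
  proof -
    have eq: "?Q n x = (\<lambda>y. ind n y * u x + ind n y *\<^sub>R u y - inner x (ind n y *\<^sub>R b y) - inner (ind n y *\<^sub>R y) (b x) - 2 * inner (Sig x) (ind n y *\<^sub>R Sig y))"
      by (auto simp: qeq algebra_simps)
    have i1: "integrable M (\<lambda>y. ind n y * u x)" using indint by simp
    have i2: "integrable M (\<lambda>y. ind n y *\<^sub>R u y)" by (rule intB[OF uint])
    have i3: "integrable M (\<lambda>y. inner x (ind n y *\<^sub>R b y))" by (intro integrable_inner_right intB bint)
    have i4: "integrable M (\<lambda>y. inner (ind n y *\<^sub>R y) (b x))" by (intro integrable_inner_left xint)
    have i5: "integrable M (\<lambda>y. 2 * inner (Sig x) (ind n y *\<^sub>R Sig y))"
      by (intro integrable_mult_right integrable_inner_right intB Sint)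
    show "integrable M (?Q n x)" unfolding eq
      by (intro Bochner_Integration.integrable_add Bochner_Integration.integrable_diff i1 i2 i3 i4 i5)
    have "(\<integral>y. ?Q n x y \<partial>M) = (\<integral>y. ind n y * u x \<partial>M) + (\<integral>y. ind n y *\<^sub>R u y \<partial>M) - (\<integral>y. inner x (ind n y *\<^sub>R b y) \<partial>M)
       - (\<integral>y. inner (ind n y *\<^sub>R y) (b x) \<partial>M) - (\<integral>y. 2 * inner (Sig x) (ind n y *\<^sub>R Sig y) \<partial>M)"
      unfolding eq using i1 i2 i3 i4 i5
      by (simp only: Bochner_Integration.integral_add Bochner_Integration.integral_diff Bochner_Integration.integrable_add Bochner_Integration.integrable_diff)
    also have "(\<integral>y. inner x (ind n y *\<^sub>R b y) \<partial>M) = inner x (\<beta> n)"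
      unfolding \<beta>_def by (rule integral_inner_right) (intro intB bint)
    also have "(\<integral>y. inner (ind n y *\<^sub>R y) (b x) \<partial>M) = inner (\<xi> n) (b x)"
      unfolding \<xi>_def by (rule integral_inner_left) (intro xint)
    also have "(\<integral>y. 2 * inner (Sig x) (ind n y *\<^sub>R Sig y) \<partial>M) = 2 * inner (Sig x) (S n)"
      unfolding S_def using integral_inner_right[of "Sig x" M "\<lambda>y. ind n y *\<^sub>R Sig y"] intB[OF Sint, of n] by simp
    finally show "(\<integral>y. ?Q n x y \<partial>M) = m n * u x + U n - inner x (\<beta> n) - inner (\<xi> n) (b x) - 2 * inner (Sig x) (S n)"
      by (simp add: m_def U_def)
  qed
  define g where "g n x = (\<integral>y. ?Q n x y \<partial>M)" for n x
  have g0: "g n x \<ge> 0" for n x unfolding g_def using ind01 q0 by (intro integral_nonneg_AE AE_I2) auto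
  define J where "J n = (\<integral>x. ind n x * g n x \<partial>M)" for n
  have geq: "ind n x * g n x = m n * (ind n x *\<^sub>R u x) + U n * ind n x - inner (ind n x *\<^sub>R x) (\<beta> n) - inner (\<xi> n) (ind n x *\<^sub>R b x) - 2 * inner (ind n x *\<^sub>R Sig x) (S n)" for n x
    unfolding g_def Qval by (simp add: algebra_simps)
  have gint: "integrable M (\<lambda>x. ind n x * g n x)" and Jval: "J n = 2 * (m n * U n) - 2 * inner (\<xi> n) (\<beta> n) - 2 * inner (S n) (S n)" for n
  proof -
    have i1: "integrable M (\<lambda>x. m n * (ind n x *\<^sub>R u x))" by (intro integrable_mult_right intB uint)
    have i2: "integrable M (\<lambda>x. U n * ind n x)" by (intro integrable_mult_right indint)
    have i3: "integrable M (\<lambda>x. inner (ind n x *\<^sub>R x) (\<beta> n))" by (intro integrable_inner_left xint)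
    have i4: "integrable M (\<lambda>x. inner (\<xi> n) (ind n x *\<^sub>R b x))" by (intro integrable_inner_right intB bint)
    have i5: "integrable M (\<lambda>x. 2 * inner (ind n x *\<^sub>R Sig x) (S n))" by (intro integrable_mult_right integrable_inner_left intB Sint)
    show "integrable M (\<lambda>x. ind n x * g n x)" unfolding geq
      by (intro Bochner_Integration.integrable_add Bochner_Integration.integrable_diff i1 i2 i3 i4 i5)
    have "J n = (\<integral>x. m n * (ind n x *\<^sub>R u x) \<partial>M) + (\<integral>x. U n * ind n x \<partial>M) - (\<integral>x. inner (ind n x *\<^sub>R x) (\<beta> n) \<partial>M)
      - (\<integral>x. inner (\<xi> n) (ind n x *\<^sub>R b x) \<partial>M) - (\<integral>x. 2 * inner (ind n x *\<^sub>R Sig x) (S n) \<partial>M)"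
      unfolding J_def geq using i1 i2 i3 i4 i5
      by (simp only: Bochner_Integration.integral_add Bochner_Integration.integral_diff Bochner_Integration.integrable_add Bochner_Integration.integrable_diff)
    also have "(\<integral>x. inner (ind n x *\<^sub>R x) (\<beta> n) \<partial>M) = inner (\<xi> n) (\<beta> n)"
      unfolding \<xi>_def by (rule integral_inner_left) (intro xint)
    also have "(\<integral>x. inner (\<xi> n) (ind n x *\<^sub>R b x) \<partial>M) = inner (\<xi> n) (\<beta> n)"
      unfolding \<beta>_def by (rule integral_inner_right) (intro intB bint)
    also have "(\<integral>x. 2 * inner (ind n x *\<^sub>R Sig x) (S n) \<partial>M) = 2 * inner (S n) (S n)"
      using integral_inner_left[of "S n" M "\<lambda>x. ind n x *\<^sub>R Sig x"] intB[OF Sint, of n] by (simp add: S_def)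
    finally show "J n = 2 * (m n * U n) - 2 * inner (\<xi> n) (\<beta> n) - 2 * inner (S n) (S n)"
      by (simp add: U_def m_def)
  qed
  have ind_mono: "ind k x \<le> ind n x" if "k \<le> n" for k n x
    using that by (auto simp: ind_def B_def indicator_def)
  have Jmono: "J k \<le> J n" if "k \<le> n" for k n
    unfolding J_def
  proof (intro integral_mono gint mult_mono ind_mono that ind01 g0)
    fix x
    show "g k x \<le> g n x" unfolding g_def
      by (intro integral_mono Qint mult_right_mono ind_mono that q0)
  qed
  define c where "c n = (\<integral>x. (1 - ind n x) * moment_size Sig b x \<partial>M)" for n
  have ind_lim: "(\<lambda>n. ind n x) \<longlonglongrightarrow> 1" for x
  proof (rule tendsto_eventually)
    obtain n0 where "norm x \<le> real n0" using real_arch_simple by blast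
    then show "\<forall>\<^sub>F n in sequentially. ind n x = 1"
      by (intro eventually_sequentiallyI[of n0]) (auto simp: ind_def B_def)
  qed
  have "c \<longlonglongrightarrow> (\<integral>x. (1 - 1) * moment_size Sig b x \<partial>M)"
    unfolding c_def
  proof (rule integral_dominated_convergence[OF _ _ int2])
    show "AE x in M. (\<lambda>n. (1 - ind n x) * moment_size Sig b x) \<longlonglongrightarrow> (1 - 1) * moment_size Sig b x"
      by (intro AE_I2 tendsto_intros ind_lim)
    show "AE x in M. norm ((1 - ind n x) * moment_size Sig b x) \<le> moment_size Sig b x" for n
      by (intro AE_I2) (auto simp: ind_def indicator_def)
  qed measurable
  then have c0: "c \<longlonglongrightarrow> 0" by simp
  have "U \<longlonglongrightarrow> (\<integral>x. 1 *\<^sub>R u x \<partial>M)"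
    unfolding U_def
  proof (rule integral_dominated_convergence[where w="\<lambda>x. \<bar>u x\<bar>"])
    show "AE x in M. (\<lambda>n. ind n x *\<^sub>R u x) \<longlonglongrightarrow> 1 *\<^sub>R u x" by (intro AE_I2 tendsto_intros ind_lim)
    show "AE x in M. norm (ind n x *\<^sub>R u x) \<le> \<bar>u x\<bar>" for n by (intro AE_I2) (auto simp: ind_def indicator_def)
  qed (use uint in auto)
  then have U0: "U \<longlonglongrightarrow> 0" using u0 by simp
  \<comment> \<open>\<open>\<xi> n\<close> may grow like \<open>n\<close>. Since \<open>b\<close>
    has integral 0, \<open>\<beta> n\<close> is minus the integral of \<open>b\<close> outside the
    ball, where \<open>n <= norm x\<close>; the factor \<open>n\<close> is thus absorbed by the
    moment \<open>|b| |x|\<close>.\<close>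
  have \<xi>\<beta>: "- inner (\<xi> n) (\<beta> n) \<le> c n" for n
  proof -
    have "norm (\<xi> n) \<le> real n"
    proof -
      have "norm (\<xi> n) \<le> (\<integral>x. norm (ind n x *\<^sub>R x) \<partial>M)" unfolding \<xi>_def by (rule integral_norm_bound)
      also have "\<dots> \<le> (\<integral>x. real n \<partial>M)"
        by (intro integral_mono integrable_norm xint) (auto simp: ind_def B_def indicator_def)
      finally show ?thesis by (simp add: prob_space)
    qed
    have i: "integrable M (\<lambda>x. (1 - ind n x) *\<^sub>R b x)"
      using Bochner_Integration.integrable_diff[OF bint intB[OF bint, of n]] by (simp add: scaleR_diff_left)
    have "(\<integral>x. (1 - ind n x) *\<^sub>R b x \<partial>M) = (\<integral>x. b x \<partial>M) - \<beta> n"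
      unfolding \<beta>_def by (subst Bochner_Integration.integral_diff[symmetric]) (auto simp: scaleR_diff_left bint intB)
    then have "\<beta> n = - (\<integral>x. (1 - ind n x) *\<^sub>R b x \<partial>M)" using b0 by simp
    then have "norm (\<beta> n) = norm (\<integral>x. (1 - ind n x) *\<^sub>R b x \<partial>M)" by (simp only: norm_minus_cancel)
    also have "\<dots> \<le> (\<integral>x. norm ((1 - ind n x) *\<^sub>R b x) \<partial>M)" by (rule integral_norm_bound)
    finally have "norm (\<beta> n) \<le> (\<integral>x. norm ((1 - ind n x) *\<^sub>R b x) \<partial>M)" .
    then have "real n * norm (\<beta> n) \<le> real n * (\<integral>x. norm ((1 - ind n x) *\<^sub>R b x) \<partial>M)"
      by (intro mult_left_mono) auto
    also have "\<dots> = (\<integral>x. real n * norm ((1 - ind n x) *\<^sub>R b x) \<partial>M)" by simp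
    also have "\<dots> \<le> c n" unfolding c_def
    proof (rule integral_mono)
      show "integrable M (\<lambda>x. real n * norm ((1 - ind n x) *\<^sub>R b x))" by (intro integrable_mult_right integrable_norm i)
      show "integrable M (\<lambda>x. (1 - ind n x) * moment_size Sig b x)"
        using Bochner_Integration.integrable_diff[OF int2 intB[OF int2, of n]] by (simp add: left_diff_distrib)
      fix x
      show "real n * norm ((1 - ind n x) *\<^sub>R b x) \<le> (1 - ind n x) * moment_size Sig b x"
      proof (cases "x \<in> B n")
        case False
        then have "real n \<le> norm x" by (simp add: B_def)
        then have "real n * norm (b x) \<le> norm x * norm (b x)" by (intro mult_right_mono) auto
        then show ?thesis using False by (simp add: ind_def mult.commute add_increasing)
      qed (simp add: ind_def)
    qed
    finally have "real n * norm (\<beta> n) \<le> c n" .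
    moreover have "- inner (\<xi> n) (\<beta> n) \<le> norm (\<xi> n) * norm (\<beta> n)"
      using Cauchy_Schwarz_ineq2[of "\<xi> n" "\<beta> n"] by linarith
    moreover have "norm (\<xi> n) * norm (\<beta> n) \<le> real n * norm (\<beta> n)"
      by (intro mult_right_mono) (use \<open>norm (\<xi> n) \<le> real n\<close> in auto)
    ultimately show ?thesis by linarith
  qed
  have m01: "\<bar>m n\<bar> \<le> 1" for n
  proof -
    have "m n \<le> (\<integral>x. 1 \<partial>M)" unfolding m_def by (intro integral_mono indint ind01) auto
    moreover have "m n \<ge> 0" unfolding m_def using ind01 by (intro integral_nonneg_AE AE_I2)
    ultimately show ?thesis by (simp add: prob_space)
  qed
  have Jle: "J n \<le> 2 * \<bar>U n\<bar> + 2 * c n" for n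
  proof -
    have "\<bar>m n * U n\<bar> \<le> 1 * \<bar>U n\<bar>" unfolding abs_mult by (intro mult_right_mono m01) auto
    then have "m n * U n \<le> \<bar>U n\<bar>" by linarith
    then show ?thesis using Jval[of n] \<xi>\<beta>[of n] inner_ge_zero[of "S n"] by linarith
  qed
  have J0: "J k = 0" for k
  proof -
    have "(\<lambda>n. 2 * \<bar>U n\<bar> + 2 * c n) \<longlonglongrightarrow> 2 * \<bar>0\<bar> + 2 * 0" by (intro tendsto_intros U0 c0)
    moreover have "\<exists>n0. \<forall>n\<ge>n0. J k \<le> 2 * \<bar>U n\<bar> + 2 * c n"
      using Jmono Jle order_trans by blast
    ultimately have "J k \<le> 2 * \<bar>0\<bar> + 2 * 0" by (rule LIMSEQ_le_const)
    moreover have "J k \<ge> 0" unfolding J_def using ind01 g0 by (intro integral_nonneg_AE AE_I2) auto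
    ultimately show ?thesis by simp
  qed
  have "AE x in M. \<forall>k. ind k x * g k x = 0"
  proof (subst AE_all_countable, rule allI)
    fix k
    show "AE x in M. ind k x * g k x = 0"
      using J0[of k] ind01 g0 unfolding J_def by (subst (asm) integral_nonneg_eq_0_iff_AE[OF gint]) auto
  qed
  \<comment> \<open>A single point with vanishing sections at all levels is enough:
    \<open>qfun Sig b x0 y = 0\<close> for almost every \<open>y\<close>, and strict positivity off
    the diagonal forces \<open>y = x0\<close>.\<close>
  then obtain x0 where x0: "\<And>k. ind k x0 * g k x0 = 0"
    using eventually_happens'[OF ae_filter_bot] by blast
  have "AE y in M. \<forall>k. norm x0 \<le> real k \<longrightarrow> ind k y * qfun Sig b x0 y = 0"
  proof (subst AE_all_countable, rule allI)
    fix k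
    show "AE y in M. norm x0 \<le> real k \<longrightarrow> ind k y * qfun Sig b x0 y = 0"
    proof (cases "norm x0 \<le> real k")
      case True
      then have "g k x0 = 0" using x0[of k] by (simp add: ind_def B_def)
      then have "AE y in M. ind k y * qfun Sig b x0 y = 0"
        unfolding g_def using ind01 q0 by (subst (asm) integral_nonneg_eq_0_iff_AE[OF Qint]) auto
      then show ?thesis by simp
    qed simp
  qed
  then have ae: "AE y in M. y = x0"
  proof eventually_elim
    fix y assume y: "\<forall>k. norm x0 \<le> real k \<longrightarrow> ind k y * qfun Sig b x0 y = 0"
    obtain k where k: "max (norm x0) (norm y) \<le> real k" using real_arch_simple by blast
    then have "qfun Sig b x0 y = 0" using y[rule_format, of k] by (simp add: ind_def B_def)
    then show "y = x0" using q[of x0 y] by auto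
  qed
  have "(\<integral>x. f x \<partial>M) = f x0" if [measurable]: "f \<in> borel_measurable borel" for f :: "real^'n \<Rightarrow> 'c::{banach, second_countable_topology}"
  proof -
    have "(\<integral>x. f x \<partial>M) = (\<integral>x. f x0 \<partial>M)"
      using ae by (intro integral_cong_AE) (auto elim: eventually_mono)
    then show ?thesis by (simp add: prob_space)
  qed
  note c = this
  \<comment> \<open>For a measure concentrated at \<open>x0\<close> the two integral identities
    become pointwise: \<open>b x0 = 0\<close>, then \<open>u x0 = 0\<close>, which leaves the
    squared norm of \<open>Sig x0\<close>.\<close>
  have bx: "b x0 = 0" using c[OF meas(2)] b0 by simp
  moreover have "u x0 = 0" using c[of u] u0 by simp
  then have "Sig x0 = 0" using bx by (simp add: u_def)
  ultimately show ?thesis using ae by blast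
qed

lemma expansive_unique:
  fixes Sig :: "real^'n::finite \<Rightarrow> real^'m::finite^'n"
  assumes meas: "Sig \<in> borel_measurable borel" "b \<in> borel_measurable borel"
    and q: "\<And>x y. x \<noteq> y \<Longrightarrow> qfun Sig b x y > 0"
    and M: "prob_solution Sig b M" "integrable M (coef_size Sig b)" "integrable M (moment_size Sig b)"
    and N: "prob_solution Sig b N" "integrable N (coef_size Sig b)" "integrable N (moment_size Sig b)"
  shows "M = N"
proof -
  obtain x0 where x0: "AE x in M. x = x0" "b x0 = 0" "Sig x0 = 0"
    using expansive_solution_is_Dirac[OF meas q M] by blast
  obtain y0 where y0: "AE x in N. x = y0" "b y0 = 0" "Sig y0 = 0"
    using expansive_solution_is_Dirac[OF meas q N] by blast
  have "qfun Sig b x0 y0 = 0" unfolding qfun_def trace_mult_transpose using x0 y0 by simp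
  then have xy: "x0 = y0" using q[of x0 y0] by auto
  have sM: "sets M = sets borel" "prob_space M" and sN: "sets N = sets borel" "prob_space N"
    using M(1) N(1) by (auto simp: prob_solution_def)
  have dirac: "emeasure M' A = indicator A x0" if "AE x in M'. x = x0" "prob_space M'" "A \<in> sets M'" for M' A
  proof -
    interpret prob_space M' by fact
    show ?thesis
    proof (cases "x0 \<in> A")
      case True
      then have "AE x in M'. x \<in> A" using that(1) by (auto elim: eventually_mono)
      then show ?thesis using True emeasure_eq_1_AE[OF that(3)] by simp
    next
      case False
      then have "AE x in M'. x \<notin> A" using that(1) by (auto elim: eventually_mono)
      then show ?thesis using False AE_iff_null_sets[OF that(3)] by auto
    qed
  qed
  show ?thesis
    by (rule measure_eqI) (use sM sN dirac[of M] dirac[of N] x0 y0 xy in auto)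
qed

theorem theorem1:
  fixes Sig :: "real^'n::finite \<Rightarrow> real^'m::finite^'n"
    and b :: "real^'n \<Rightarrow> real^'n"
  assumes "Sig \<in> borel_measurable borel"
    and "b \<in> borel_measurable borel"
    and "(\<forall>x y. x \<noteq> y \<longrightarrow> qfun Sig b x y > 0) \<or> (\<forall>x y. x \<noteq> y \<longrightarrow> qfun Sig b x y < 0)"
  shows "\<forall>\<mu> \<nu>. prob_solution Sig b \<mu>
           \<and> (\<integral>\<^sup>+x. ennreal ((norm (Sig x))\<^sup>2 + norm (b x) * norm x) \<partial>\<mu>) < \<infinity>
           \<and> prob_solution Sig b \<nu>
           \<and> (\<integral>\<^sup>+x. ennreal ((norm (Sig x))\<^sup>2 + norm (b x) * norm x) \<partial>\<nu>) < \<infinity>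
           \<longrightarrow> \<mu> = \<nu>"
proof (intro allI impI, elim conjE)
  fix M N :: "(real^'n) measure"
  assume M: "prob_solution Sig b M" "(\<integral>\<^sup>+x. ennreal ((norm (Sig x))\<^sup>2 + norm (b x) * norm x) \<partial>M) < \<infinity>"
    and N: "prob_solution Sig b N" "(\<integral>\<^sup>+x. ennreal ((norm (Sig x))\<^sup>2 + norm (b x) * norm x) \<partial>N) < \<infinity>"
  note meas = assms(1,2)
  have iM: "integrable M (coef_size Sig b)" and iN: "integrable N (coef_size Sig b)"
    by (rule coef_size_integrable[OF meas M], rule coef_size_integrable[OF meas N])
  show "M = N"
  proof (rule disjE[OF assms(3)])
    assume q: "\<forall>x y. x \<noteq> y \<longrightarrow> qfun Sig b x y > 0"
    have int2: "integrable P (\<lambda>x. (norm (Sig x))\<^sup>2 + norm (b x) * norm x)"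
      if P: "prob_solution Sig b P" "(\<integral>\<^sup>+x. ennreal ((norm (Sig x))\<^sup>2 + norm (b x) * norm x) \<partial>P) < \<infinity>" for P
    proof -
      note meas[measurable]
      have [measurable_cong]: "sets P = sets borel" using P(1) by (simp add: prob_solution_def)
      show ?thesis by (rule integrableI_nonneg) (use P(2) in auto)
    qed
    show ?thesis
      by (rule expansive_unique[OF meas _ M(1) iM int2[OF M] N(1) iN int2[OF N]]) (use q in blast)
  next
    assume q: "\<forall>x y. x \<noteq> y \<longrightarrow> qfun Sig b x y < 0"
    then have q': "\<And>x y. x \<noteq> y \<Longrightarrow> qfun Sig b x y < 0" by blast
    show ?thesis
      using dissipative_coupling_imp_eq[OF meas q' _ _ _ _ dissipative_couplings[OF meas q' M(1) iM N(1) iN]]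
        M(1) N(1) by (auto simp: prob_solution_def)
  qed
qed

end
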